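(* Let $g:\mathbb{U}\to\mathbb{C}$ be a univalent function such that $g(0)=1$ and $\Re g(\zeta)>0$ for $\zeta\in\mathbb{U}$. Then $$S^*_g(\mathbb{B}^n)=\overline{S^*_g(\mathbb{B}^n)\cap\mathcal{A}(\mathbb{B}^n)}\quad\text{for all } n\ge 2.$$
   Context: $\mathbb{U}$ is the open unit disc in $\mathbb{C}$ and $\mathbb{B}^n$ the open Euclidean unit ball of $\mathbb{C}^n$, with inner product $\langle z,w\rangle=\sum_{j=1}^n z_j\overline{w}_j$. Univalent means holomorphic and injective. $H(\mathbb{B}^n)$ is the space of holomorphic mappings $\mathbb{B}^n\to\mathbb{C}^n$ with the topology of locally uniform convergence; the overline denotes closure in $H(\mathbb{B}^n)$. $\mathcal{L}S(\mathbb{B}^n)$ is the set of locally biholomorphic $f\in H(\mathbb{B}^n)$ with $f(0)=0$, $Df(0)=I_n$. $S_g^*(\mathbb{B}^n)$ is the set of $g$-starlike mappings: all $f\in\mathcal{L}S(\mathbb{B}^n)$ such that $\frac{1}{\|z\|^2}\langle [Df(z)]^{-1}f(z),z\rangle\in g(\mathbb{U})$ for all $z\in\mathbb{B}^n\setminus\{0\}$. $\mathrm{Aut}(\mathbb{C}^n)$ is the set of holomorphic automorphisms of $\mathbb{C}^n$ and $\mathcal{A}(\mathbb{B}^n)=\{\Phi|_{\mathbb{B}^n}:\Phi\in\mathrm{Aut}(\mathbb{C}^n)\}$. *)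

theory Defs
  imports "HOL-Analysis.Analysis" "HOL-Library.FuncSet"
begin

abbreviation unit_ball :: "(complex^'n) set" where
  "unit_ball \<equiv> ball 0 1"

definition herm_inner :: "complex^'n \<Rightarrow> complex^'n \<Rightarrow> complex" where
  "herm_inner z w = (\<Sum>j\<in>UNIV. z $ j * cnj (w $ j))"

(* The Frechet derivative at each point is complex linear. Used only for open S. *)
definition cn_holomorphic_on :: "(complex^'n \<Rightarrow> complex^'m) \<Rightarrow> (complex^'n) set \<Rightarrow> bool" where
  "cn_holomorphic_on f S \<longleftrightarrow>
     (\<forall>z\<in>S. \<exists>A :: complex^'n^'m. (f has_derivative (\<lambda>h. A *v h)) (at z within S))"

definition cn_biholomorphic_on :: "(complex^'n \<Rightarrow> complex^'n) \<Rightarrow> (complex^'n) set \<Rightarrow> bool" where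
  "cn_biholomorphic_on f U \<longleftrightarrow>
     open U \<and> open (f ` U) \<and> inj_on f U \<and> cn_holomorphic_on f U \<and>
     cn_holomorphic_on (inv_into U f) (f ` U)"

definition cn_locally_biholomorphic_on :: "(complex^'n \<Rightarrow> complex^'n) \<Rightarrow> (complex^'n) set \<Rightarrow> bool" where
  "cn_locally_biholomorphic_on f S \<longleftrightarrow>
     (\<forall>z\<in>S. \<exists>U. z \<in> U \<and> U \<subseteq> S \<and> cn_biholomorphic_on f U)"

(* A map with domain the ball is represented by a total function that is
   "undefined" off the ball, so that equality in H_ball is equality on the ball. *)
definition H_ball :: "(complex^'n \<Rightarrow> complex^'n) set" where
  "H_ball = {f \<in> extensional unit_ball. cn_holomorphic_on f unit_ball}"

(* The topology of uniform convergence on compact subsets of the ball, which is the topology of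
   locally uniform convergence since the ball is locally compact. *)
definition H_open :: "(complex^'n \<Rightarrow> complex^'n) set \<Rightarrow> bool" where
  "H_open W \<longleftrightarrow> W \<subseteq> H_ball \<and>
     (\<forall>f\<in>W. \<exists>K e. compact K \<and> K \<subseteq> unit_ball \<and> e > 0 \<and>
        {h \<in> H_ball. \<forall>z\<in>K. dist (h z) (f z) < e} \<subseteq> W)"

definition H_topology :: "(complex^'n \<Rightarrow> complex^'n) topology" where
  "H_topology = topology H_open"

lemma istopology_H_open: "istopology (H_open :: (complex^'n \<Rightarrow> complex^'n) set \<Rightarrow> bool)"
  unfolding istopology_def
proof (intro conjI allI impI)
  fix S T :: "(complex^'n \<Rightarrow> complex^'n) set"
  assume S: "H_open S" and T: "H_open T"
  show "H_open (S \<inter> T)"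
    unfolding H_open_def
  proof (intro conjI ballI)
    show "S \<inter> T \<subseteq> H_ball" using S by (auto simp: H_open_def)
    fix f assume f: "f \<in> S \<inter> T"
    obtain K d where K: "compact K" "K \<subseteq> unit_ball" "d > 0"
      "{h \<in> H_ball. \<forall>z\<in>K. dist (h z) (f z) < d} \<subseteq> S"
      using S f unfolding H_open_def by blast
    obtain L e where L: "compact L" "L \<subseteq> unit_ball" "e > 0"
      "{h \<in> H_ball. \<forall>z\<in>L. dist (h z) (f z) < e} \<subseteq> T"
      using T f unfolding H_open_def by blast
    have "{h \<in> H_ball. \<forall>z\<in>K \<union> L. dist (h z) (f z) < min d e} \<subseteq> S \<inter> T"
      using K(4) L(4) by auto
    moreover have "compact (K \<union> L)" "K \<union> L \<subseteq> unit_ball" "min d e > 0"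
      using K L by auto
    ultimately show "\<exists>K e. compact K \<and> K \<subseteq> unit_ball \<and> e > 0 \<and>
        {h \<in> H_ball. \<forall>z\<in>K. dist (h z) (f z) < e} \<subseteq> S \<inter> T"
      by blast
  qed
next
  fix \<K> :: "(complex^'n \<Rightarrow> complex^'n) set set"
  assume H: "\<forall>S\<in>\<K>. H_open S"
  show "H_open (\<Union>\<K>)"
    unfolding H_open_def
  proof (intro conjI ballI)
    show "\<Union>\<K> \<subseteq> H_ball" using H by (auto simp: H_open_def)
    fix f assume "f \<in> \<Union>\<K>"
    then obtain S where S: "S \<in> \<K>" "f \<in> S" by blast
    then obtain K e where "compact K" "K \<subseteq> unit_ball" "e > 0"
      "{h \<in> H_ball. \<forall>z\<in>K. dist (h z) (f z) < e} \<subseteq> S"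
      using H unfolding H_open_def by meson
    with S show "\<exists>K e. compact K \<and> K \<subseteq> unit_ball \<and> e > 0 \<and>
        {h \<in> H_ball. \<forall>z\<in>K. dist (h z) (f z) < e} \<subseteq> \<Union>\<K>"
      by blast
  qed
qed

lemma openin_H_topology: "openin H_topology W \<longleftrightarrow> H_open W"
  by (simp add: H_topology_def istopology_H_open)

lemma topspace_H_topology: "topspace H_topology = H_ball"
proof -
  have "H_open H_ball"
    unfolding H_open_def by (auto intro!: exI[of _ "{}"] exI[of _ "1::real"])
  then show ?thesis
    unfolding topspace_def openin_H_topology by (auto simp: H_open_def)
qed

lemma limitin_H_topology:
  fixes f :: "complex^'n \<Rightarrow> complex^'n"
  assumes "\<forall>\<^sub>F i in F. h i \<in> H_ball"
  shows "limitin H_topology h f F \<longleftrightarrow>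
    f \<in> H_ball \<and> (\<forall>K. compact K \<and> K \<subseteq> unit_ball \<longrightarrow> uniform_limit K h f F)"
proof (intro iffI conjI allI impI)
  assume L: "limitin H_topology h f F"
  then show f: "f \<in> H_ball" by (simp add: limitin_def topspace_H_topology)
  fix K :: "(complex^'n) set" assume K: "compact K \<and> K \<subseteq> unit_ball"
  show "uniform_limit K h f F"
    unfolding uniform_limit_iff
  proof (intro allI impI)
    fix e :: real assume "e > 0"
    \<comment> \<open>the functions at distance less than e on K, with a uniform gap, form an open set\<close>
    define W where "W = {k \<in> H_ball. \<exists>d>0. \<forall>z\<in>K. dist (k z) (f z) < e - d}"
    have "H_open W"
      unfolding H_open_def
    proof (intro conjI ballI)
      show "W \<subseteq> H_ball" by (auto simp: W_def)
      fix k assume "k \<in> W"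
      then obtain d where d: "d > 0" "\<forall>z\<in>K. dist (k z) (f z) < e - d" by (auto simp: W_def)
      have "{j \<in> H_ball. \<forall>z\<in>K. dist (j z) (k z) < d/2} \<subseteq> W"
      proof
        fix j assume j: "j \<in> {j \<in> H_ball. \<forall>z\<in>K. dist (j z) (k z) < d/2}"
        have "dist (j z) (f z) < e - d/2" if "z \<in> K" for z
        proof -
          have "dist (j z) (k z) < d/2" "dist (k z) (f z) < e - d" using j d that by auto
          then show ?thesis using dist_triangle[of "j z" "f z" "k z"] by linarith
        qed
        then show "j \<in> W"
          using j d(1) unfolding W_def by (auto intro!: exI[of _ "d/2"])
      qed
      then show "\<exists>K e. compact K \<and> K \<subseteq> unit_ball \<and> e > 0 \<and>
          {h \<in> H_ball. \<forall>z\<in>K. dist (h z) (k z) < e} \<subseteq> W"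
        using K d(1) by (intro exI[of _ K] exI[of _ "d/2"]) auto
    qed
    moreover have "f \<in> W"
      using f \<open>e > 0\<close> unfolding W_def by (auto intro!: exI[of _ "e/2"])
    ultimately have "\<forall>\<^sub>F i in F. h i \<in> W"
      using L by (auto simp: limitin_def openin_H_topology)
    then show "\<forall>\<^sub>F i in F. \<forall>z\<in>K. dist (h i z) (f z) < e"
      by eventually_elim (fastforce simp: W_def)
  qed
next
  assume R: "f \<in> H_ball \<and> (\<forall>K. compact K \<and> K \<subseteq> unit_ball \<longrightarrow> uniform_limit K h f F)"
  show "limitin H_topology h f F"
    unfolding limitin_def topspace_H_topology openin_H_topology
  proof (intro conjI allI impI)
    show "f \<in> H_ball" using R by blast
    fix W :: "(complex^'n \<Rightarrow> complex^'n) set" assume W: "H_open W \<and> f \<in> W"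
    then obtain K e where K: "compact K" "K \<subseteq> unit_ball" "e > 0"
      "{k \<in> H_ball. \<forall>z\<in>K. dist (k z) (f z) < e} \<subseteq> W"
      unfolding H_open_def by meson
    have "\<forall>\<^sub>F i in F. \<forall>z\<in>K. dist (h i z) (f z) < e"
      using R K unfolding uniform_limit_iff by blast
    then show "\<forall>\<^sub>F i in F. h i \<in> W"
      using assms by eventually_elim (use K(4) in blast)
  qed
qed

(* The complex Jacobian matrix of a holomorphic map: its j-th column is the
   derivative in the direction of the j-th standard basis vector. *)
abbreviation Df :: "(complex^'n \<Rightarrow> complex^'n) \<Rightarrow> complex^'n \<Rightarrow> complex^'n^'n" where
  "Df f z \<equiv> matrix (frechet_derivative f (at z))"

definition LS_ball :: "(complex^'n \<Rightarrow> complex^'n) set" where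
  "LS_ball = {f \<in> H_ball. cn_locally_biholomorphic_on f unit_ball \<and> f 0 = 0 \<and> Df f 0 = mat 1}"

definition g_starlike :: "(complex \<Rightarrow> complex) \<Rightarrow> (complex^'n \<Rightarrow> complex^'n) set" where
  "g_starlike g = {f \<in> LS_ball. \<forall>z \<in> unit_ball - {0}.
     herm_inner (matrix_inv (Df f z) *v f z) z / of_real ((norm z)\<^sup>2) \<in> g ` ball 0 1}"

definition Aut_Cn :: "(complex^'n \<Rightarrow> complex^'n) set" where
  "Aut_Cn = {\<Phi>. bij \<Phi> \<and> cn_holomorphic_on \<Phi> UNIV \<and> cn_holomorphic_on (inv \<Phi>) UNIV}"

definition A_ball :: "(complex^'n \<Rightarrow> complex^'n) set" where
  "A_ball = (\<lambda>\<Phi>. restrict \<Phi> unit_ball) ` Aut_Cn"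

end

theory Submission
  imports Defs "HOL-Complex_Analysis.Great_Picard"
begin

text \<open>
  Closedness: for \<open>g\<close>-starlike \<open>f\<close> put \<open>h = (Df)\<^sup>-\<^sup>1 f\<close>. By the Schwarz lemma for \<open>g\<^sup>-\<^sup>1\<close> composed with
  \<open>\<zeta> \<mapsto> \<langle>h(\<zeta> u), u\<rangle> / \<zeta>\<close>, the quotient at \<open>z\<close> lies in the compact set \<open>g(cball 0 \<bar>z\<bar>)\<close>, which is
  stable under limits; \<open>det Df\<close> stays zero-free by Hurwitz' theorem on complex lines.

  Density: no Andersen-Lempert theorem for non-autonomous fields and no Runge property of the image is
  needed, because \<open>f\<close> linearises the autonomous flow of \<open>- h\<close>. On smaller balls \<open>h\<close> is approximated by
  Taylor polynomials, and since \<open>n \<ge> 2\<close> polynomial fields are sums of shear and overshear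
  fields, whose flows are automorphisms. This gives automorphisms \<open>E\<close> with
  \<open>\<bar>E(w) - w + s h(w)\<bar> \<le> s \<delta> \<bar>w\<bar>\<^sup>2\<close> and \<open>DE(0) = (1 - s) I\<close>, where \<open>\<delta>\<close> is as small as desired, so
  that \<open>f \<circ> E\<close> is close to \<open>(1 - s) f\<close>. Then
  \<open>(1 - s)\<^sup>-\<^sup>k E\<^sup>k\<close> is an automorphism close to \<open>f\<close> for large \<open>k\<close>, and a slight dilation of it is
  \<open>g\<close>-starlike on the whole unit ball.
\<close>

subsection \<open>Holomorphy along complex lines\<close>

text \<open>The error budget shapes the construction. As \<open>Df f w *v hfield f w = f w\<close>,
  a step of size \<open>s\<close> along \<open>- hfield f\<close> should become multiplication by
  \<open>1 - s\<close> under \<open>f\<close>. Undoing \<open>k\<close> steps by the factor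
  \<open>(1 - s) ^ k\<close> magnifies every error: an error of size s \<delta> |w| per step would
  keep its relative size and add up without bound, whereas |w|^2 decays like
  \<open>(1 - s) ^ (2 * k)\<close> and leaves a geometric series whose sum is of order \<delta>,
  whatever \<open>s\<close> and \<open>k\<close> are. Hence \<open>E\<close> must have derivative
  exactly \<open>1 - s\<close> at 0, and every approximation must agree with its target to second
  order there; this is why the polynomials are stripped of their terms of degree below two.
  Positivity of Re g makes |w| decrease under a step, so the iterates never leave the ball on which
  the estimates hold. The quotient defining starlikeness, with its denominator |z|^2, survives
  approximation near 0 because the error of \<open>hfield\<close> vanishes at 0 as well.\<close>

lemma norm_smult_vec: "norm (c *s v) = norm c * norm (v::complex^'n)"
  by (simp add: norm_vec_def norm_mult L2_set_right_distrib)

lemma continuous_on_smult [continuous_intros]: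
  fixes g :: "'a::topological_space \<Rightarrow> complex^'n"
  assumes "continuous_on S f" "continuous_on S g"
  shows "continuous_on S (\<lambda>x. f x *s g x)"
  using assms unfolding vector_scalar_mult_def by (intro continuous_intros)

lemma tendsto_smult [tendsto_intros]:
  fixes g :: "'a \<Rightarrow> complex^'n"
  assumes "(f \<longlongrightarrow> a) F" "(g \<longlongrightarrow> b) F"
  shows "((\<lambda>x. f x *s g x) \<longlongrightarrow> a *s b) F"
  using assms unfolding vector_scalar_mult_def by (intro tendsto_intros)

lemma has_derivative_smult:
  fixes g :: "complex^'m \<Rightarrow> complex^'n"
  assumes "(f has_derivative f') (at x within S)" "(g has_derivative g') (at x within S)"
  shows "((\<lambda>x. f x *s g x) has_derivative (\<lambda>h. f x *s g' h + f' h *s g x)) (at x within S)"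
proof -
  have "bounded_bilinear (\<lambda>(c::complex) (v::complex^'n). c *s v)"
    by (unfold_locales)
      (auto simp: vector_add_ldistrib vector_sadd_rdistrib vec_eq_iff norm_smult_vec intro!: exI[of _ 1])
  from bounded_bilinear.FDERIV[OF this assms] show ?thesis .
qed

text \<open>Cauchy's inequalities bound the k-th coefficient by \<open>B / R ^ k\<close>, so the
  tail is dominated by a geometric series of ratio \<open>norm z / R\<close>.\<close>

lemma taylor_remainder_bound:
  fixes f :: "complex \<Rightarrow> complex"
  assumes hol: "f holomorphic_on ball 0 R" and cont: "continuous_on (cball 0 R) f"
    and bd: "\<And>z. norm z = R \<Longrightarrow> norm (f z) \<le> B" and z: "norm z < R"
  shows "norm (f z - (\<Sum>k<K. (deriv ^^ k) f 0 / fact k * z ^ k))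
          \<le> B * (norm z / R) ^ K / (1 - norm z / R)"
proof -
  have R: "R > 0" using z norm_ge_zero[of z] by linarith
  define a where "a k = (deriv ^^ k) f 0 / fact k" for k
  define q where "q = norm z / R"
  have q: "0 \<le> q" "q < 1" using R z by (auto simp: q_def)
  have a: "norm (a k) \<le> B / R ^ k" for k
    using Cauchy_inequality[OF hol cont R, of B k] bd
    by (simp add: a_def norm_divide field_simps)
  have "(\<lambda>k. a k * z ^ k) sums f z"
    using holomorphic_power_series[OF hol, of z] z by (simp add: a_def)
  then have s: "(\<lambda>k. a (k + K) * z ^ (k + K)) sums (f z - (\<Sum>k<K. a k * z ^ k))"
    by (rule sums_split_initial_segment)
  have g: "(\<lambda>k. B * q ^ K * q ^ k) sums (B * q ^ K * (1 / (1 - q)))"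
    using q by (intro sums_mult geometric_sums) auto
  have "norm (a (k + K) * z ^ (k + K)) \<le> B * q ^ K * q ^ k" for k
  proof -
    have "norm (a (k + K) * z ^ (k + K)) \<le> B / R ^ (k + K) * norm z ^ (k + K)"
      unfolding norm_mult norm_power by (intro mult_right_mono a) auto
    also have "\<dots> = B * q ^ K * q ^ k"
      by (simp add: q_def power_add power_divide mult_ac)
    finally show ?thesis .
  qed
  from norm_sums_le[OF s g this] show ?thesis by (simp add: a_def q_def)
qed

text \<open>Holomorphy tested on complex lines only: all estimates below are one-variable estimates on
  lines, and this notion passes to uniform limits without any several-variables theory.\<close>

definition line_hol :: "(complex^'n \<Rightarrow> complex) \<Rightarrow> (complex^'n) set \<Rightarrow> bool" where
  "line_hol \<phi> S \<longleftrightarrow> continuous_on S \<phi> \<and>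
     (\<forall>a v. (\<lambda>\<zeta>. \<phi> (a + \<zeta> *s v)) holomorphic_on {\<zeta>. a + \<zeta> *s v \<in> S})"

definition line_deriv :: "(complex^'n \<Rightarrow> complex) \<Rightarrow> complex^'n \<Rightarrow> complex^'n \<Rightarrow> complex" where
  "line_deriv \<phi> z v = deriv (\<lambda>\<zeta>. \<phi> (z + \<zeta> *s v)) 0"

lemma line_hol_continuous: "line_hol \<phi> S \<Longrightarrow> continuous_on S \<phi>"
  by (simp add: line_hol_def)

lemma line_hol_line: "line_hol \<phi> S \<Longrightarrow> (\<lambda>\<zeta>. \<phi> (a + \<zeta> *s v)) holomorphic_on {\<zeta>. a + \<zeta> *s v \<in> S}"
  by (simp add: line_hol_def)

lemma line_hol_subset: "line_hol \<phi> S \<Longrightarrow> T \<subseteq> S \<Longrightarrow> line_hol \<phi> T"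
  unfolding line_hol_def by (blast intro: continuous_on_subset holomorphic_on_subset)

lemma line_hol_cong: "(\<And>z. z \<in> S \<Longrightarrow> \<phi> z = \<psi> z) \<Longrightarrow> line_hol \<phi> S \<longleftrightarrow> line_hol \<psi> S"
  unfolding line_hol_def by (intro conj_cong all_cong1 continuous_on_cong holomorphic_cong) auto

lemma open_line: "open S \<Longrightarrow> open {\<zeta>. (a::complex^'n) + \<zeta> *s v \<in> S}"
  using open_vimage[of S "\<lambda>\<zeta>. a + \<zeta> *s v"] by (simp add: vimage_def continuous_intros)

lemma line_hol_const [simp, intro]: "line_hol (\<lambda>_. c) S"
  by (simp add: line_hol_def)

lemma line_hol_nth [simp, intro]: "line_hol (\<lambda>z. z $ i) S"
  by (auto simp: line_hol_def intro!: continuous_intros holomorphic_intros)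

lemma line_hol_add: "line_hol f S \<Longrightarrow> line_hol g S \<Longrightarrow> line_hol (\<lambda>z. f z + g z) S"
  by (auto simp: line_hol_def intro!: continuous_intros holomorphic_intros)

lemma line_hol_diff: "line_hol f S \<Longrightarrow> line_hol g S \<Longrightarrow> line_hol (\<lambda>z. f z - g z) S"
  by (auto simp: line_hol_def intro!: continuous_intros holomorphic_intros)

lemma line_hol_mult: "line_hol f S \<Longrightarrow> line_hol g S \<Longrightarrow> line_hol (\<lambda>z. f z * g z) S"
  by (auto simp: line_hol_def intro!: continuous_intros holomorphic_intros)

lemma line_hol_divide: "line_hol f S \<Longrightarrow> line_hol g S \<Longrightarrow> (\<And>z. z \<in> S \<Longrightarrow> g z \<noteq> 0) \<Longrightarrow> line_hol (\<lambda>z. f z / g z) S"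
  by (auto simp: line_hol_def intro!: continuous_intros holomorphic_intros)

lemma line_hol_sum: "(\<And>i. i \<in> I \<Longrightarrow> line_hol (f i) S) \<Longrightarrow> line_hol (\<lambda>z. \<Sum>i\<in>I. f i z) S"
  by (auto simp: line_hol_def intro!: continuous_intros holomorphic_intros)

lemma line_hol_prod: "(\<And>i. i \<in> I \<Longrightarrow> line_hol (f i) S) \<Longrightarrow> line_hol (\<lambda>z. \<Prod>i\<in>I. f i z) S"
  by (auto simp: line_hol_def intro!: continuous_intros holomorphic_intros)

text \<open>\<open>L'\<close> is the linear part of \<open>L\<close>: lines go to lines, so
  restriction to a line commutes with the substitution. It serves translations and coordinate
  projections.\<close>

lemma line_hol_affine:
  assumes "line_hol f T" "\<And>z. z \<in> S \<Longrightarrow> L z \<in> T" "continuous_on S L"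
    and L: "\<And>a v \<zeta>. L (a + \<zeta> *s v) = L a + \<zeta> *s L' v"
  shows "line_hol (\<lambda>z. f (L z)) S"
  unfolding line_hol_def
proof (intro conjI allI)
  show "continuous_on S (\<lambda>z. f (L z))"
    using assms by (intro continuous_on_compose2[OF line_hol_continuous[OF assms(1)]]) auto
  show "(\<lambda>\<zeta>. f (L (a + \<zeta> *s v))) holomorphic_on {\<zeta>. a + \<zeta> *s v \<in> S}" for a v
    unfolding L by (rule holomorphic_on_subset[OF line_hol_line[OF assms(1)]])
      (use assms(2)[of "a + _ *s v"] in \<open>auto simp: L\<close>)
qed

lemma line_in_cball:
  assumes "norm (v::complex^'n) * norm \<zeta> \<le> R"
  shows "a + \<zeta> *s v \<in> cball a R"
  using assms by (simp add: dist_norm norm_smult_vec mult.commute)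

lemma hol_along_line:
  assumes "line_hol \<phi> S" "cball a R \<subseteq> S" "v \<noteq> 0"
  shows "(\<lambda>\<zeta>. \<phi> (a + \<zeta> *s v)) holomorphic_on ball 0 (R / norm v)"
    and "continuous_on (cball 0 (R / norm v)) (\<lambda>\<zeta>. \<phi> (a + \<zeta> *s v))"
proof -
  have sub: "cball 0 (R / norm v) \<subseteq> {\<zeta>. a + \<zeta> *s v \<in> S}"
  proof
    fix \<zeta> :: complex assume "\<zeta> \<in> cball 0 (R / norm v)"
    then have "norm v * norm \<zeta> \<le> R" using assms(3) by (simp add: field_simps)
    from line_in_cball[OF this, of a] show "\<zeta> \<in> {\<zeta>. a + \<zeta> *s v \<in> S}" using assms(2) by auto
  qed
  note h = line_hol_line[OF assms(1), of a v]
  show "(\<lambda>\<zeta>. \<phi> (a + \<zeta> *s v)) holomorphic_on ball 0 (R / norm v)"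
    using holomorphic_on_subset[OF h] sub ball_subset_cball by blast
  show "continuous_on (cball 0 (R / norm v)) (\<lambda>\<zeta>. \<phi> (a + \<zeta> *s v))"
    using holomorphic_on_imp_continuous_on[OF h] sub continuous_on_subset by blast
qed

text \<open>The one-variable estimate on the line through \<open>a\<close> in direction
  \<open>v\<close>, taken at parameter 1; the parameter disc has radius
  \<open>R / norm v > 1\<close>.\<close>

lemma line_hol_taylor:
  assumes "line_hol \<phi> S" "cball a R \<subseteq> S" and B: "\<And>z. z \<in> cball a R \<Longrightarrow> norm (\<phi> z) \<le> B"
    and "norm v < R" "v \<noteq> 0"
  shows "norm (\<phi> (a + v) - (\<Sum>k<K. (deriv ^^ k) (\<lambda>\<zeta>. \<phi> (a + \<zeta> *s v)) 0 / fact k))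
      \<le> B * (norm v / R) ^ K / (1 - norm v / R)"
proof -
  have "norm (\<phi> (a + \<zeta> *s v)) \<le> B" if "norm \<zeta> = R / norm v" for \<zeta>
    by (rule B, rule line_in_cball) (use that assms in auto)
  moreover have "norm (1::complex) < R / norm v" using assms by simp
  ultimately show ?thesis
    using taylor_remainder_bound[OF hol_along_line[OF assms(1,2,5)], of B 1 K] by simp
qed

lemma line_deriv_0 [simp]: "line_deriv \<phi> a 0 = 0"
  by (simp add: line_deriv_def)

lemma line_hol_increment1:
  assumes "line_hol \<phi> S" "cball a R \<subseteq> S" and B: "\<And>z. z \<in> cball a R \<Longrightarrow> norm (\<phi> z) \<le> B"
    and "norm v < R"
  shows "norm (\<phi> (a + v) - \<phi> a) \<le> B * (norm v / R) / (1 - norm v / R)"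
proof (cases "v = 0")
  case False
  from line_hol_taylor[OF assms this, of 1] show ?thesis by simp
qed auto

lemma line_hol_increment2:
  assumes "line_hol \<phi> S" "cball a R \<subseteq> S" and B: "\<And>z. z \<in> cball a R \<Longrightarrow> norm (\<phi> z) \<le> B"
    and "norm v < R"
  shows "norm (\<phi> (a + v) - \<phi> a - line_deriv \<phi> a v) \<le> B * (norm v / R)\<^sup>2 / (1 - norm v / R)"
proof (cases "v = 0")
  case False
  from line_hol_taylor[OF assms this, of 2] show ?thesis
    by (simp add: line_deriv_def numeral_2_eq_2 algebra_simps)
qed auto

lemma line_deriv_bound:
  assumes "line_hol \<phi> S" "cball a R \<subseteq> S" and B: "\<And>z. z \<in> cball a R \<Longrightarrow> norm (\<phi> z) \<le> B"
    and "0 < R"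
  shows "norm (line_deriv \<phi> a v) \<le> B * norm v / R"
proof (cases "v = 0")
  case False
  have "norm (\<phi> (a + \<zeta> *s v)) \<le> B" if "norm (0 - \<zeta>) = R / norm v" for \<zeta>
    by (rule B, rule line_in_cball) (use that False in auto)
  from Cauchy_inequality[OF hol_along_line[OF assms(1,2) False] _ this, of 1] assms False
  show ?thesis by (simp add: line_deriv_def)
qed auto

lemma field_differentiable_line:
  assumes "line_hol \<phi> S" "open S" "a + \<zeta> *s v \<in> S"
  shows "(\<lambda>\<zeta>. \<phi> (a + \<zeta> *s v)) field_differentiable (at \<zeta>)"
  using holomorphic_on_imp_differentiable_at[OF line_hol_line[OF assms(1)] open_line[OF assms(2)], of \<zeta> a v] assms(3)
  by simp

lemma line_deriv_has_field_derivative: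
  assumes "line_hol \<phi> S" "open S" "a \<in> S"
  shows "((\<lambda>\<zeta>. \<phi> (a + \<zeta> *s v)) has_field_derivative line_deriv \<phi> a v) (at 0)"
  using field_differentiable_line[OF assms(1,2), of a 0 v] assms(3)
  by (simp add: line_deriv_def field_differentiable_derivI)

lemma line_deriv_unique:
  assumes "((\<lambda>\<zeta>. \<phi> (a + \<zeta> *s v)) has_field_derivative d) (at 0)"
  shows "line_deriv \<phi> a v = d"
  using assms unfolding line_deriv_def by (rule DERIV_imp_deriv)

lemma line_deriv_smult:
  assumes "line_hol \<phi> S" "open S" "a \<in> S"
  shows "line_deriv \<phi> a (t *s v) = t * line_deriv \<phi> a v"
proof (rule line_deriv_unique)
  have "((\<lambda>\<zeta>. \<phi> (a + \<zeta> *s v)) \<circ> (\<lambda>\<zeta>. \<zeta> * t) has_field_derivative line_deriv \<phi> a v * t) (at 0)"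
    using line_deriv_has_field_derivative[OF assms, of v]
    by (intro DERIV_chain) (auto intro!: derivative_eq_intros)
  then show "((\<lambda>\<zeta>. \<phi> (a + \<zeta> *s (t *s v))) has_field_derivative t * line_deriv \<phi> a v) (at 0)"
    by (simp add: o_def vector_smult_assoc mult.commute)
qed

lemma line_deriv_add:
  assumes "line_hol \<phi> S" "line_hol \<psi> S" "open S" "a \<in> S"
  shows "line_deriv (\<lambda>z. \<phi> z + \<psi> z) a v = line_deriv \<phi> a v + line_deriv \<psi> a v"
  using assms by (intro line_deriv_unique DERIV_add line_deriv_has_field_derivative)

lemma line_deriv_diff:
  assumes "line_hol \<phi> S" "line_hol \<psi> S" "open S" "a \<in> S"
  shows "line_deriv (\<lambda>z. \<phi> z - \<psi> z) a v = line_deriv \<phi> a v - line_deriv \<psi> a v"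
  using assms by (intro line_deriv_unique DERIV_diff line_deriv_has_field_derivative)

lemma line_deriv_mult:
  assumes "line_hol \<phi> S" "line_hol \<psi> S" "open S" "a \<in> S"
  shows "line_deriv (\<lambda>z. \<phi> z * \<psi> z) a v = line_deriv \<phi> a v * \<psi> a + \<phi> a * line_deriv \<psi> a v"
proof (rule line_deriv_unique)
  show "((\<lambda>\<zeta>. \<phi> (a + \<zeta> *s v) * \<psi> (a + \<zeta> *s v)) has_field_derivative line_deriv \<phi> a v * \<psi> a + \<phi> a * line_deriv \<psi> a v) (at 0)"
    using DERIV_mult[OF line_deriv_has_field_derivative[OF assms(1,3,4), of v] line_deriv_has_field_derivative[OF assms(2,3,4), of v]]
    by (simp add: algebra_simps)
qed

lemma line_deriv_sum:
  assumes "\<And>i. i \<in> I \<Longrightarrow> line_hol (\<phi> i) S" "open S" "a \<in> S"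
  shows "line_deriv (\<lambda>z. \<Sum>i\<in>I. \<phi> i z) a v = (\<Sum>i\<in>I. line_deriv (\<phi> i) a v)"
  using assms by (intro line_deriv_unique DERIV_sum line_deriv_has_field_derivative)

lemma line_hol_bounded_nbhd:
  assumes "line_hol \<phi> S" "open S" "a \<in> S"
  obtains R B where "R > 0" "cball a R \<subseteq> S" "B \<ge> 0" "\<And>z. z \<in> cball a R \<Longrightarrow> norm (\<phi> z) \<le> B"
proof -
  obtain R where R: "R > 0" "cball a R \<subseteq> S" using assms open_contains_cball by blast
  have "bounded (\<phi> ` cball a R)"
    by (intro compact_imp_bounded compact_continuous_image continuous_on_subset[OF line_hol_continuous[OF assms(1)]] R) auto
  then obtain B where "\<And>z. z \<in> cball a R \<Longrightarrow> norm (\<phi> z) \<le> B" unfolding bounded_iff by blast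
  then show thesis using that[OF R, of "max B 0"] by fastforce
qed

text \<open>On each line this is the Weierstrass theorem. The filter is arbitrary so that difference
  quotients with a parameter tending to 0 are covered, not only sequences.\<close>

lemma line_hol_uniform_limit:
  fixes f :: "'b \<Rightarrow> complex^'n \<Rightarrow> complex"
  assumes S: "open S" and F: "F \<noteq> bot"
    and loc: "\<And>z. z \<in> S \<Longrightarrow> \<exists>r>0. ball z r \<subseteq> S \<and> (\<forall>\<^sub>F n in F. line_hol (f n) (ball z r)) \<and> uniform_limit (ball z r) f g F"
  shows "line_hol g S"
  unfolding line_hol_def
proof (intro conjI allI)
  show "continuous_on S g"
    unfolding continuous_on_eq_continuous_at[OF S]
  proof
    fix z assume "z \<in> S"
    then obtain r where r: "r > 0" "\<forall>\<^sub>F n in F. line_hol (f n) (ball z r)" "uniform_limit (ball z r) f g F"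
      using loc by blast
    have "continuous_on (ball z r) g"
      by (rule uniform_limit_theorem[OF _ r(3) F]) (use r(2) in \<open>auto elim!: eventually_mono simp: line_hol_def\<close>)
    then show "isCont g z" using r(1) by (simp add: continuous_on_eq_continuous_at)
  qed
  fix a v
  show "(\<lambda>\<zeta>. g (a + \<zeta> *s v)) holomorphic_on {\<zeta>. a + \<zeta> *s v \<in> S}"
    unfolding holomorphic_on_def
  proof
    fix \<zeta>0 assume "\<zeta>0 \<in> {\<zeta>. a + \<zeta> *s v \<in> S}"
    then obtain r where r: "r > 0" "\<forall>\<^sub>F n in F. line_hol (f n) (ball (a + \<zeta>0 *s v) r)"
      "uniform_limit (ball (a + \<zeta>0 *s v) r) f g F"
      using loc by blast
    have "open {\<zeta>. a + \<zeta> *s v \<in> ball (a + \<zeta>0 *s v) r}" by (intro open_line) auto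
    then obtain d where d: "d > 0" "cball \<zeta>0 d \<subseteq> {\<zeta>. a + \<zeta> *s v \<in> ball (a + \<zeta>0 *s v) r}"
      using r(1) unfolding open_contains_cball by (metis (no_types, lifting) centre_in_ball mem_Collect_eq)
    have "(\<lambda>\<zeta>. g (a + \<zeta> *s v)) holomorphic_on ball \<zeta>0 d"
    proof (rule holomorphic_uniform_limit[OF _ _ F])
      show "\<forall>\<^sub>F n in F. continuous_on (cball \<zeta>0 d) (\<lambda>\<zeta>. f n (a + \<zeta> *s v)) \<and>
              (\<lambda>\<zeta>. f n (a + \<zeta> *s v)) holomorphic_on ball \<zeta>0 d"
        using r(2)
      proof eventually_elim
        case (elim n)
        have "(\<lambda>\<zeta>. f n (a + \<zeta> *s v)) holomorphic_on cball \<zeta>0 d"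
          using holomorphic_on_subset[OF line_hol_line[OF elim] d(2)] .
        then show ?case
          using holomorphic_on_imp_continuous_on holomorphic_on_subset[OF _ ball_subset_cball] by blast
      qed
      show "uniform_limit (cball \<zeta>0 d) (\<lambda>n \<zeta>. f n (a + \<zeta> *s v)) (\<lambda>\<zeta>. g (a + \<zeta> *s v)) F"
        by (rule uniform_limit_compose'[OF r(3)]) (use d(2) in auto)
    qed auto
    then have "(\<lambda>\<zeta>. g (a + \<zeta> *s v)) field_differentiable at \<zeta>0"
      using d(1) by (simp add: holomorphic_on_imp_differentiable_at)
    then show "(\<lambda>\<zeta>. g (a + \<zeta> *s v)) field_differentiable at \<zeta>0 within {\<zeta>. a + \<zeta> *s v \<in> S}"
      by (rule field_differentiable_at_within)
  qed
qed

text \<open>The difference quotients in direction \<open>v\<close> are holomorphic along every line,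
  also in directions other than \<open>v\<close>, and the second-order remainder makes them converge
  locally uniformly. This stands in for the holomorphy of partial derivatives.\<close>

lemma line_hol_line_deriv:
  assumes S: "open S" and phi: "line_hol \<phi> S"
  shows "line_hol (\<lambda>z. line_deriv \<phi> z v) S"
proof (rule line_hol_uniform_limit[where F = "at (0::complex)" and f = "\<lambda>t z. (\<phi> (z + t *s v) - \<phi> z) / t"])
  fix z0 assume "z0 \<in> S"
  then obtain R B where R: "R > 0" "cball z0 R \<subseteq> S" "B \<ge> 0" and B: "\<And>z. z \<in> cball z0 R \<Longrightarrow> norm (\<phi> z) \<le> B"
    using line_hol_bounded_nbhd[OF phi S] by metis
  \<comment> \<open>Halving keeps a ball of radius \<open>r\<close> around each point of
    \<open>ball z0 r\<close> inside \<open>cball z0 R\<close>, so one bound \<open>B\<close> serves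
    them all.\<close>
  define r where "r = R / 2"
  have r: "r > 0" using R by (simp add: r_def)
  have in_c: "z + w \<in> cball z0 R" if "z \<in> ball z0 r" "norm w \<le> r" for z w
  proof -
    have "norm (z0 - z - w) \<le> norm (z0 - z) + norm w" by (rule norm_triangle_ineq4)
    then show ?thesis using that by (simp add: r_def dist_norm diff_diff_eq)
  qed
  have ev: "\<forall>\<^sub>F t in at (0::complex). norm (t *s v) < r"
  proof -
    have "((\<lambda>t::complex. norm (t *s v)) \<longlongrightarrow> norm (0 *s v)) (at 0)" by (intro tendsto_intros)
    then show ?thesis using r by (intro order_tendstoD(2)) auto
  qed
  show "\<exists>r>0. ball z0 r \<subseteq> S \<and> (\<forall>\<^sub>F t in at (0::complex). line_hol (\<lambda>z. (\<phi> (z + t *s v) - \<phi> z) / t) (ball z0 r)) \<and>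
     uniform_limit (ball z0 r) (\<lambda>t z. (\<phi> (z + t *s v) - \<phi> z) / t) (\<lambda>z. line_deriv \<phi> z v) (at 0)"
  proof (intro exI conjI)
    show "r > 0" by fact
    show "ball z0 r \<subseteq> S" using R(1,2) by (auto simp: r_def)
    show "\<forall>\<^sub>F t in at (0::complex). line_hol (\<lambda>z. (\<phi> (z + t *s v) - \<phi> z) / t) (ball z0 r)"
      using ev eventually_neq_at_within[of 0]
    proof eventually_elim
      case (elim t)
      show ?case
      proof (intro line_hol_divide line_hol_diff)
        show "line_hol (\<lambda>z. \<phi> (z + t *s v)) (ball z0 r)"
          by (rule line_hol_affine[OF phi, where L' = "\<lambda>v. v"])
            (use in_c elim R in \<open>auto intro!: continuous_intros\<close>)
        show "line_hol \<phi> (ball z0 r)" by (rule line_hol_subset[OF phi]) fact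
      qed (use elim in auto)
    qed
    show "uniform_limit (ball z0 r) (\<lambda>t z. (\<phi> (z + t *s v) - \<phi> z) / t) (\<lambda>z. line_deriv \<phi> z v) (at 0)"
    proof (rule uniform_limitI)
      fix e :: real assume "e > 0"
      \<comment> \<open>The remainder of the increment \<open>t *s v\<close> is of order
        \<open>C * (norm t)\<^sup>2\<close>; one factor \<open>norm t\<close> is lost on division by
        \<open>t\<close>.\<close>
      define C where "C = B * (norm v / r)\<^sup>2"
      have "((\<lambda>t::complex. C * norm t / (1 - norm t * norm v / r)) \<longlongrightarrow> C * norm (0::complex) / (1 - norm (0::complex) * norm v / r)) (at 0)"
        using r by (intro tendsto_intros) auto
      then have "\<forall>\<^sub>F t in at (0::complex). C * norm t / (1 - norm t * norm v / r) < e"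
        using \<open>e > 0\<close> by (intro order_tendstoD(2)) auto
      then show "\<forall>\<^sub>F t in at 0. \<forall>z\<in>ball z0 r. dist ((\<phi> (z + t *s v) - \<phi> z) / t) (line_deriv \<phi> z v) < e"
        using ev eventually_neq_at_within[of 0]
      proof eventually_elim
        case (elim t)
        show ?case
        proof
          fix z assume z: "z \<in> ball z0 r"
          have c: "cball z r \<subseteq> S" and b: "\<And>w. w \<in> cball z r \<Longrightarrow> norm (\<phi> w) \<le> B"
          proof -
            have "w \<in> cball z0 R" if "w \<in> cball z r" for w
              using in_c[OF z, of "w - z"] that by (simp add: dist_norm norm_minus_commute)
            then show "cball z r \<subseteq> S" "\<And>w. w \<in> cball z r \<Longrightarrow> norm (\<phi> w) \<le> B" using R B by blast+
          qed
          have zS: "z \<in> S" using c r by auto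
          have "norm (\<phi> (z + t *s v) - \<phi> z - line_deriv \<phi> z (t *s v)) \<le> B * (norm (t *s v) / r)\<^sup>2 / (1 - norm (t *s v) / r)"
            using elim by (intro line_hol_increment2[OF phi c b]) auto
          also have "\<dots> = norm t * (C * norm t / (1 - norm t * norm v / r))"
            by (simp add: C_def norm_smult_vec power2_eq_square)
          also have "\<dots> < norm t * e" using elim by (intro mult_strict_left_mono) auto
          finally have "norm (\<phi> (z + t *s v) - \<phi> z - t * line_deriv \<phi> z v) < norm t * e"
            by (simp add: line_deriv_smult[OF phi S zS])
          moreover have "(\<phi> (z + t *s v) - \<phi> z) / t - line_deriv \<phi> z v = (\<phi> (z + t *s v) - \<phi> z - t * line_deriv \<phi> z v) / t"
            using elim by (simp add: field_simps)
          ultimately show "dist ((\<phi> (z + t *s v) - \<phi> z) / t) (line_deriv \<phi> z v) < e"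
            using elim by (simp add: dist_norm norm_divide field_simps)
        qed
      qed
    qed
  qed
qed (use S in auto)

subsection \<open>Polynomial approximation on balls\<close>

definition monomial :: "('n::finite \<Rightarrow> nat) \<Rightarrow> complex^'n \<Rightarrow> complex" where
  "monomial \<alpha> w = (\<Prod>j\<in>UNIV. (w $ j) ^ \<alpha> j)"

text \<open>\<open>d\<close> bounds the degree of each monomial from below: \<open>polyfun 0\<close>
  is all polynomials, \<open>polyfun 2\<close> those vanishing to second order at 0. The inductive
  form gives closure properties by adding one monomial at a time.\<close>

inductive polyfun :: "nat \<Rightarrow> (complex^'n \<Rightarrow> complex) \<Rightarrow> bool" for d where
  polyfun_zero: "polyfun d (\<lambda>_. 0)"
| polyfun_add_monomial: "d \<le> sum \<alpha> UNIV \<Longrightarrow> polyfun d p \<Longrightarrow> polyfun d (\<lambda>w. c * monomial \<alpha> w + p w)"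

lemma monomial_smult: "monomial \<alpha> (\<zeta> *s w) = \<zeta> ^ sum \<alpha> UNIV * monomial \<alpha> w"
  by (simp add: monomial_def power_mult_distrib prod.distrib power_sum)

lemma line_hol_power: "line_hol f S \<Longrightarrow> line_hol (\<lambda>z. f z ^ k) S"
  by (induction k) (auto intro: line_hol_mult)

lemma line_hol_monomial: "line_hol (monomial \<alpha>) S"
  unfolding monomial_def by (intro line_hol_prod line_hol_power line_hol_nth)

lemma line_hol_polyfun: "polyfun d p \<Longrightarrow> line_hol p S"
  by (induction rule: polyfun.induct) (auto intro!: line_hol_add line_hol_mult line_hol_monomial)

lemma polyfun_add: "polyfun d p \<Longrightarrow> polyfun d q \<Longrightarrow> polyfun d (\<lambda>w. p w + q w)"
proof (induction rule: polyfun.induct)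
  case (polyfun_add_monomial \<alpha> p c)
  from polyfun.polyfun_add_monomial[OF this(1) this(3)[OF this(4)], of c] show ?case
    by (simp add: add.assoc)
qed auto

lemma polyfun_sum: "(\<And>i. i \<in> I \<Longrightarrow> polyfun d (p i)) \<Longrightarrow> polyfun d (\<lambda>w. \<Sum>i\<in>I. p i w)"
  by (induction I rule: infinite_finite_induct) (auto intro: polyfun_zero polyfun_add)

lemma polyfun_const: "polyfun 0 (\<lambda>_. c)"
  using polyfun_add_monomial[of 0 "\<lambda>_. 0" "\<lambda>_. 0" c] by (simp add: polyfun_zero monomial_def)

lemma monomial_upd: "(w $ j) ^ k * monomial \<alpha> w = monomial (\<alpha>(j := \<alpha> j + k)) w"
proof -
  have "monomial \<beta> w = (w $ j) ^ \<beta> j * (\<Prod>i\<in>UNIV - {j}. (w $ i) ^ \<beta> i)" for \<beta>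
    unfolding monomial_def by (rule prod.remove) auto
  note * = this[of \<alpha>] this[of "\<alpha>(j := \<alpha> j + k)"]
  have "(\<Prod>i\<in>UNIV - {j}. (w $ i) ^ (\<alpha>(j := \<alpha> j + k)) i) = (\<Prod>i\<in>UNIV - {j}. (w $ i) ^ \<alpha> i)"
    by (intro prod.cong) auto
  then show ?thesis unfolding * by (simp add: power_add mult_ac)
qed

lemma polyfun_nth_power_mult: "polyfun 0 p \<Longrightarrow> polyfun 0 (\<lambda>w. (w $ j) ^ k * p w)"
proof (induction rule: polyfun.induct)
  case (polyfun_add_monomial \<alpha> p c)
  from polyfun.polyfun_add_monomial[OF _ this(3), of "\<alpha>(j := \<alpha> j + k)" c] show ?case
    by (simp add: monomial_upd[symmetric] distrib_left mult.left_commute)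
qed (auto intro: polyfun_zero)

lemma line_deriv_monomial_0: "line_deriv (monomial \<alpha>) 0 w = (if sum \<alpha> UNIV = 1 then monomial \<alpha> w else 0)"
proof (rule line_deriv_unique)
  define m where "m = sum \<alpha> UNIV"
  have "((\<lambda>\<zeta>. \<zeta> ^ m * monomial \<alpha> w) has_field_derivative (of_nat m * 0 ^ (m - Suc 0) * monomial \<alpha> w)) (at 0)"
    by (auto intro!: derivative_eq_intros)
  moreover have "of_nat m * 0 ^ (m - Suc 0) * monomial \<alpha> w = (if m = 1 then monomial \<alpha> w else 0)"
    by (cases m) (auto simp: power_0_left)
  ultimately show "((\<lambda>\<zeta>. monomial \<alpha> (0 + \<zeta> *s w)) has_field_derivative
      (if sum \<alpha> UNIV = 1 then monomial \<alpha> w else 0)) (at 0)"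
    by (simp add: monomial_smult m_def)
qed

lemma monomial_at_0: "monomial \<alpha> 0 = (if sum \<alpha> UNIV = 0 then 1 else 0)"
  using monomial_smult[of \<alpha> 0 "\<chi> i. 1"] by (auto simp: power_0_left monomial_def)

text \<open>By homogeneity a monomial equals its value at 0 in degree 0 and its derivative at 0 in
  degree 1, and has neither in higher degree; so exactly the terms of degree below two
  cancel.\<close>

lemma polyfun_cutoff: "polyfun 0 p \<Longrightarrow> polyfun 2 (\<lambda>w. p w - p 0 - line_deriv p 0 w)"
proof (induction rule: polyfun.induct)
  case polyfun_zero
  have "line_deriv (\<lambda>_. 0) 0 w = 0" for w :: "complex^'a" by (rule line_deriv_unique) auto
  then show ?case by (simp add: polyfun.polyfun_zero)
next
  case (polyfun_add_monomial \<alpha> p c)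
  have line_deriv: "line_deriv (\<lambda>w. c * monomial \<alpha> w + p w) 0 w = c * line_deriv (monomial \<alpha>) 0 w + line_deriv p 0 w" for w
  proof -
    have "line_deriv (\<lambda>w. c) 0 w = 0" by (rule line_deriv_unique) auto
    then have "line_deriv (\<lambda>w. c * monomial \<alpha> w) 0 w = c * line_deriv (monomial \<alpha>) 0 w"
      using line_deriv_mult[OF line_hol_const line_hol_monomial, of UNIV 0 c \<alpha> w] by simp
    then show ?thesis
      using line_deriv_add[of "\<lambda>w. c * monomial \<alpha> w" UNIV p 0 w] polyfun_add_monomial(2)
      by (simp add: line_hol_mult line_hol_monomial line_hol_polyfun)
  qed
  have eq: "c * monomial \<alpha> w + p w - (c * monomial \<alpha> 0 + p 0) - line_deriv (\<lambda>w. c * monomial \<alpha> w + p w) 0 w =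
     (if sum \<alpha> UNIV \<ge> 2 then c else 0) * monomial \<alpha> w + (p w - p 0 - line_deriv p 0 w)" for w
  proof -
    consider "sum \<alpha> UNIV = 0" | "sum \<alpha> UNIV = 1" | "sum \<alpha> UNIV \<ge> 2" by linarith
    then show ?thesis
    proof cases
      case 1
      then have "monomial \<alpha> w = 1" by (simp add: monomial_def)
      then show ?thesis using 1 by (simp add: line_deriv line_deriv_monomial_0 monomial_at_0)
    qed (auto simp: line_deriv line_deriv_monomial_0 monomial_at_0)
  qed
  show ?case unfolding eq
    by (cases "sum \<alpha> UNIV \<ge> 2") (use polyfun.polyfun_add_monomial[of 2 \<alpha>] polyfun_add_monomial in auto)
qed

text \<open>Coordinates outside \<open>S\<close> are set to 0, so that
  \<open>\<phi> w = \<phi> (proj S w)\<close> expresses dependence on the coordinates in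
  \<open>S\<close> alone.\<close>

definition proj :: "'n set \<Rightarrow> complex^'n \<Rightarrow> complex^'n" where
  "proj S w = (\<chi> i. if i \<in> S then w $ i else 0)"

lemma norm_proj_le: "norm (proj S w) \<le> norm w"
  by (rule norm_le_componentwise_cart) (simp add: proj_def)

lemma proj_idem [simp]: "proj S (proj S w) = proj S w"
  by (simp add: proj_def vec_eq_iff)

lemma proj_in_ball: "w \<in> ball 0 R \<Longrightarrow> proj S w \<in> ball 0 R"
  using norm_proj_le[of S w] by simp

lemma line_hol_proj:
  assumes "line_hol \<phi> (ball 0 R)"
  shows "line_hol (\<lambda>w. \<phi> (proj S w)) (ball 0 R)"
proof (rule line_hol_affine[OF assms, where L' = "proj S"])
  have "proj S = (\<lambda>w. \<chi> i. (if i \<in> S then 1 else 0) * w $ i)"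
    by (auto simp: proj_def fun_eq_iff vec_eq_iff)
  then show "continuous_on (ball 0 R) (proj S)" by (auto intro!: continuous_intros)
  show "proj S w \<in> ball 0 R" if "w \<in> ball 0 R" for w using that by (rule proj_in_ball)
qed (auto simp: proj_def vec_eq_iff)

text \<open>Line-holomorphy of the iterate belongs to the claim because the induction step needs it
  in order to differentiate once more.\<close>

lemma higher_deriv_line:
  assumes "open S" "line_hol \<phi> S"
  shows "z + \<zeta> *s e \<in> S \<Longrightarrow>
    (deriv ^^ k) (\<lambda>\<zeta>. \<phi> (z + \<zeta> *s e)) \<zeta> = ((\<lambda>\<psi> z. line_deriv \<psi> z e) ^^ k) \<phi> (z + \<zeta> *s e) \<and>
    line_hol (((\<lambda>\<psi> z. line_deriv \<psi> z e) ^^ k) \<phi>) S"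
proof (induction k arbitrary: \<zeta>)
  case 0
  then show ?case using assms by simp
next
  case (Suc k)
  define \<psi> where "\<psi> = ((\<lambda>\<psi> z. line_deriv \<psi> z e) ^^ k) \<phi>"
  have psi: "line_hol \<psi> S" using Suc by (simp add: \<psi>_def)
  have "eventually (\<lambda>\<xi>. \<xi> \<in> {\<zeta>. z + \<zeta> *s e \<in> S}) (nhds \<zeta>)"
    using open_line[OF assms(1)] Suc.prems by (intro eventually_nhds_in_open) auto
  then have "eventually (\<lambda>\<xi>. (deriv ^^ k) (\<lambda>\<zeta>. \<phi> (z + \<zeta> *s e)) \<xi> = \<psi> (z + \<xi> *s e)) (nhds \<zeta>)"
    by eventually_elim (use Suc.IH in \<open>auto simp: \<psi>_def\<close>)
  then have "deriv ((deriv ^^ k) (\<lambda>\<zeta>. \<phi> (z + \<zeta> *s e))) \<zeta> = deriv (\<lambda>\<xi>. \<psi> (z + \<xi> *s e)) \<zeta>"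
    by (intro deriv_cong_ev) auto
  also have "\<dots> = line_deriv \<psi> (z + \<zeta> *s e) e"
  proof (rule DERIV_imp_deriv)
    have "((\<lambda>\<xi>. \<psi> (z + \<zeta> *s e + \<xi> *s e)) has_field_derivative line_deriv \<psi> (z + \<zeta> *s e) e) (at (\<zeta> - \<zeta>))"
      using line_deriv_has_field_derivative[OF psi assms(1) Suc.prems] by simp
    then have "((\<lambda>\<xi>. \<psi> (z + \<zeta> *s e + \<xi> *s e)) \<circ> (\<lambda>\<xi>. \<xi> - \<zeta>) has_field_derivative line_deriv \<psi> (z + \<zeta> *s e) e * 1) (at \<zeta>)"
      by (rule DERIV_chain) (auto intro!: derivative_eq_intros)
    moreover have "z + \<zeta> *s e + (\<xi> - \<zeta>) *s e = z + \<xi> *s e" for \<xi>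
      by (simp add: vector_sub_rdistrib)
    ultimately show "((\<lambda>\<xi>. \<psi> (z + \<xi> *s e)) has_field_derivative line_deriv \<psi> (z + \<zeta> *s e) e) (at \<zeta>)"
      by (simp add: o_def)
  qed
  finally show ?case using line_hol_line_deriv[OF assms(1) psi] by (simp add: \<psi>_def)
qed

text \<open>Induction on the set of variables on which \<open>\<phi>\<close> depends: the Taylor
  expansion in coordinate \<open>j\<close> has coefficients depending only on the coordinates in
  \<open>S\<close>, and the induction hypothesis approximates those. No power series in several
  variables is involved.\<close>

lemma polynomial_approximation_aux:
  fixes \<phi> :: "complex^'n \<Rightarrow> complex"
  assumes "finite S" "line_hol \<phi> (ball 0 R)" "\<And>w. w \<in> ball 0 R \<Longrightarrow> \<phi> w = \<phi> (proj S w)"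
    and "0 < r" "r < R" "e > 0"
  shows "\<exists>p. polyfun 0 p \<and> (\<forall>w\<in>cball 0 r. norm (\<phi> w - p w) \<le> e)"
  using assms(1,2,3,6)
proof (induction S arbitrary: \<phi> e rule: finite_induct)
  case empty
  have "proj {} w = 0" for w :: "complex^'n" by (simp add: proj_def vec_eq_iff)
  then have "norm (\<phi> w - \<phi> 0) \<le> e" if "w \<in> cball 0 r" for w
    using empty(2)[of w] that assms(5) empty(3) by simp
  then show ?case using polyfun_const[of "\<phi> 0"] by blast
next
  case (insert j S)
  define E where "E = (axis j 1 :: complex^'n)"
  define D where "D k = ((\<lambda>\<psi> z. line_deriv \<psi> z E) ^^ k) \<phi>" for k
  define a where "a k w = D k (proj S w) / fact k" for k w
  \<comment> \<open>Scaling coordinate \<open>j\<close> by factors of modulus up to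
    \<open>\<rho> > 1\<close> keeps points of \<open>cball 0 r\<close> inside
    \<open>cball 0 r'\<close>; the Taylor tail at parameter 1 is then geometric of ratio
    \<open>1 / \<rho>\<close>.\<close>
  define r' where "r' = (r + R) / 2"
  define \<rho> where "\<rho> = r' / r"
  have r': "r < r'" "r' < R" "\<rho> > 1" using assms(4,5) by (auto simp: r'_def \<rho>_def)
  have gD: "line_hol (D k) (ball 0 R)" for k
    using higher_deriv_line[OF _ insert.prems(1), of 0 0 E k] assms(4,5) by (simp add: D_def)
  have ga: "line_hol (a k) (ball 0 R)" for k
    unfolding a_def by (rule line_hol_divide[OF line_hol_proj[OF gD] line_hol_const]) simp
  have pa: "a k w = a k (proj S w)" for k w
    by (simp add: a_def)
  have "bounded (\<phi> ` cball 0 r')"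
    using r' by (intro compact_imp_bounded compact_continuous_image continuous_on_subset[OF line_hol_continuous[OF insert.prems(1)]]) auto
  then obtain M where M: "\<And>w. w \<in> cball 0 r' \<Longrightarrow> norm (\<phi> w) \<le> M" unfolding bounded_iff by blast
  have "(\<lambda>K. M * (1 / \<rho>) ^ K / (1 - 1 / \<rho>)) \<longlonglongrightarrow> M * 0 / (1 - 1 / \<rho>)"
    using r'(3) by (intro tendsto_intros LIMSEQ_power_zero) auto
  then have "\<forall>\<^sub>F K in sequentially. M * (1 / \<rho>) ^ K / (1 - 1 / \<rho>) < e / 2"
    using insert.prems(3) by (intro order_tendstoD(2)) auto
  then obtain K where K: "M * (1 / \<rho>) ^ K / (1 - 1 / \<rho>) < e / 2"
    unfolding eventually_sequentially by blast
  have tail: "norm (\<phi> w - (\<Sum>k<K. a k w * (w $ j) ^ k)) \<le> e / 2" if w: "w \<in> cball 0 r" for w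
  proof -
    define z where "z = proj S w"
    define v where "v = (w $ j) *s E"
    have eq: "proj (insert j S) w = z + v"
      using insert.hyps(2) by (auto simp: z_def v_def proj_def vec_eq_iff E_def axis_def)
    have in_c: "z + \<zeta> *s v \<in> cball 0 r'" if "norm \<zeta> \<le> \<rho>" for \<zeta>
    proof -
      have "norm (z + \<zeta> *s v) \<le> norm (complex_of_real \<rho> *s w)"
      proof (rule norm_le_componentwise_cart)
        fix i
        have "\<bar>\<rho>\<bar> * cmod (w $ i) \<ge> 1 * cmod (w $ i)" using r'(3) by (intro mult_right_mono) auto
        then show "norm ((z + \<zeta> *s v) $ i) \<le> norm ((complex_of_real \<rho> *s w) $ i)"
          using insert.hyps(2) that r'(3)
          by (auto simp: z_def v_def proj_def E_def axis_def norm_mult intro: mult_right_mono)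
      qed
      also have "\<dots> \<le> \<rho> * r" using w r'(3) by (simp add: norm_smult_vec)
      finally show ?thesis using assms(4) by (simp add: \<rho>_def)
    qed
    have hol: "(\<lambda>\<zeta>. \<phi> (z + \<zeta> *s v)) holomorphic_on cball 0 \<rho>"
      by (rule holomorphic_on_subset[OF line_hol_line[OF insert.prems(1)]]) (use in_c r' in force)
    have "norm (\<phi> (z + 1 *s v) - (\<Sum>k<K. (deriv ^^ k) (\<lambda>\<zeta>. \<phi> (z + \<zeta> *s v)) 0 / fact k * 1 ^ k))
          \<le> M * (norm (1::complex) / \<rho>) ^ K / (1 - norm (1::complex) / \<rho>)"
    proof (rule taylor_remainder_bound)
      show "(\<lambda>\<zeta>. \<phi> (z + \<zeta> *s v)) holomorphic_on ball 0 \<rho>"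
        by (rule holomorphic_on_subset[OF hol ball_subset_cball])
      show "continuous_on (cball 0 \<rho>) (\<lambda>\<zeta>. \<phi> (z + \<zeta> *s v))"
        by (rule holomorphic_on_imp_continuous_on[OF hol])
    qed (use M in_c r' in auto)
    \<comment> \<open>\<open>v\<close> is \<open>w $ j\<close> times the unit vector
      \<open>E\<close>, so the powers of \<open>w $ j\<close> come out by rescaling the
      parameter.\<close>
    moreover have "(deriv ^^ k) (\<lambda>\<zeta>. \<phi> (z + \<zeta> *s v)) 0 = (w $ j) ^ k * D k z" for k
    proof -
      have "(deriv ^^ k) (\<lambda>\<zeta>. (\<lambda>\<xi>. \<phi> (z + \<xi> *s E)) ((w $ j) * \<zeta>)) 0 =
          (w $ j) ^ k * (deriv ^^ k) (\<lambda>\<xi>. \<phi> (z + \<xi> *s E)) ((w $ j) * 0)"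
      proof (rule higher_deriv_compose_linear[where S = "ball 0 \<rho>" and T = "{\<xi>. z + \<xi> *s E \<in> ball 0 R}"])
        show "w $ j * \<zeta> \<in> {\<xi>. z + \<xi> *s E \<in> ball 0 R}" if "\<zeta> \<in> ball 0 \<rho>" for \<zeta>
          using in_c[of \<zeta>] that r' by (simp add: v_def vector_smult_assoc mult.commute)
        show "open {\<xi>. z + \<xi> *s E \<in> ball 0 R}" by (intro open_line) simp
        show "(\<lambda>\<xi>. \<phi> (z + \<xi> *s E)) holomorphic_on {\<xi>. z + \<xi> *s E \<in> ball 0 R}"
          by (rule line_hol_line[OF insert.prems(1)])
      qed (use r' in auto)
      moreover have "z \<in> ball 0 R" using in_c[of 0] r' by simp
      ultimately show ?thesis
        using higher_deriv_line[OF _ insert.prems(1), of z 0 E k]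
        by (simp add: D_def v_def vector_smult_assoc mult.commute)
    qed
    moreover have "\<phi> w = \<phi> (z + 1 *s v)"
      using insert.prems(2)[of w] w assms(5) eq by simp
    ultimately have "norm (\<phi> w - (\<Sum>k<K. a k w * (w $ j) ^ k)) \<le> M * (1 / \<rho>) ^ K / (1 - 1 / \<rho>)"
      by (simp add: a_def z_def mult_ac)
    then show ?thesis using K by linarith
  qed
  \<comment> \<open>Allowance per coefficient: on \<open>cball 0 r\<close> the k-th error is
    weighted by at most \<open>r ^ k\<close>. The summand 1 keeps the denominator positive when
    \<open>K = 0\<close>.\<close>
  define \<eta> where "\<eta> = e / (2 * ((\<Sum>k<K. r ^ k) + 1))"
  have sp: "(\<Sum>k<K. r ^ k) \<ge> 0" using assms(4) by (intro sum_nonneg) auto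
  then have \<eta>: "\<eta> > 0" "\<eta> * (\<Sum>k<K. r ^ k) \<le> e / 2"
    using insert.prems(3) by (auto simp: \<eta>_def field_simps)
  have "\<exists>p. polyfun 0 p \<and> (\<forall>w\<in>cball 0 r. norm (a k w - p w) \<le> \<eta>)" for k
    by (rule insert.IH[OF ga pa \<eta>(1)])
  then obtain p where p: "\<And>k. polyfun 0 (p k)" "\<And>k w. w \<in> cball 0 r \<Longrightarrow> norm (a k w - p k w) \<le> \<eta>"
    by metis
  show ?case
  proof (intro exI conjI ballI)
    show "polyfun 0 (\<lambda>w. \<Sum>k<K. (w $ j) ^ k * p k w)"
      by (intro polyfun_sum polyfun_nth_power_mult p)
    fix w :: "complex^'n" assume w: "w \<in> cball 0 r"
    have "norm ((\<Sum>k<K. a k w * (w $ j) ^ k) - (\<Sum>k<K. (w $ j) ^ k * p k w))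
        = norm (\<Sum>k<K. (a k w - p k w) * (w $ j) ^ k)"
      by (simp add: sum_subtractf algebra_simps)
    also have "\<dots> \<le> (\<Sum>k<K. \<eta> * r ^ k)"
    proof (rule sum_norm_le)
      fix k
      have "norm (w $ j) \<le> r" using Finite_Cartesian_Product.norm_nth_le[of w j] w by simp
      then show "norm ((a k w - p k w) * (w $ j) ^ k) \<le> \<eta> * r ^ k"
        unfolding norm_mult norm_power using p(2)[OF w, of k] \<eta>(1)
        by (intro mult_mono power_mono) auto
    qed
    also have "\<dots> \<le> e / 2" using \<eta>(2) by (simp add: sum_distrib_left)
    finally have "norm ((\<Sum>k<K. a k w * (w $ j) ^ k) - (\<Sum>k<K. (w $ j) ^ k * p k w)) \<le> e / 2" .
    with tail[OF w] show "norm (\<phi> w - (\<Sum>k<K. (w $ j) ^ k * p k w)) \<le> e"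
      using norm_triangle_ineq[of "\<phi> w - (\<Sum>k<K. a k w * (w $ j) ^ k)" "(\<Sum>k<K. a k w * (w $ j) ^ k) - (\<Sum>k<K. (w $ j) ^ k * p k w)"]
      by simp
  qed
qed

lemma polynomial_approximation:
  fixes \<phi> :: "complex^'n \<Rightarrow> complex"
  assumes phi: "line_hol \<phi> (ball 0 R)" "\<phi> 0 = 0" "\<And>v. line_deriv \<phi> 0 v = 0" and "0 < r" "r < R" "e > 0"
  obtains p where "polyfun 2 p" "\<And>w. w \<in> cball 0 r \<Longrightarrow> norm (\<phi> w - p w) \<le> e"
proof -
  have "proj UNIV w = w" for w :: "complex^'n" by (simp add: proj_def)
  then have "\<exists>p. polyfun 0 p \<and> (\<forall>w\<in>cball 0 r. norm (\<phi> w - p w) \<le> e / 3)"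
    using assms by (intro polynomial_approximation_aux[where S = UNIV and R = R]) auto
  then obtain p where p: "polyfun 0 p" "\<And>w. w \<in> cball 0 r \<Longrightarrow> norm (\<phi> w - p w) \<le> e / 3" by blast
  have g: "line_hol (\<lambda>w. \<phi> w - p w) (ball 0 R)" by (intro line_hol_diff phi line_hol_polyfun[OF p(1)])
  show thesis
  proof (rule that)
    show "polyfun 2 (\<lambda>w. p w - p 0 - line_deriv p 0 w)" by (rule polyfun_cutoff[OF p(1)])
    fix w :: "complex^'n" assume w: "w \<in> cball 0 r"
    have "line_deriv (\<lambda>w. \<phi> w - p w) 0 w = - line_deriv p 0 w"
      using line_deriv_diff[OF phi(1) line_hol_polyfun[OF p(1)], of 0 w] phi assms(4,5) by simp
    moreover have "norm (line_deriv (\<lambda>w. \<phi> w - p w) 0 w) \<le> (e / 3) * norm w / r"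
      by (rule line_deriv_bound[OF g]) (use p(2) assms in auto)
    moreover have "(e / 3) * norm w / r \<le> e / 3" using w assms(4,6) by (simp add: field_simps)
    moreover have "norm (p 0) \<le> e / 3" using p(2)[of 0] phi assms(4) by simp
    ultimately have "norm (\<phi> w - p w) + norm (p 0) + norm (line_deriv p 0 w) \<le> e"
      using p(2)[OF w] by (simp only: norm_minus_cancel)
    moreover have "norm (\<phi> w - (p w - p 0 - line_deriv p 0 w)) \<le> norm (\<phi> w - p w) + norm (p 0) + norm (line_deriv p 0 w)"
      using norm_triangle_ineq[of "\<phi> w - p w + p 0" "line_deriv p 0 w"] norm_triangle_ineq[of "\<phi> w - p w" "p 0"]
      by (simp add: algebra_simps)
    ultimately show "norm (\<phi> w - (p w - p 0 - line_deriv p 0 w)) \<le> e" by linarith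
  qed
qed

subsection \<open>Vector fields generated by automorphisms\<close>

text \<open>A real derivative is additive, so compatibility with complex scalars already makes it
  the action of a complex matrix.\<close>

lemma cn_holomorphic_onI:
  fixes f :: "complex^'n \<Rightarrow> complex^'m"
  assumes "\<And>w. w \<in> S \<Longrightarrow> \<exists>D. (f has_derivative D) (at w within S) \<and> (\<forall>c h. D (c *s h) = c *s D h)"
  shows "cn_holomorphic_on f S"
  unfolding cn_holomorphic_on_def
proof
  fix w assume "w \<in> S"
  then obtain D where D: "(f has_derivative D) (at w within S)" "\<And>c h. D (c *s h) = c *s D h"
    using assms by blast
  have "Vector_Spaces.linear (*s) (*s) D"
    by unfold_locales
      (auto simp: D(2) linear_add[OF has_derivative_linear[OF D(1)]] vector_add_ldistrib vector_sadd_rdistrib vector_smult_assoc)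
  then have "D = (\<lambda>h. matrix D *v h)" by (auto simp: matrix_works)
  then show "\<exists>A. (f has_derivative (*v) A) (at w within S)" using D(1) by metis
qed

lemma cn_holomorphic_on_compose_UNIV:
  assumes "cn_holomorphic_on f UNIV" "cn_holomorphic_on g S"
  shows "cn_holomorphic_on (\<lambda>z. f (g z)) S"
  unfolding cn_holomorphic_on_def
proof
  fix z assume "z \<in> S"
  then obtain A B where "(g has_derivative (*v) A) (at z within S)" "(f has_derivative (*v) B) (at (g z))"
    using assms unfolding cn_holomorphic_on_def by (metis UNIV_I)
  then have "((f \<circ> g) has_derivative ((*v) B \<circ> (*v) A)) (at z within S)"
    by (intro diff_chain_within) (auto intro: has_derivative_at_withinI)
  then show "\<exists>A. ((\<lambda>z. f (g z)) has_derivative (*v) A) (at z within S)"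
    by (auto simp: o_def matrix_vector_mul_assoc intro!: exI[of _ "B ** A"])
qed

lemma cn_holomorphic_imp_continuous_on: "cn_holomorphic_on f S \<Longrightarrow> continuous_on S f"
  unfolding cn_holomorphic_on_def continuous_on_eq_continuous_within
  using has_derivative_continuous by blast

lemma Aut_CnI:
  assumes "cn_holomorphic_on f UNIV" "cn_holomorphic_on g UNIV" "\<And>w. g (f w) = w" "\<And>w. f (g w) = w"
  shows "f \<in> Aut_Cn"
proof -
  have "inv f = g" by (rule inv_unique_comp) (auto simp: assms fun_eq_iff)
  moreover have "bij f" by (rule o_bij[of g]) (auto simp: assms fun_eq_iff)
  ultimately show ?thesis using assms by (simp add: Aut_Cn_def)
qed

lemma Aut_Cn_compose:
  assumes "f \<in> Aut_Cn" "g \<in> Aut_Cn"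
  shows "(\<lambda>w. f (g w)) \<in> Aut_Cn"
proof (rule Aut_CnI)
  show "cn_holomorphic_on (\<lambda>w. f (g w)) UNIV" "cn_holomorphic_on (\<lambda>w. inv g (inv f w)) UNIV"
    using assms by (auto simp: Aut_Cn_def intro: cn_holomorphic_on_compose_UNIV[of f] cn_holomorphic_on_compose_UNIV[of "inv g"])
qed (use assms in \<open>auto simp: Aut_Cn_def bij_def surj_f_inv_f\<close>)

lemma cn_holomorphic_smult: "cn_holomorphic_on (\<lambda>w. c *s (w::complex^'n)) S"
  by (rule cn_holomorphic_onI, rule exI[of _ "\<lambda>h. c *s h"])
    (use has_derivative_smult[OF has_derivative_const has_derivative_ident, of c] in
      \<open>auto simp: vector_smult_assoc mult.commute\<close>)

lemma Aut_Cn_smult: "c \<noteq> 0 \<Longrightarrow> (\<lambda>w. c *s w) \<in> Aut_Cn"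
  by (rule Aut_CnI[OF cn_holomorphic_smult cn_holomorphic_smult[of "inverse c"]])
    (auto simp: vector_smult_assoc)

lemma Aut_Cn_id: "(\<lambda>w. w) \<in> Aut_Cn"
  using Aut_Cn_smult[of 1] by simp

text \<open>Vector fields \<open>V\<close> for which the Euler step \<open>w \<mapsto> w + s V(w)\<close> is realised by automorphisms up to
  \<open>o(s)\<close>. The time \<open>s\<close> is complex, which makes the set a complex vector space.\<close>

definition aut_fields :: "(complex^'n \<Rightarrow> complex^'n) set" where
  "aut_fields = {V. continuous_on UNIV V \<and> (\<exists>\<Phi>::complex \<Rightarrow> complex^'n \<Rightarrow> complex^'n.
     (\<forall>s. \<Phi> s \<in> Aut_Cn \<and> \<Phi> s 0 = 0 \<and> (\<Phi> s has_derivative (\<lambda>h. h)) (at 0)) \<and>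
     (\<forall>R. uniform_limit (cball 0 R) (\<lambda>s w. inverse s *s (\<Phi> s w - w)) V (at 0)))}"

lemma aut_fieldsI:
  assumes "continuous_on UNIV V" "\<And>s. \<Phi> s \<in> Aut_Cn" "\<And>s. \<Phi> s 0 = 0"
    "\<And>s. (\<Phi> s has_derivative (\<lambda>h. h)) (at 0)"
    "\<And>R. uniform_limit (cball 0 R) (\<lambda>s w. inverse s *s (\<Phi> s w - w)) V (at 0)"
  shows "V \<in> aut_fields"
  using assms unfolding aut_fields_def by blast

lemma aut_fieldsE:
  assumes "V \<in> aut_fields"
  obtains \<Phi> where "continuous_on UNIV V" "\<And>s. \<Phi> s \<in> Aut_Cn" "\<And>s. \<Phi> s 0 = 0"
    "\<And>s. (\<Phi> s has_derivative (\<lambda>h. h)) (at 0)"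
    "\<And>R. uniform_limit (cball 0 R) (\<lambda>s w. inverse s *s (\<Phi> s w - w)) V (at 0)"
  using assms unfolding aut_fields_def by blast

lemma aut_fields_zero: "(\<lambda>_. 0) \<in> aut_fields"
  by (rule aut_fieldsI[where \<Phi> = "\<lambda>s w. w"])
    (auto simp: Aut_Cn_id uniform_limit_const intro: has_derivative_ident)

text \<open>The steps are composed: \<open>\<Phi> (\<Psi> w) - w\<close> is
  \<open>\<Phi> (\<Psi> w) - \<Psi> w\<close> plus \<open>\<Psi> w - w\<close>, and the order of
  composition is invisible to first order in \<open>s\<close>.\<close>

lemma aut_fields_add:
  assumes "V \<in> aut_fields" "W \<in> aut_fields"
  shows "(\<lambda>w. V w + W w) \<in> (aut_fields :: (complex^'n \<Rightarrow> complex^'n) set)"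
proof -
  obtain \<Phi> where cV: "continuous_on UNIV V" and \<Phi>: "\<And>s. \<Phi> s \<in> Aut_Cn" "\<And>s. \<Phi> s 0 = 0"
    "\<And>s. (\<Phi> s has_derivative (\<lambda>h. h)) (at 0)"
    and lV: "\<And>R. uniform_limit (cball 0 R) (\<lambda>s w. inverse s *s (\<Phi> s w - w)) V (at 0)"
    using aut_fieldsE[OF assms(1)] by blast
  obtain \<Psi> where cW: "continuous_on UNIV W" and \<Psi>: "\<And>s. \<Psi> s \<in> Aut_Cn" "\<And>s. \<Psi> s 0 = 0"
    "\<And>s. (\<Psi> s has_derivative (\<lambda>h. h)) (at 0)"
    and lW: "\<And>R. uniform_limit (cball 0 R) (\<lambda>s w. inverse s *s (\<Psi> s w - w)) W (at 0)"
    using aut_fieldsE[OF assms(2)] by blast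
  show ?thesis
  proof (rule aut_fieldsI[where \<Phi> = "\<lambda>s w. \<Phi> s (\<Psi> s w)"])
    show "continuous_on UNIV (\<lambda>w. V w + W w)" by (intro continuous_intros cV cW)
    fix s
    show "(\<lambda>w. \<Phi> s (\<Psi> s w)) \<in> Aut_Cn" by (rule Aut_Cn_compose[OF \<Phi>(1) \<Psi>(1)])
    show "\<Phi> s (\<Psi> s 0) = 0" by (simp add: \<Phi> \<Psi>)
    show "((\<lambda>w. \<Phi> s (\<Psi> s w)) has_derivative (\<lambda>h. h)) (at 0)"
      using diff_chain_at[OF \<Psi>(3), of "\<Phi> s" "\<lambda>h. h"] \<Phi>(3)[of s] by (simp add: \<Psi>(2) o_def)
  next
    fix R :: real
    have "bounded (W ` cball 0 R)"
      by (intro compact_imp_bounded compact_continuous_image continuous_on_subset[OF cW]) auto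
    then obtain M where M: "\<And>w. w \<in> cball 0 R \<Longrightarrow> norm (W w) \<le> M" unfolding bounded_iff by blast
    have uc: "uniformly_continuous_on (cball 0 (R + 1)) V"
      by (intro compact_uniformly_continuous continuous_on_subset[OF cV]) auto
    \<comment> \<open>This quotient is evaluated at the moved point \<open>\<Psi> s w\<close>, which
      lies in \<open>cball 0 (R + 1)\<close> and tends to \<open>w\<close> uniformly; uniform
      continuity of \<open>V\<close> absorbs the displacement.\<close>
    have "uniform_limit (cball 0 R) (\<lambda>s w. inverse s *s (\<Phi> s (\<Psi> s w) - \<Psi> s w)) V (at 0)"
    proof (rule uniform_limitI)
      fix e :: real assume e: "e > 0"
      obtain d where d: "d > 0" "\<And>x y. x \<in> cball 0 (R+1) \<Longrightarrow> y \<in> cball 0 (R+1) \<Longrightarrow> dist y x < d \<Longrightarrow> dist (V y) (V x) < e / 2"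
        using uc e unfolding uniformly_continuous_on_def by (metis half_gt_zero)
      have "((\<lambda>s::complex. norm s * (M + 1)) \<longlongrightarrow> norm (0::complex) * (M + 1)) (at 0)"
        by (intro tendsto_intros)
      then have "\<forall>\<^sub>F s in at (0::complex). norm s * (M + 1) < min 1 d"
        using d(1) by (intro order_tendstoD(2)) auto
      moreover have "\<forall>\<^sub>F s in at 0. \<forall>w\<in>cball 0 R. dist (inverse s *s (\<Psi> s w - w)) (W w) < 1"
        by (rule uniform_limitD[OF lW]) simp
      moreover have "\<forall>\<^sub>F s in at 0. \<forall>w\<in>cball 0 (R+1). dist (inverse s *s (\<Phi> s w - w)) (V w) < e / 2"
        by (rule uniform_limitD[OF lV]) (use e in simp)
      ultimately show "\<forall>\<^sub>F s in at 0. \<forall>w\<in>cball 0 R. dist (inverse s *s (\<Phi> s (\<Psi> s w) - \<Psi> s w)) (V w) < e"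
        using eventually_neq_at_within[of 0]
      proof eventually_elim
        case (elim s)
        show ?case
        proof
          fix w :: "complex^'n" assume w: "w \<in> cball 0 R"
          define u where "u = inverse s *s (\<Psi> s w - w)"
          have "norm u \<le> norm (W w) + norm (u - W w)" using norm_triangle_ineq[of "W w" "u - W w"] by simp
          then have "norm u \<le> M + 1" using M[OF w] elim(2) w by (fastforce simp: u_def dist_norm)
          then have "norm (s *s u) \<le> norm s * (M + 1)" by (simp add: norm_smult_vec mult_left_mono)
          moreover have "s *s u = \<Psi> s w - w" using elim(4) by (simp add: u_def vector_smult_assoc)
          ultimately have n: "norm (\<Psi> s w - w) < min 1 d" using elim(1) by simp
          have "norm (\<Psi> s w) \<le> norm w + norm (\<Psi> s w - w)"
            using norm_triangle_ineq[of w "\<Psi> s w - w"] by simp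
          then have in1: "\<Psi> s w \<in> cball 0 (R+1)" and in2: "w \<in> cball 0 (R+1)" using n w by auto
          have "dist (V (\<Psi> s w)) (V w) < e / 2"
            by (rule d(2)[OF in2 in1]) (use n in \<open>simp add: dist_norm\<close>)
          moreover have "dist (inverse s *s (\<Phi> s (\<Psi> s w) - \<Psi> s w)) (V (\<Psi> s w)) < e / 2"
            using elim(3) in1 by blast
          ultimately show "dist (inverse s *s (\<Phi> s (\<Psi> s w) - \<Psi> s w)) (V w) < e"
            using dist_triangle_half_r dist_commute by metis
        qed
      qed
    qed
    from uniform_limit_add[OF this lW[of R]]
    show "uniform_limit (cball 0 R) (\<lambda>s w. inverse s *s (\<Phi> s (\<Psi> s w) - w)) (\<lambda>w. V w + W w) (at 0)"
      by (simp add: vector_add_ldistrib[symmetric])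
  qed
qed

lemma aut_fields_smult:
  assumes "V \<in> aut_fields"
  shows "(\<lambda>w. c *s V w) \<in> (aut_fields :: (complex^'n \<Rightarrow> complex^'n) set)"
proof (cases "c = 0")
  case True
  then show ?thesis using aut_fields_zero by simp
next
  case False
  obtain \<Phi> where cV: "continuous_on UNIV V" and \<Phi>: "\<And>s. \<Phi> s \<in> Aut_Cn" "\<And>s. \<Phi> s 0 = 0"
    "\<And>s. (\<Phi> s has_derivative (\<lambda>h. h)) (at 0)"
    and lV: "\<And>R. uniform_limit (cball 0 R) (\<lambda>s w. inverse s *s (\<Phi> s w - w)) V (at 0)"
    using aut_fieldsE[OF assms(1)] by blast
  show ?thesis
  proof (rule aut_fieldsI[where \<Phi> = "\<lambda>s. \<Phi> (c * s)"])
    show "continuous_on UNIV (\<lambda>w. c *s V w)" by (intro continuous_intros cV)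
    fix R :: real
    have fl: "filterlim (\<lambda>s. c * s) (at 0) (at 0)"
      using False by (auto intro!: filterlim_atI tendsto_eq_intros simp: eventually_at intro: gt_ex)
    show "uniform_limit (cball 0 R) (\<lambda>s w. inverse s *s (\<Phi> (c * s) w - w)) (\<lambda>w. c *s V w) (at 0)"
    proof (rule uniform_limitI)
      fix e :: real assume e: "e > 0"
      have "\<forall>\<^sub>F s in at 0. \<forall>w\<in>cball 0 R. dist (inverse s *s (\<Phi> s w - w)) (V w) < e / norm c"
        by (rule uniform_limitD[OF lV]) (use e False in simp)
      then have "\<forall>\<^sub>F s in at 0. \<forall>w\<in>cball 0 R. dist (inverse (c * s) *s (\<Phi> (c * s) w - w)) (V w) < e / norm c"
        using fl by (rule eventually_compose_filterlim)
      then show "\<forall>\<^sub>F s in at 0. \<forall>w\<in>cball 0 R. dist (inverse s *s (\<Phi> (c * s) w - w)) (c *s V w) < e"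
      proof (rule eventually_mono, intro ballI)
        fix s and w :: "complex^'n"
        assume elim: "\<forall>w\<in>cball 0 R. dist (inverse (c * s) *s (\<Phi> (c * s) w - w)) (V w) < e / norm c" "w \<in> cball 0 R"
        have "inverse s *s (\<Phi> (c * s) w - w) = c *s (inverse (c * s) *s (\<Phi> (c * s) w - w))"
          using False by (simp add: vector_smult_assoc mult.assoc[symmetric])
        then have "dist (inverse s *s (\<Phi> (c * s) w - w)) (c *s V w) = norm c * dist (inverse (c * s) *s (\<Phi> (c * s) w - w)) (V w)"
          by (simp only: dist_norm norm_smult_vec vector_ssub_ldistrib[symmetric])
        also have "\<dots> < norm c * (e / norm c)" using elim False by (intro mult_strict_left_mono) auto
        finally show "dist (inverse s *s (\<Phi> (c * s) w - w)) (c *s V w) < e" using False by simp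
      qed
    qed
  qed (use \<Phi> in auto)
qed

lemma aut_fields_diff:
  "V \<in> aut_fields \<Longrightarrow> W \<in> aut_fields \<Longrightarrow> (\<lambda>w. V w - W w) \<in> aut_fields"
  using aut_fields_add[OF _ aut_fields_smult[of W "-1"]] by (simp add: vector_sneg_minus1[symmetric])

lemma aut_fields_sum:
  "(\<And>i. i \<in> I \<Longrightarrow> V i \<in> aut_fields) \<Longrightarrow> (\<lambda>w. \<Sum>i\<in>I. V i w) \<in> aut_fields"
  by (induction I rule: infinite_finite_induct) (auto intro: aut_fields_zero aut_fields_add)

text \<open>A Vandermonde argument by elimination: subtracting \<open>2 ^ Suc d\<close> times the
  sum at \<open>b\<close> from the sum at \<open>2 * b\<close> removes the top coefficient and
  multiplies the others by the nonzero factors \<open>2 ^ t - 2 ^ Suc d\<close>.\<close>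

lemma aut_fields_coefficient:
  fixes V :: "nat \<Rightarrow> complex^'n \<Rightarrow> complex^'n"
  assumes "\<And>b. (\<lambda>w. \<Sum>t\<le>d. b ^ t *s V t w) \<in> aut_fields" "t \<le> d"
  shows "V t \<in> aut_fields"
  using assms
proof (induction d arbitrary: V t)
  case 0
  from 0(1)[of 0] 0(2) show ?case by simp
next
  case (Suc d)
  have low: "V t \<in> aut_fields" if "t \<le> d" for t
  proof -
    define \<kappa> :: complex where "\<kappa> = 2 ^ t - 2 ^ Suc d"
    have "(\<lambda>w. (2 ^ t - 2 ^ Suc d) *s V t w) \<in> aut_fields"
    proof (rule Suc.IH[where V = "\<lambda>t w. (2 ^ t - 2 ^ Suc d) *s V t w", OF _ that])
      fix b
      have "(\<lambda>w. (\<Sum>t\<le>Suc d. (2 * b) ^ t *s V t w) - 2 ^ Suc d *s (\<Sum>t\<le>Suc d. b ^ t *s V t w)) \<in> aut_fields"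
        by (intro aut_fields_diff aut_fields_smult Suc.prems(1))
      moreover have "(\<Sum>t\<le>Suc d. (2 * b) ^ t *s V t w) - 2 ^ Suc d *s (\<Sum>t\<le>Suc d. b ^ t *s V t w)
         = (\<Sum>t\<le>d. b ^ t *s ((2 ^ t - 2 ^ Suc d) *s V t w))" for w
        by (simp add: vec_eq_iff sum_distrib_left power_mult_distrib algebra_simps sum_subtractf)
      ultimately show "(\<lambda>w. \<Sum>t\<le>d. b ^ t *s ((2 ^ t - 2 ^ Suc d) *s V t w)) \<in> aut_fields" by simp
    qed
    then have "(\<lambda>w. \<kappa> *s V t w) \<in> aut_fields" by (simp add: \<kappa>_def)
    from aut_fields_smult[OF this, of "inverse \<kappa>"]
    have "(\<lambda>w. (inverse \<kappa> * \<kappa>) *s V t w) \<in> aut_fields" by (simp only: vector_smult_assoc)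
    moreover have "\<kappa> \<noteq> 0"
    proof -
      have "(2::nat) ^ t \<noteq> 2 ^ Suc d" using that by (subst power_inject_exp) auto
      then have "of_nat (2 ^ t) \<noteq> (of_nat (2 ^ Suc d) :: complex)" unfolding of_nat_eq_iff .
      then show ?thesis by (simp add: \<kappa>_def)
    qed
    ultimately show ?thesis by simp
  qed
  have "(\<lambda>w. (\<Sum>t\<le>Suc d. 1 ^ t *s V t w) - (\<Sum>t\<le>d. V t w)) \<in> aut_fields"
    by (intro aut_fields_diff aut_fields_sum Suc.prems(1) low) auto
  then have "V (Suc d) \<in> aut_fields" by simp
  with low show ?case using Suc.prems(2) le_Suc_eq by blast
qed

section \<open>Entire functions, shears and overshears\<close>

definition entire :: "(complex^'n \<Rightarrow> complex) \<Rightarrow> bool" where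
  "entire p \<longleftrightarrow> (\<forall>w. \<exists>D. (p has_derivative D) (at w) \<and> (\<forall>c h. D (c *s h) = c * D h))"

lemma entireI:
  assumes "\<And>w. (p has_derivative D w) (at w)" "\<And>w c h. D w (c *s h) = c * D w h"
  shows "entire p"
  using assms unfolding entire_def by blast

lemma entireE:
  assumes "entire p"
  obtains D where "\<And>w. (p has_derivative D w) (at w)" "\<And>w c h. D w (c *s h) = c * D w h"
  using assms unfolding entire_def by metis

lemma entire_const: "entire (\<lambda>_. c)"
  by (rule entireI[of _ "\<lambda>_ _. 0"]) auto

lemma entire_nth: "entire (\<lambda>w. w $ i)"
  by (rule entireI[of _ "\<lambda>_ h. h $ i"])
    (auto intro!: bounded_linear_imp_has_derivative bounded_linear_vec_nth)

lemma entire_add: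
  assumes "entire p" "entire q"
  shows "entire (\<lambda>w. p w + q w)"
proof -
  obtain D where D: "\<And>w. (p has_derivative D w) (at w)" "\<And>w c h. D w (c *s h) = c * D w h"
    using entireE[OF assms(1)] by blast
  obtain E where E: "\<And>w. (q has_derivative E w) (at w)" "\<And>w c h. E w (c *s h) = c * E w h"
    using entireE[OF assms(2)] by blast
  show ?thesis
    by (rule entireI[of _ "\<lambda>w h. D w h + E w h"]) (auto simp: D(2) E(2) algebra_simps intro!: has_derivative_add D(1) E(1))
qed

lemma entire_mult:
  assumes "entire p" "entire q"
  shows "entire (\<lambda>w. p w * q w)"
proof -
  obtain D where D: "\<And>w. (p has_derivative D w) (at w)" "\<And>w c h. D w (c *s h) = c * D w h"
    using entireE[OF assms(1)] by blast
  obtain E where E: "\<And>w. (q has_derivative E w) (at w)" "\<And>w c h. E w (c *s h) = c * E w h"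
    using entireE[OF assms(2)] by blast
  show ?thesis
    by (rule entireI[of _ "\<lambda>w h. p w * E w h + D w h * q w"])
      (use has_derivative_mult[OF D(1) E(1)] in \<open>auto simp: D(2) E(2) algebra_simps\<close>)
qed

lemma entire_exp:
  assumes "entire p"
  shows "entire (\<lambda>w. exp (p w))"
proof -
  obtain D where D: "\<And>w. (p has_derivative D w) (at w)" "\<And>w c h. D w (c *s h) = c * D w h"
    using entireE[OF assms(1)] by blast
  have e: "(exp has_derivative (*) (exp z)) (at z)" for z :: complex
    using DERIV_exp[of z] by (simp add: has_field_derivative_def)
  show ?thesis
    by (rule entireI[of _ "\<lambda>w h. exp (p w) * D w h"])
      (use diff_chain_at[OF D(1) e] in \<open>auto simp: D(2) algebra_simps o_def\<close>)
qed

lemma entire_power: "entire p \<Longrightarrow> entire (\<lambda>w. p w ^ k)"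
  by (induction k) (auto intro: entire_const entire_mult)

lemma entire_prod: "(\<And>i. i \<in> I \<Longrightarrow> entire (p i)) \<Longrightarrow> entire (\<lambda>w. \<Prod>i\<in>I. p i w)"
  by (induction I rule: infinite_finite_induct) (auto intro: entire_const entire_mult)

lemma entire_continuous: "entire p \<Longrightarrow> continuous_on S p"
  by (metis entireE continuous_at_imp_continuous_on has_derivative_continuous)

lemma cn_holomorphic_translation_along:
  assumes "entire p"
  shows "cn_holomorphic_on (\<lambda>w. w + p w *s v) UNIV"
proof (rule cn_holomorphic_onI)
  fix w
  obtain D where D: "\<And>w. (p has_derivative D w) (at w)" "\<And>w c h. D w (c *s h) = c * D w h"
    using entireE[OF assms(1)] by blast
  have "((\<lambda>w. w + p w *s v) has_derivative (\<lambda>h. h + D w h *s v)) (at w)"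
    using has_derivative_add[OF has_derivative_ident has_derivative_smult[OF D(1)[of w] has_derivative_const[of v]]]
    by simp
  moreover have "c *s h + D w (c *s h) *s v = c *s (h + D w h *s v)" for c h
    by (simp add: D(2) vector_add_ldistrib vector_smult_assoc)
  ultimately show "\<exists>D. ((\<lambda>w. w + p w *s v) has_derivative D) (at w within UNIV) \<and> (\<forall>c h. D (c *s h) = c *s D h)"
    by blast
qed

lemma has_derivative_mult_zeros:
  fixes p q :: "complex^'n \<Rightarrow> complex"
  assumes "entire p" "entire q" "p 0 = 0" "q 0 = 0"
  shows "((\<lambda>w. p w * q w) has_derivative (\<lambda>_. 0)) (at 0)"
proof -
  obtain D where D: "\<And>w. (p has_derivative D w) (at w)" "\<And>w c h. D w (c *s h) = c * D w h"
    using entireE[OF assms(1)] by blast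
  obtain E where E: "\<And>w. (q has_derivative E w) (at w)" "\<And>w c h. E w (c *s h) = c * E w h"
    using entireE[OF assms(2)] by blast
  from has_derivative_mult[OF D(1)[of 0] E(1)[of 0]] show ?thesis by (simp add: assms)
qed

lemma has_derivative_translation_along_0:
  fixes p :: "complex^'n \<Rightarrow> complex"
  assumes "(p has_derivative (\<lambda>_. 0)) (at 0)"
  shows "((\<lambda>w. w + p w *s v) has_derivative (\<lambda>h. h)) (at 0)"
  using has_derivative_add[OF has_derivative_ident has_derivative_smult[OF assms has_derivative_const[of v]]]
  by simp

text \<open>As \<open>p\<close> is constant along \<open>v\<close>, the flow is exactly
  \<open>w + (s * p w) *s v\<close>, with inverse at time \<open>- s\<close>; its difference
  quotient equals the field for every nonzero \<open>s\<close>.\<close>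

lemma aut_fields_shear:
  fixes p :: "complex^'n \<Rightarrow> complex"
  assumes "entire p" and inv: "\<And>w t. p (w + t *s v) = p w" and "p 0 = 0"
    and d: "(p has_derivative (\<lambda>_. 0)) (at 0)"
  shows "(\<lambda>w. p w *s v) \<in> aut_fields"
proof (rule aut_fieldsI[where \<Phi> = "\<lambda>s w. w + (s * p w) *s v"])
  show "continuous_on UNIV (\<lambda>w. p w *s v)" by (intro continuous_intros entire_continuous assms)
  fix s
  have inv': "p (w - t *s v) = p w" for w t using inv[of w "- t"] by simp
  have c: "entire (\<lambda>w. s * p w)" for s by (intro entire_mult entire_const assms)
  show "(\<lambda>w. w + (s * p w) *s v) \<in> Aut_Cn"
    by (rule Aut_CnI[OF cn_holomorphic_translation_along[OF c[of s], of v] cn_holomorphic_translation_along[OF c[of "- s"], of v]])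
      (simp_all add: inv inv')
  show "((\<lambda>w. w + (s * p w) *s v) has_derivative (\<lambda>h. h)) (at 0)"
    by (rule has_derivative_translation_along_0) (use has_derivative_mult_right[OF d, of s] in simp)
  show "0 + (s * p 0) *s v = 0" by (simp add: assms)
next
  fix R :: real
  show "uniform_limit (cball 0 R) (\<lambda>s w. inverse s *s (w + (s * p w) *s v - w)) (\<lambda>w. p w *s v) (at 0)"
  proof (rule uniform_limitI)
    fix e :: real assume "e > 0"
    show "\<forall>\<^sub>F s in at 0. \<forall>w\<in>cball 0 R. dist (inverse s *s (w + (s * p w) *s v - w)) (p w *s v) < e"
      using eventually_neq_at_within[of 0] by eventually_elim (use \<open>e > 0\<close> in \<open>simp add: mult.assoc[symmetric]\<close>)
  qed
qed

text \<open>Taylor remainder on the unit disc, on whose boundary \<open>exp\<close> is bounded by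
  \<open>exp 1\<close>; the factor 2 comes from \<open>1 - norm z \<ge> 1 / 2\<close>.\<close>

lemma norm_exp_remainder:
  fixes z :: complex
  assumes "norm z \<le> 1 / 2"
  shows "norm (exp z - 1 - z) \<le> 2 * exp 1 * (norm z)\<^sup>2"
proof -
  have "norm (exp z - (\<Sum>k<2. (deriv ^^ k) exp 0 / fact k * z ^ k)) \<le> exp 1 * (norm z / 1)\<^sup>2 / (1 - norm z / 1)"
  proof (rule taylor_remainder_bound)
    show "norm (exp z) \<le> exp 1" if "norm z = 1" for z :: complex
      using norm_exp[of z] that by simp
  qed (use assms in \<open>auto intro!: continuous_intros holomorphic_intros\<close>)
  also have "\<dots> \<le> exp 1 * (norm z)\<^sup>2 / (1 / 2)"
    using assms by (intro frac_le) auto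
  finally have "norm (exp z - (\<Sum>k<2. (deriv ^^ k) exp 0 / fact k * z ^ k)) \<le> exp 1 * (norm z)\<^sup>2 / (1 / 2)" .
  moreover have "deriv exp (0::complex) = 1" using DERIV_imp_deriv[OF DERIV_exp, of "0::complex"] by simp
  ultimately show ?thesis by (simp add: numeral_2_eq_2 algebra_simps)
qed

text \<open>The flow of a field \<open>p m v\<close>, with \<open>p\<close> constant and \<open>m\<close> affine along \<open>v\<close>, is explicit.\<close>

lemma aut_fields_overshear:
  fixes p m :: "complex^'n \<Rightarrow> complex"
  assumes p: "entire p" "\<And>w t. p (w + t *s v) = p w" "p 0 = 0"
    and m: "entire m" "\<And>w t. m (w + t *s v) = m w + t" "m 0 = 0"
  shows "(\<lambda>w. (p w * m w) *s v) \<in> aut_fields"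
proof (rule aut_fieldsI[where \<Phi> = "\<lambda>s w. w + ((exp (s * p w) + - 1) * m w) *s v"])
  show "continuous_on UNIV (\<lambda>w. (p w * m w) *s v)" by (intro continuous_intros entire_continuous p m)
  fix s
  have e: "entire (\<lambda>w. exp (s * p w) + - 1)" for s
    by (intro entire_add entire_mult entire_exp entire_const p)
  have c: "entire (\<lambda>w. (exp (s * p w) + - 1) * m w)" for s
    by (rule entire_mult[OF e m(1)])
  \<comment> \<open>Along an orbit \<open>p\<close> is fixed and \<open>m\<close> solves m' = p m,
    so time \<open>s\<close> multiplies \<open>m\<close> by \<open>exp (s * p w)\<close>, which time
    \<open>- s\<close> undoes.\<close>
  have i: "(w + ((exp (s * p w) + - 1) * m w) *s v) +
      ((exp (- s * p (w + ((exp (s * p w) + - 1) * m w) *s v)) + - 1) * m (w + ((exp (s * p w) + - 1) * m w) *s v)) *s v = w" for s w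
  proof -
    have "(exp (s * p w) + - 1) * m w + (exp (- s * p w) + - 1) * (m w + (exp (s * p w) + - 1) * m w) = 0"
      by (simp add: exp_minus field_simps)
    then show ?thesis by (simp only: p(2) m(2) add.assoc vector_sadd_rdistrib[symmetric]) simp
  qed
  show "(\<lambda>w. w + ((exp (s * p w) + - 1) * m w) *s v) \<in> Aut_Cn"
    by (rule Aut_CnI[OF cn_holomorphic_translation_along[OF c[of s], of v] cn_holomorphic_translation_along[OF c[of "- s"], of v]])
      (use i[where s = s] i[where s = "- s"] in simp_all)
  show "((\<lambda>w. w + ((exp (s * p w) + - 1) * m w) *s v) has_derivative (\<lambda>h. h)) (at 0)"
    by (intro has_derivative_translation_along_0 has_derivative_mult_zeros e m) (simp add: p)
  show "0 + ((exp (s * p 0) + - 1) * m 0) *s v = 0" by (simp add: m)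
next
  fix R :: real
  have "bounded (p ` cball 0 R)" "bounded (m ` cball 0 R)"
    by (intro compact_imp_bounded compact_continuous_image entire_continuous p m; simp)+
  then obtain P M where P: "\<And>w. w \<in> cball 0 R \<Longrightarrow> norm (p w) \<le> P" and M: "\<And>w. w \<in> cball 0 R \<Longrightarrow> norm (m w) \<le> M"
    unfolding bounded_iff by blast
  show "uniform_limit (cball 0 R) (\<lambda>s w. inverse s *s (w + ((exp (s * p w) + - 1) * m w) *s v - w)) (\<lambda>w. (p w * m w) *s v) (at 0)"
  proof (rule uniform_limitI)
    fix e' :: real assume e': "e' > 0"
    \<comment> \<open>The exponential remainder is quadratic in \<open>s\<close>; one factor
      \<open>norm s\<close> is lost to \<open>inverse s\<close>.\<close>
    define C where "C = 2 * exp 1 * P\<^sup>2 * M * norm v"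
    have "((\<lambda>s::complex. norm s * P) \<longlongrightarrow> norm (0::complex) * P) (at 0)" "((\<lambda>s::complex. norm s * C) \<longlongrightarrow> norm (0::complex) * C) (at 0)"
      by (intro tendsto_intros)+
    then have "\<forall>\<^sub>F s in at (0::complex). norm s * P < 1 / 2" "\<forall>\<^sub>F s in at (0::complex). norm s * C < e'"
      using e' order_tendstoD(2)[of _ _ "at (0::complex)" "1 / 2 :: real"] order_tendstoD(2)[of _ _ "at (0::complex)" e'] by auto
    then show "\<forall>\<^sub>F s in at 0. \<forall>w\<in>cball 0 R. dist (inverse s *s (w + ((exp (s * p w) + - 1) * m w) *s v - w)) ((p w * m w) *s v) < e'"
      using eventually_neq_at_within[of 0]
    proof eventually_elim
      case (elim s)
      show ?case
      proof
        fix w :: "complex^'n" assume w: "w \<in> cball 0 R"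
        note Pw = P[OF w] and Mw = M[OF w]
        have P0: "P \<ge> 0" "M \<ge> 0" using Pw Mw norm_ge_zero order_trans by blast+
        have n: "norm (s * p w) \<le> norm s * P" using Pw by (simp add: norm_mult mult_left_mono)
        have "norm (exp (s * p w) - 1 - s * p w) \<le> 2 * exp 1 * (norm (s * p w))\<^sup>2"
          by (rule norm_exp_remainder) (use n elim in linarith)
        also have "\<dots> \<le> 2 * exp 1 * (norm s * P)\<^sup>2" using n by (intro mult_left_mono power_mono) auto
        finally have r: "norm (exp (s * p w) - 1 - s * p w) \<le> 2 * exp 1 * (norm s * P)\<^sup>2" .
        have "inverse s *s (w + ((exp (s * p w) + - 1) * m w) *s v - w) - (p w * m w) *s v
            = (inverse s * (exp (s * p w) - 1 - s * p w) * m w) *s v"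
          using elim(3) by (simp add: vec_eq_iff field_simps)
        then have "dist (inverse s *s (w + ((exp (s * p w) + - 1) * m w) *s v - w)) ((p w * m w) *s v)
            = inverse (norm s) * norm (exp (s * p w) - 1 - s * p w) * norm (m w) * norm v"
          by (simp add: dist_norm norm_smult_vec norm_mult norm_inverse)
        also have "\<dots> \<le> inverse (norm s) * (2 * exp 1 * (norm s * P)\<^sup>2) * M * norm v"
          using r Mw P0 by (intro mult_mono mult_nonneg_nonneg) auto
        also have "\<dots> = norm s * C" using elim(3) by (simp add: C_def power2_eq_square field_simps)
        finally show "dist (inverse s *s (w + ((exp (s * p w) + - 1) * m w) *s v - w)) ((p w * m w) *s v) < e'"
          using elim(2) by simp
      qed
    qed
  qed
qed

text \<open>For \<open>\<mu> = 0\<close> the whole coefficient is constant along \<open>v\<close>, a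
  shear; otherwise \<open>m\<close> divided by \<open>\<mu>\<close> has slope 1 along
  \<open>v\<close>. Both cases must be covered, since the direction will depend on a parameter that
  may vanish.\<close>

lemma aut_fields_linear_overshear:
  fixes p m :: "complex^'n \<Rightarrow> complex"
  assumes p: "entire p" "\<And>w t. p (w + t *s v) = p w" "p 0 = 0"
    and m: "entire m" "\<And>w t. m (w + t *s v) = m w + t * \<mu>" "m 0 = 0"
  shows "(\<lambda>w. (p w * m w) *s v) \<in> aut_fields"
proof (cases "\<mu> = 0")
  case True
  show ?thesis
  proof (rule aut_fields_shear)
    show "entire (\<lambda>w. p w * m w)" by (rule entire_mult[OF p(1) m(1)])
    show "((\<lambda>w. p w * m w) has_derivative (\<lambda>_. 0)) (at 0)"
      by (rule has_derivative_mult_zeros[OF p(1) m(1) p(3) m(3)])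
  qed (use p m True in auto)
next
  case False
  have "(\<lambda>w. (p w * (inverse \<mu> * m w)) *s v) \<in> aut_fields"
  proof (rule aut_fields_overshear[OF p])
    show "entire (\<lambda>w. inverse \<mu> * m w)" by (intro entire_mult entire_const m)
    show "inverse \<mu> * m (w + t *s v) = inverse \<mu> * m w + t" for w t
      using False by (simp add: m field_simps)
    show "inverse \<mu> * m 0 = 0" by (simp add: m)
  qed
  from aut_fields_smult[OF this, of \<mu>]
  have "(\<lambda>w. (\<mu> * (p w * (inverse \<mu> * m w))) *s v) \<in> aut_fields" by (simp only: vector_smult_assoc)
  moreover have "\<mu> * (p w * (inverse \<mu> * m w)) = p w * m w" for w using False by simp
  ultimately show ?thesis by simp
qed

text \<open>Through the absorption identities, equality would force
  \<open>(l + 2) * (k + 1) = k * (l + 1)\<close> with \<open>m = l + 1 + k\<close>, whose left side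
  is larger. The hypothesis makes the middle coefficient nonzero, so that it cancels.\<close>

lemma binomial_log_concave:
  assumes "Suc l \<le> m"
  shows "(m choose Suc l) * (m choose Suc l) \<noteq> (m choose l) * (m choose Suc (Suc l))"
proof
  define a b c where "a = (m choose l)" and "b = (m choose Suc l)" and "c = (m choose Suc (Suc l))"
  assume "(m choose Suc l) * (m choose Suc l) = (m choose l) * (m choose Suc (Suc l))"
  then have eq: "b * b = a * c" by (simp add: a_def b_def c_def)
  have "Suc l * b = (m - l) * a" "Suc (Suc l) * c = (m - Suc l) * b"
    unfolding a_def b_def c_def by (simp_all only: binomial_absorption binomial_absorb_comp)
  moreover obtain k where k: "m = Suc l + k" using assms le_iff_add by metis
  ultimately have 1: "Suc l * b = Suc k * a" and 2: "Suc (Suc l) * c = k * b" by auto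
  have "Suc (Suc l) * Suc k * (b * b) = Suc (Suc l) * Suc k * (a * c)" by (simp only: eq)
  also have "\<dots> = (Suc (Suc l) * c) * (Suc k * a)" by (simp only: mult_ac)
  also have "\<dots> = (k * b) * (Suc l * b)" by (simp only: 1 2)
  also have "\<dots> = k * Suc l * (b * b)" by (simp only: mult_ac)
  finally have "Suc (Suc l) * Suc k * (b * b) = k * Suc l * (b * b)" .
  moreover have "b > 0" using assms by (simp add: b_def)
  ultimately have "Suc (Suc l) * Suc k = k * Suc l" by (metis mult_right_cancel nat_0_less_mult_iff neq0_conv)
  then show False by simp
qed

text \<open>For every \<open>b\<close> the field \<open>(x + b y)\<^sup>m c M (b e\<^sub>i - e\<^sub>j)\<close>, with \<open>x\<close>, \<open>y\<close> the coordinates \<open>i\<close>, \<open>j\<close>,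
  is a shear or an overshear; the conclusions are its coefficients as a polynomial in \<open>b\<close>.\<close>

lemma aut_fields_binomial_coefficients:
  fixes i j :: "'n::finite" and c M :: "complex^'n \<Rightarrow> complex"
  assumes ij: "i \<noteq> j" and c: "entire c" "\<And>w t. c (w + t *s axis i 1) = c w" "\<And>w t. c (w + t *s axis j 1) = c w"
    and c0: "m = 0 \<Longrightarrow> c 0 = 0" and M: "M = (\<lambda>w. w $ i) \<or> M = (\<lambda>w. w $ j)"
  defines "F \<equiv> \<lambda>t w. of_nat (m choose t) * (w $ i) ^ (m - t) * (w $ j) ^ t * c w * M w"
  shows "(\<lambda>w. F 0 w *s axis j 1) \<in> aut_fields"
    and "t \<le> m \<Longrightarrow> (\<lambda>w. F t w *s axis i 1 - F (Suc t) w *s axis j 1) \<in> aut_fields"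
proof -
  \<comment> \<open>Coefficient of \<open>b ^ t\<close>: the \<open>axis i 1\<close> part of the
    direction carries an extra factor \<open>b\<close>, hence the shifted index, and degree 0
    consists of the \<open>axis j 1\<close> part alone.\<close>
  define V where "V t w = (case t of 0 \<Rightarrow> - F 0 w *s axis j 1 | Suc t' \<Rightarrow> F t' w *s axis i 1 - F t w *s axis j 1)" for t w
  have "(\<lambda>w. \<Sum>t\<le>Suc m. b ^ t *s V t w) \<in> aut_fields" for b
  proof -
    \<comment> \<open>Along this direction \<open>w $ i + b * w $ j\<close> does not change, since
      \<open>b - b * 1 = 0\<close>.\<close>
    define v :: "complex^'n" where "v = b *s axis i 1 - axis j 1"
    define p where "p w = (w $ i + b * w $ j) ^ m * c w" for w :: "complex^'n"
    have v: "v $ i = b" "v $ j = -1" using ij by (auto simp: v_def axis_def)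
    have cv: "c (w + t *s v) = c w" for w t
    proof -
      have "w + t *s v = (w + (t * b) *s axis i 1) + (- t) *s axis j 1"
        by (simp add: v_def vec_eq_iff algebra_simps)
      then show ?thesis by (simp only: c)
    qed
    have "(\<lambda>w. (p w * M w) *s v) \<in> aut_fields"
    proof (rule aut_fields_linear_overshear[where \<mu> = "M v"])
      show "entire p" unfolding p_def by (intro entire_mult entire_power entire_add entire_nth entire_const c)
      show "p (w + t *s v) = p w" for w t by (simp add: p_def cv v algebra_simps)
      \<comment> \<open>For \<open>m = 0\<close> the power is 1, and only \<open>c\<close> can
        vanish at 0.\<close>
      show "p 0 = 0" using c0 by (cases m) (auto simp: p_def)
    qed (use M in \<open>auto intro: entire_nth\<close>)
    moreover have "(p w * M w) *s v = (\<Sum>t\<le>Suc m. b ^ t *s V t w)" for w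
    proof -
      have "(w $ i + b * w $ j) ^ m = (\<Sum>t\<le>m. of_nat (m choose t) * (b * w $ j) ^ t * (w $ i) ^ (m - t))"
        using binomial_ring[of "b * w $ j" "w $ i" m] by (simp add: add.commute)
      then have pM: "p w * M w = (\<Sum>t\<le>m. b ^ t * F t w)"
        by (simp add: p_def F_def sum_distrib_left sum_distrib_right power_mult_distrib mult_ac)
      \<comment> \<open>The binomial coefficient is 0 beyond \<open>m\<close>, so the sum may gain
        one term to match the shifted index.\<close>
      have "F (Suc m) w = 0" by (simp add: F_def)
      then have "(\<Sum>t\<le>m. b ^ t * F t w) = (\<Sum>t\<le>Suc m. b ^ t * F t w)" by simp
      also have "\<dots> = F 0 w + (\<Sum>t\<le>m. b ^ Suc t * F (Suc t) w)" by (subst sum.atMost_Suc_shift) simp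
      finally have pM': "p w * M w = F 0 w + (\<Sum>t\<le>m. b ^ Suc t * F (Suc t) w)" using pM by simp
      have "(\<Sum>t\<le>Suc m. b ^ t *s V t w) = V 0 w + (\<Sum>t\<le>m. b ^ Suc t *s V (Suc t) w)"
        by (subst sum.atMost_Suc_shift) simp
      also have "\<dots> = (b * (\<Sum>t\<le>m. b ^ t * F t w)) *s axis i 1 - (F 0 w + (\<Sum>t\<le>m. b ^ Suc t * F (Suc t) w)) *s axis j 1"
        by (simp add: V_def vec_eq_iff sum_subtractf sum_distrib_left sum_distrib_right algebra_simps)
      also have "\<dots> = (p w * M w) *s v"
        unfolding pM[symmetric] pM'[symmetric] by (simp add: v_def vec_eq_iff algebra_simps)
      finally show ?thesis by simp
    qed
    ultimately show ?thesis by simp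
  qed
  note * = aut_fields_coefficient[OF this]
  show "(\<lambda>w. F 0 w *s axis j 1) \<in> aut_fields"
    using aut_fields_smult[OF *[of 0], of "-1"] by (simp add: V_def vector_smult_assoc)
  show "t \<le> m \<Longrightarrow> (\<lambda>w. F t w *s axis i 1 - F (Suc t) w *s axis j 1) \<in> aut_fields"
    using *[of "Suc t"] by (simp add: V_def)
qed

text \<open>The choices \<open>M = x\<close> and \<open>M = y\<close> give two linear relations between \<open>x\<^sup>k\<^sup>+\<^sup>1 y\<^sup>l c e\<^sub>i\<close> and
  \<open>x\<^sup>k y\<^sup>l\<^sup>+\<^sup>1 c e\<^sub>j\<close>, which are independent by log-concavity of the binomial coefficients.\<close>

lemma aut_fields_two_variables:
  fixes i j :: "'n::finite" and c :: "complex^'n \<Rightarrow> complex"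
  assumes ij: "i \<noteq> j" and c: "entire c" "\<And>w t. c (w + t *s axis i 1) = c w" "\<And>w t. c (w + t *s axis j 1) = c w"
    and c0: "k + l = 0 \<Longrightarrow> c 0 = 0"
  shows "(\<lambda>w. ((w $ i) ^ Suc k * (w $ j) ^ l * c w) *s axis i 1) \<in> aut_fields"
proof -
  define X where "X w = ((w $ i) ^ Suc k * (w $ j) ^ l * c w) *s (axis i 1 :: complex^'n)" for w
  define Y where "Y w = ((w $ i) ^ k * (w $ j) ^ Suc l * c w) *s (axis j 1 :: complex^'n)" for w
  define m where "m = k + l"
  define A B where "A = (of_nat (m choose l) :: complex)" and "B = (of_nat (m choose Suc l) :: complex)"
  note b = aut_fields_binomial_coefficients[OF ij c, of m, OF c0[folded m_def]]
  have AB: "(\<lambda>w. A *s X w - B *s Y w) \<in> aut_fields"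
  proof -
    have "(\<lambda>w. (of_nat (m choose l) * (w $ i) ^ (m - l) * (w $ j) ^ l * c w * w $ i) *s axis i 1 -
      (of_nat (m choose Suc l) * (w $ i) ^ (m - Suc l) * (w $ j) ^ Suc l * c w * w $ i) *s axis j 1) \<in> aut_fields"
      by (rule b(2)) (auto simp: m_def)
    \<comment> \<open>For \<open>k = 0\<close> the natural subtraction \<open>m - Suc l\<close>
      truncates, but then \<open>B = 0\<close> and the term vanishes on both sides.\<close>
    moreover have "(of_nat (m choose l) * (w $ i) ^ (m - l) * (w $ j) ^ l * c w * w $ i) *s axis i 1 -
      (of_nat (m choose Suc l) * (w $ i) ^ (m - Suc l) * (w $ j) ^ Suc l * c w * w $ i) *s axis j 1 = A *s X w - B *s Y w"
      for w :: "complex^'n"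
      by (cases k) (auto simp: A_def B_def X_def Y_def m_def vec_eq_iff)
    ultimately show ?thesis by simp
  qed
  have "X \<in> aut_fields"
  proof (cases l)
    case 0
    \<comment> \<open>With \<open>l = 0\<close> the field \<open>Y\<close> is itself the lowest
      coefficient, so the single relation \<open>AB\<close> suffices.\<close>
    have "(\<lambda>w. (of_nat (m choose 0) * (w $ i) ^ (m - 0) * (w $ j) ^ 0 * c w * w $ j) *s axis j 1) \<in> aut_fields"
      by (rule b(1)) auto
    then have "Y \<in> aut_fields" using 0 by (simp add: Y_def[abs_def] m_def mult_ac)
    from aut_fields_add[OF AB aut_fields_smult[OF this, of B]] show ?thesis using 0 by (simp add: A_def)
  next
    case (Suc l')
    define C where "C = (of_nat (m choose l') :: complex)"
    have CA: "(\<lambda>w. C *s X w - A *s Y w) \<in> aut_fields"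
    proof -
      have "(\<lambda>w. (of_nat (m choose l') * (w $ i) ^ (m - l') * (w $ j) ^ l' * c w * w $ j) *s axis i 1 -
        (of_nat (m choose Suc l') * (w $ i) ^ (m - Suc l') * (w $ j) ^ Suc l' * c w * w $ j) *s axis j 1) \<in> aut_fields"
        by (rule b(2)) (auto simp: m_def Suc)
      moreover have "(of_nat (m choose l') * (w $ i) ^ (m - l') * (w $ j) ^ l' * c w * w $ j) *s axis i 1 -
        (of_nat (m choose Suc l') * (w $ i) ^ (m - Suc l') * (w $ j) ^ Suc l' * c w * w $ j) *s axis j 1 = C *s X w - A *s Y w"
        for w :: "complex^'n"
        by (auto simp: A_def C_def X_def Y_def m_def Suc vec_eq_iff)
      ultimately show ?thesis by simp
    qed
    have "A * A \<noteq> C * B"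
    proof -
      have "of_nat ((m choose l) * (m choose l)) \<noteq> (of_nat ((m choose l') * (m choose Suc l)) :: complex)"
        unfolding of_nat_eq_iff using binomial_log_concave[of l' m] by (simp add: Suc m_def)
      then show ?thesis by (simp add: A_def B_def C_def)
    qed
    define \<kappa> where "\<kappa> = A * A - B * C"
    have "\<kappa> \<noteq> 0" using \<open>A * A \<noteq> C * B\<close> by (simp add: \<kappa>_def mult.commute)
    \<comment> \<open>Elimination of \<open>Y\<close>: the determinant \<open>A * A - B * C\<close>
      of the two relations remains in front of \<open>X\<close>.\<close>
    have "(\<lambda>w. A *s (A *s X w - B *s Y w) - B *s (C *s X w - A *s Y w)) \<in> aut_fields"
      by (intro aut_fields_diff aut_fields_smult AB CA)
    moreover have "A *s (A *s X w - B *s Y w) - B *s (C *s X w - A *s Y w) = \<kappa> *s X w" for w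
      by (simp add: \<kappa>_def vec_eq_iff algebra_simps)
    ultimately have "(\<lambda>w. \<kappa> *s X w) \<in> aut_fields" by simp
    from aut_fields_smult[OF this, of "inverse \<kappa>"] show ?thesis
      using \<open>\<kappa> \<noteq> 0\<close> by (simp add: vector_smult_assoc)
  qed
  then show ?thesis by (simp add: X_def[abs_def])
qed

text \<open>A monomial free of coordinate \<open>i\<close> gives a shear. Otherwise a second
  coordinate \<open>j\<close> is singled out, the remaining factors being constant in both; this is
  where dimension at least two enters.\<close>

lemma aut_fields_monomial:
  fixes i :: "'n::finite"
  assumes "CARD('n) \<ge> 2" "sum \<alpha> UNIV \<ge> 2"
  shows "(\<lambda>w. monomial \<alpha> w *s axis i 1) \<in> aut_fields"
proof -
  obtain j where j: "j \<noteq> i"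
  proof -
    have "UNIV \<noteq> {i}"
    proof
      assume "UNIV = {i}"
      from arg_cong[OF this, of card] show False using assms(1) by simp
    qed
    then show thesis using that by blast
  qed
  define c where "c w = (\<Prod>t\<in>UNIV - {i} - {j}. (w $ t) ^ \<alpha> t)" for w :: "complex^'n"
  have split: "monomial \<alpha> w = (w $ i) ^ \<alpha> i * (w $ j) ^ \<alpha> j * c w" for w
  proof -
    have "monomial \<alpha> w = (w $ i) ^ \<alpha> i * (\<Prod>t\<in>UNIV - {i}. (w $ t) ^ \<alpha> t)"
      unfolding monomial_def by (rule prod.remove) auto
    also have "(\<Prod>t\<in>UNIV - {i}. (w $ t) ^ \<alpha> t) = (w $ j) ^ \<alpha> j * c w"
      unfolding c_def by (rule prod.remove) (use j in auto)
    finally show ?thesis by simp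
  qed
  have cm: "entire (monomial \<alpha>)" unfolding monomial_def by (intro entire_prod entire_power entire_nth)
  show ?thesis
  proof (cases "\<alpha> i")
    case 0
    show ?thesis
    proof (rule aut_fields_shear[OF cm])
      show "monomial \<alpha> (w + t *s axis i 1) = monomial \<alpha> w" for w t
        unfolding monomial_def by (rule prod.cong) (use 0 in \<open>auto simp: axis_def\<close>)
      show "monomial \<alpha> 0 = 0" using assms(2) by (simp add: monomial_at_0 del: sum_eq_0_iff)
      have g: "line_deriv (monomial \<alpha>) 0 h = 0" for h using assms(2) line_deriv_monomial_0[of \<alpha> h] by auto
      obtain D where D: "\<And>w. (monomial \<alpha> has_derivative D w) (at w)" "\<And>w c h. D w (c *s h) = c * D w h"
        using entireE[OF cm] by blast
      have "D 0 h = 0" for h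
      proof -
        have l: "((\<lambda>\<zeta>. \<zeta> *s h) has_derivative (\<lambda>\<zeta>. \<zeta> *s h)) (at 0)"
          by (intro bounded_linear_imp_has_derivative bounded_linear_intro[where K = "norm h"])
            (auto simp: vector_sadd_rdistrib norm_smult_vec vec_eq_iff)
        have "(monomial \<alpha> has_derivative D 0) (at (0 *s h))" using D(1)[of 0] by simp
        from diff_chain_at[OF l this] have "((\<lambda>\<zeta>. monomial \<alpha> (0 + \<zeta> *s h)) has_derivative (\<lambda>\<zeta>. D 0 h * \<zeta>)) (at 0)"
          by (simp add: o_def D(2) mult.commute)
        then have "((\<lambda>\<zeta>. monomial \<alpha> (0 + \<zeta> *s h)) has_field_derivative D 0 h) (at 0)"
          by (simp add: has_field_derivative_def)
        from line_deriv_unique[OF this] g show ?thesis by simp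
      qed
      then have "D 0 = (\<lambda>_. 0)" by auto
      then show "(monomial \<alpha> has_derivative (\<lambda>_. 0)) (at 0)" using D(1)[of 0] by simp
    qed
  next
    case (Suc k)
    have "(\<lambda>w. ((w $ i) ^ Suc k * (w $ j) ^ \<alpha> j * c w) *s axis i 1) \<in> aut_fields"
    proof (rule aut_fields_two_variables)
      show "i \<noteq> j" using j by simp
      show "entire c" unfolding c_def by (intro entire_prod entire_power entire_nth)
      show "c (w + t *s axis i 1) = c w" "c (w + t *s axis j 1) = c w" for w t
        unfolding c_def by (rule prod.cong; auto simp: axis_def)+
      \<comment> \<open>Here the monomial is \<open>w $ i\<close> times \<open>c\<close>, so degree
        at least two leaves a nonconstant factor in \<open>c\<close>.\<close>
      assume "k + \<alpha> j = 0"
      then have "sum \<alpha> (UNIV - {i} - {j}) \<noteq> 0"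
        using assms(2) Suc sum.remove[of UNIV i \<alpha>] sum.remove[of "UNIV - {i}" j \<alpha>] j
        by (simp del: sum_eq_0_iff)
      then obtain t where "t \<in> UNIV - {i} - {j}" "\<alpha> t \<noteq> 0" by (meson sum_eq_0_iff finite)
      then show "c 0 = 0" unfolding c_def by (intro prod_zero) auto
    qed
    then show ?thesis by (simp only: split Suc)
  qed
qed

lemma aut_fields_polyfun:
  fixes p :: "complex^'n \<Rightarrow> complex"
  assumes "CARD('n::finite) \<ge> 2" "polyfun 2 p"
  shows "(\<lambda>w. p w *s axis i 1) \<in> aut_fields"
  using assms(2)
proof (induction rule: polyfun.induct)
  case polyfun_zero
  then show ?case using aut_fields_zero by simp
next
  case (polyfun_add_monomial \<alpha> p c)
  from aut_fields_add[OF aut_fields_smult[OF aut_fields_monomial[OF assms(1) this(1), of i], of c] this(3)]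
  show ?case by (simp add: vector_smult_assoc vector_sadd_rdistrib)
qed

lemma aut_fields_polynomial_map:
  fixes p :: "'n::finite \<Rightarrow> complex^'n \<Rightarrow> complex"
  assumes "CARD('n) \<ge> 2" "\<And>i. polyfun 2 (p i)"
  shows "(\<lambda>w. \<chi> i. p i w) \<in> aut_fields"
proof -
  have "(\<lambda>w. \<Sum>i\<in>UNIV. p i w *s axis i 1) \<in> aut_fields"
    by (intro aut_fields_sum aut_fields_polyfun assms)
  moreover have "(\<Sum>i\<in>UNIV. p i w *s axis i 1) = (\<chi> i. p i w)" for w
    using basis_expansion[of "\<chi> i. p i w"] by simp
  ultimately show ?thesis by simp
qed

subsection \<open>The vector field of a starlike mapping\<close>

lemma cn_holomorphic_has_derivative:
  assumes "cn_holomorphic_on f S" "open S" "z \<in> S"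
  shows "(f has_derivative (*v) (Df f z)) (at z)"
proof -
  obtain A where A: "(f has_derivative (*v) A) (at z)"
    using assms unfolding cn_holomorphic_on_def by (metis at_within_open)
  then have "frechet_derivative f (at z) = (*v) A" by (metis frechet_derivative_at)
  then show ?thesis using A by (simp add: matrix_of_matrix_vector_mul)
qed

lemma Df_unique:
  assumes "(f has_derivative (*v) A) (at z)"
  shows "Df f z = A"
  using frechet_derivative_at[OF assms] by (metis matrix_of_matrix_vector_mul)

lemma cn_holomorphic_line_derivative:
  assumes "cn_holomorphic_on f S" "open S" "a + \<zeta> *s v \<in> S"
  shows "((\<lambda>\<zeta>. f (a + \<zeta> *s v) $ i) has_field_derivative (Df f (a + \<zeta> *s v) *v v) $ i) (at \<zeta>)"
proof -
  define A where "A = Df f (a + \<zeta> *s v)"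
  have l: "((\<lambda>\<zeta>. a + \<zeta> *s v) has_derivative (\<lambda>\<tau>. \<tau> *s v)) (at \<zeta>)"
    using has_derivative_add[OF has_derivative_const[of a] bounded_linear_imp_has_derivative[OF bounded_linear_intro[where f = "\<lambda>\<tau>. \<tau> *s v" and K = "norm v"]]]
    by (simp add: vector_sadd_rdistrib norm_smult_vec vec_eq_iff)
  have f: "(f has_derivative (*v) A) (at (a + \<zeta> *s v))"
    unfolding A_def by (rule cn_holomorphic_has_derivative[OF assms])
  have "((\<lambda>x. x $ i) \<circ> (f \<circ> (\<lambda>\<zeta>. a + \<zeta> *s v)) has_derivative (\<lambda>x. x $ i) \<circ> ((*v) A \<circ> (\<lambda>\<tau>. \<tau> *s v))) (at \<zeta>)"
    by (intro diff_chain_at l f bounded_linear_imp_has_derivative bounded_linear_vec_nth)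
  moreover have "(A *v (\<tau> *s v)) $ i = (A *v v) $ i * \<tau>" for \<tau>
    by (simp add: matrix_vector_mult_def sum_distrib_left sum_distrib_right mult_ac)
  ultimately show ?thesis by (simp add: has_field_derivative_def o_def A_def)
qed

lemma cn_holomorphic_imp_line_hol:
  fixes f :: "complex^'n \<Rightarrow> complex^'n"
  assumes "cn_holomorphic_on f S" "open S"
  shows "line_hol (\<lambda>z. f z $ i) S"
  unfolding line_hol_def
proof (intro conjI allI)
  show "continuous_on S (\<lambda>z. f z $ i)"
    by (intro continuous_intros cn_holomorphic_imp_continuous_on assms)
  show "(\<lambda>\<zeta>. f (a + \<zeta> *s v) $ i) holomorphic_on {\<zeta>. a + \<zeta> *s v \<in> S}" for a v
    unfolding holomorphic_on_open[OF open_line[OF assms(2)]]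
    using cn_holomorphic_line_derivative[OF assms] by blast
qed

lemma line_deriv_component:
  assumes "cn_holomorphic_on f S" "open S" "z \<in> S"
  shows "line_deriv (\<lambda>z. f z $ i) z v = (Df f z *v v) $ i"
  using cn_holomorphic_line_derivative[OF assms(1,2), of z 0 v i] assms(3) by (intro line_deriv_unique) simp

lemma Df_component:
  assumes "cn_holomorphic_on f S" "open S" "z \<in> S"
  shows "Df f z $ i $ j = line_deriv (\<lambda>z. f z $ i) z (axis j 1)"
  unfolding line_deriv_component[OF assms] 
  by (simp add: matrix_vector_mult_def axis_def if_distrib[of "\<lambda>x. _ * x"] cong: if_cong)

lemma line_hol_Df:
  assumes "cn_holomorphic_on f S" "open S"
  shows "line_hol (\<lambda>z. Df f z $ i $ j) S"
proof -
  have "line_hol (\<lambda>z. line_deriv (\<lambda>z. f z $ i) z (axis j 1)) S"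
    by (intro line_hol_line_deriv cn_holomorphic_imp_line_hol assms)
  then show ?thesis using Df_component[OF assms] by (subst line_hol_cong) auto
qed

lemma line_hol_det:
  assumes "\<And>i j. line_hol (\<lambda>z. A z $ i $ j) S"
  shows "line_hol (\<lambda>z. det (A z)) S"
  unfolding det_def by (intro line_hol_sum line_hol_mult line_hol_prod line_hol_const assms)

lemma matrix_inv_works:
  fixes A :: "complex^'n^'n"
  assumes "det A \<noteq> 0"
  shows "A ** matrix_inv A = mat 1" "matrix_inv A ** A = mat 1"
  using assms invertible_det_nz unfolding invertible_def matrix_inv_def
  by (metis (mono_tags, lifting) someI_ex)+

text \<open>Cramer's rule writes the components as determinants divided by \<open>det A\<close>;
  holomorphy and continuity of \<open>hfield\<close> are read off from this form.\<close>

lemma matrix_inv_cramer: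
  fixes A :: "complex^'n^'n"
  assumes "det A \<noteq> 0"
  shows "matrix_inv A *v b = (\<chi> k. det (\<chi> i j. if j = k then b $ i else A $ i $ j) / det A)"
proof -
  have "A *v (matrix_inv A *v b) = b"
    by (simp add: matrix_vector_mul_assoc matrix_inv_works[OF assms])
  then show ?thesis unfolding cramer[OF assms] .
qed

definition hfield :: "(complex^'n \<Rightarrow> complex^'n) \<Rightarrow> complex^'n \<Rightarrow> complex^'n" where
  "hfield f z = matrix_inv (Df f z) *v f z"

lemma Df_hfield:
  assumes "det (Df f z) \<noteq> 0"
  shows "Df f z *v hfield f z = f z"
  unfolding cramer[OF assms] hfield_def matrix_inv_cramer[OF assms] ..

lemma line_hol_hfield:
  assumes f: "cn_holomorphic_on f S" "open S" and d: "\<And>z. z \<in> S \<Longrightarrow> det (Df f z) \<noteq> 0"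
  shows "line_hol (\<lambda>z. hfield f z $ k) S"
proof -
  have "line_hol (\<lambda>z. det (\<chi> i j. if j = k then f z $ i else Df f z $ i $ j) / det (Df f z)) S"
  proof (intro line_hol_divide line_hol_det)
    show "line_hol (\<lambda>z. (\<chi> i j. if j = k then f z $ i else Df f z $ i $ j) $ i $ j) S" for i j
      by (cases "j = k") (simp_all add: line_hol_Df[OF f] cn_holomorphic_imp_line_hol[OF f])
  qed (use line_hol_Df[OF f] d in auto)
  then show ?thesis
    by (subst line_hol_cong) (use d in \<open>auto simp: hfield_def matrix_inv_cramer\<close>)
qed

lemma det_nonzero_of_left_inverse:
  fixes f k :: "complex^'n \<Rightarrow> complex^'n"
  assumes "(f has_derivative (*v) A) (at z)" "(k has_derivative (*v) B) (at (f z))"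
    and U: "open U" "z \<in> U" "\<And>x. x \<in> U \<Longrightarrow> k (f x) = x"
  shows "det A \<noteq> 0"
proof -
  have "((\<lambda>x. k (f x)) has_derivative (*v) (B ** A)) (at z)"
    using diff_chain_at[OF assms(1,2)] by (simp add: o_def matrix_vector_mul_assoc)
  then have "((\<lambda>x. x) has_derivative (*v) (B ** A)) (at z)"
    by (rule has_derivative_transform_within_open[OF _ U(1,2)]) (rule U(3))
  then have "(\<lambda>h. h) = (*v) (B ** A)"
    by (rule has_derivative_unique[OF has_derivative_ident])
  then have "(B ** A) *v x = mat 1 *v x" for x by (metis matrix_vector_mul_lid)
  then have "B ** A = mat 1" by (simp add: matrix_eq)
  then show ?thesis by (metis det_I det_mul mult_zero_right one_neq_zero)
qed

lemma LS_ball_props: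
  assumes "f \<in> LS_ball"
  shows "cn_holomorphic_on f unit_ball" "f 0 = 0" "Df f 0 = mat 1" "\<And>z. z \<in> unit_ball \<Longrightarrow> det (Df f z) \<noteq> 0"
proof -
  show h: "cn_holomorphic_on f unit_ball" and "f 0 = 0" "Df f 0 = mat 1"
    using assms by (auto simp: LS_ball_def H_ball_def)
  fix z :: "complex^'a" assume z: "z \<in> unit_ball"
  then obtain U where U: "z \<in> U" "U \<subseteq> unit_ball" "open U" "open (f ` U)" "inj_on f U"
    "cn_holomorphic_on (inv_into U f) (f ` U)"
    using assms unfolding LS_ball_def cn_locally_biholomorphic_on_def cn_biholomorphic_on_def by blast
  show "det (Df f z) \<noteq> 0"
    by (rule det_nonzero_of_left_inverse[OF cn_holomorphic_has_derivative[OF h open_ball z]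
          cn_holomorphic_has_derivative[OF U(6,4) imageI[OF U(1)]] U(3,1)])
      (use U(5) in simp)
qed

text \<open>The product rule is applied to \<open>f z = Df f z *v hfield f z\<close> at 0: as
  \<open>hfield f 0 = 0\<close>, the derivative of \<open>Df f\<close> drops out, and
  \<open>Df f 0\<close> is the identity.\<close>

lemma hfield_normalized:
  assumes f: "cn_holomorphic_on f S" "open S" "0 \<in> S" "f 0 = 0" "Df f 0 = mat 1"
    and d: "\<And>z. z \<in> S \<Longrightarrow> det (Df f z) \<noteq> 0"
  shows "hfield f 0 = 0" "line_deriv (\<lambda>z. hfield f z $ k) 0 v = v $ k"
proof -
  show h0: "hfield f 0 = 0" by (simp add: hfield_def f)
  note gh = line_hol_hfield[OF f(1,2) d] and gD = line_hol_Df[OF f(1,2)]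
  define F where "F z = (\<Sum>j\<in>UNIV. Df f z $ k $ j * hfield f z $ j)" for z
  have eq: "f z $ k = F z" if "z \<in> S" for z
    using arg_cong[OF Df_hfield[OF d[OF that]], of "\<lambda>x. x $ k"] by (simp add: F_def matrix_vector_mult_def)
  have gF: "line_hol F S" unfolding F_def by (intro line_hol_sum line_hol_mult gD gh)
  have "line_deriv F 0 v = (\<Sum>j\<in>UNIV. line_deriv (\<lambda>z. Df f z $ k $ j * hfield f z $ j) 0 v)"
    unfolding F_def by (rule line_deriv_sum[where S = S]) (use f in \<open>auto intro!: line_hol_mult gD gh\<close>)
  also have "\<dots> = (\<Sum>j\<in>UNIV. (mat 1 :: complex^'a^'a) $ k $ j * line_deriv (\<lambda>z. hfield f z $ j) 0 v)"
    by (intro sum.cong refl) (subst line_deriv_mult[OF gD gh f(2,3)], simp_all add: h0 f)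
  also have "\<dots> = line_deriv (\<lambda>z. hfield f z $ k) 0 v"
    by (simp add: mat_def if_distrib[of "\<lambda>x. x * _"] cong: if_cong)
  finally have 1: "line_deriv F 0 v = line_deriv (\<lambda>z. hfield f z $ k) 0 v" .
  have "((\<lambda>\<zeta>. F (0 + \<zeta> *s v)) has_field_derivative line_deriv F 0 v) (at 0)"
    by (rule line_deriv_has_field_derivative[OF gF f(2,3)])
  then have "((\<lambda>\<zeta>. f (0 + \<zeta> *s v) $ k) has_field_derivative line_deriv F 0 v) (at 0)"
    by (rule has_field_derivative_transform_within_open[OF _ open_line[OF f(2), of 0 v]]) (use eq f(3) in auto)
  then have "line_deriv (\<lambda>z. f z $ k) 0 v = line_deriv F 0 v" by (rule line_deriv_unique)
  then show "line_deriv (\<lambda>z. hfield f z $ k) 0 v = v $ k"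
    using line_deriv_component[OF f(1-3), of k v] f(5) 1 by simp
qed

lemma herm_inner_self: "herm_inner v v = of_real ((norm v)\<^sup>2)"
proof -
  have "herm_inner v v = (\<Sum>j\<in>UNIV. of_real ((cmod (v $ j))\<^sup>2))"
    unfolding herm_inner_def by (intro sum.cong refl) (simp add: complex_norm_square[symmetric] del: of_real_power)
  also have "\<dots> = of_real ((norm v)\<^sup>2)"
    by (simp add: norm_vec_def L2_set_def sum_nonneg)
  finally show ?thesis .
qed

lemma Re_herm_inner: "Re (herm_inner v w) = v \<bullet> w"
  by (simp add: herm_inner_def inner_vec_def inner_complex_def)

lemma norm_herm_inner_le: "norm (herm_inner v w) \<le> norm v * norm w"
proof -
  have "norm (herm_inner v w) \<le> (\<Sum>j\<in>UNIV. \<bar>cmod (v $ j)\<bar> * \<bar>cmod (w $ j)\<bar>)"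
    unfolding herm_inner_def by (rule sum_norm_le) (simp add: norm_mult)
  also have "\<dots> \<le> norm v * norm w" unfolding norm_vec_def by (rule L2_set_mult_ineq)
  finally show ?thesis .
qed

lemma herm_inner_smult: "herm_inner v (c *s w) = cnj c * herm_inner v w" "herm_inner (c *s v) w = c * herm_inner v w"
  by (simp_all add: herm_inner_def sum_distrib_left mult_ac)

lemma herm_inner_diff_left: "herm_inner (v - v') w = herm_inner v w - herm_inner v' w"
  by (simp add: herm_inner_def sum_subtractf algebra_simps)

text \<open>The Schwarz lemma on complex lines through the origin, applied to \<open>g\<^sup>-\<^sup>1\<close> composed with
  the quotient defining \<open>g\<close>-starlikeness.\<close>

lemma starlike_Schwarz:
  fixes f :: "complex^'n \<Rightarrow> complex^'n"
  assumes g: "g holomorphic_on ball 0 1" "inj_on g (ball 0 1)" "g 0 = 1"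
    and f: "f \<in> g_starlike g" and z: "z \<in> unit_ball" "z \<noteq> 0"
  shows "herm_inner (hfield f z) z / of_real ((norm z)\<^sup>2) \<in> g ` cball 0 (norm z)"
proof -
  have L: "f \<in> LS_ball" using f by (simp add: g_starlike_def)
  note p = LS_ball_props[OF L]
  have val: "herm_inner (hfield f z) z / of_real ((norm z)\<^sup>2) \<in> g ` ball 0 1" if "z \<in> unit_ball" "z \<noteq> 0" for z
    using f that by (simp add: g_starlike_def hfield_def)
  define u where "u = complex_of_real (1 / norm z) *s z"
  have nu: "norm u = 1" using z by (simp add: u_def norm_smult_vec norm_divide)
  have zu: "z = complex_of_real (norm z) *s u" using z by (simp add: u_def vector_smult_assoc)
  \<comment> \<open>\<open>\<phi>\<close> vanishes at 0 with derivative 1, so its quotient by the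
    parameter extends there with value \<open>1 = g 0\<close>; composed with the inverse of
    \<open>g\<close> it fixes 0, as the Schwarz lemma requires.\<close>
  define \<phi> where "\<phi> \<zeta> = herm_inner (hfield f (0 + \<zeta> *s u)) u" for \<zeta>
  note gh = line_hol_hfield[OF p(1) open_ball p(4)]
  have "{\<zeta>. 0 + \<zeta> *s u \<in> unit_ball} = ball 0 1" by (auto simp: norm_smult_vec nu)
  then have hol: "\<phi> holomorphic_on ball 0 1"
    unfolding \<phi>_def herm_inner_def
    using line_hol_line[OF gh, of 0 u] by (intro holomorphic_intros) auto
  have 0: "\<phi> 0 = 0" using hfield_normalized(1)[OF p(1) open_ball _ p(2,3,4)] by (simp add: \<phi>_def herm_inner_def)
  have "(\<phi> has_field_derivative (\<Sum>j\<in>UNIV. u $ j * cnj (u $ j))) (at 0)"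
    unfolding \<phi>_def herm_inner_def
  proof (intro DERIV_sum DERIV_cmult_right)
    fix j
    show "((\<lambda>\<zeta>. hfield f (0 + \<zeta> *s u) $ j) has_field_derivative u $ j) (at 0)"
      using line_deriv_has_field_derivative[OF gh[of j] open_ball, of 0 u] hfield_normalized(2)[OF p(1) open_ball _ p(2,3,4), of j u]
      by simp
  qed
  then have d: "deriv \<phi> 0 = 1"
    using herm_inner_self[of u] nu by (simp add: herm_inner_def DERIV_imp_deriv)
  define Q where "Q \<zeta> = (if \<zeta> = 0 then deriv \<phi> 0 else (\<phi> \<zeta> - \<phi> 0) / (\<zeta> - 0))" for \<zeta>
  have holQ: "Q holomorphic_on ball 0 1" unfolding Q_def by (rule pole_lemma[OF hol]) simp
  \<comment> \<open>The second slot produces a conjugate factor that cancels against the squared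
    norm and leaves division by \<open>\<zeta>\<close>.\<close>
  have Qval: "Q \<zeta> = herm_inner (hfield f (\<zeta> *s u)) (\<zeta> *s u) / of_real ((norm (\<zeta> *s u))\<^sup>2)" if "\<zeta> \<noteq> 0" for \<zeta>
  proof -
    have "of_real ((norm (\<zeta> *s u))\<^sup>2) = \<zeta> * cnj \<zeta>"
      by (simp only: norm_smult_vec nu mult_1_right complex_norm_square)
    then show ?thesis using that 0 by (simp add: Q_def \<phi>_def herm_inner_smult)
  qed
  have Qin: "Q \<zeta> \<in> g ` ball 0 1" if "\<zeta> \<in> ball 0 1" for \<zeta>
  proof (cases "\<zeta> = 0")
    case True
    then show ?thesis using g(3) d by (auto simp: Q_def intro!: image_eqI[of _ _ 0])
  next
    case False
    then show ?thesis
      unfolding Qval[OF False] using that nu by (intro val) (auto simp: norm_smult_vec)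
  qed
  obtain g' where g': "g' holomorphic_on (g ` ball 0 1)" "\<And>z. z \<in> ball 0 1 \<Longrightarrow> g' (g z) = z"
  proof (rule holomorphic_has_inverse[OF g(1) open_ball g(2)])
    fix k assume "k holomorphic_on (g ` ball 0 1)" "\<And>z. z \<in> ball 0 1 \<Longrightarrow> k (g z) = z"
    then show thesis by (rule that)
  qed
  have gg': "g' w \<in> ball 0 1" "g (g' w) = w" if "w \<in> g ` ball 0 1" for w using g'(2) that by auto
  have "norm (g' (Q (complex_of_real (norm z)))) \<le> norm (complex_of_real (norm z))"
  proof (rule Schwarz_Lemma(1))
    show "(\<lambda>\<zeta>. g' (Q \<zeta>)) holomorphic_on ball 0 1"
      using holomorphic_on_compose_gen[OF holQ g'(1) image_subsetI[OF Qin]] by (simp add: o_def)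
    have "g' (g 0) = 0" by (rule g'(2)) simp
    then show "g' (Q 0) = 0" by (simp add: Q_def d g(3))
    show "norm (g' (Q \<zeta>)) < 1" if "norm \<zeta> < 1" for \<zeta> using gg'(1)[OF Qin[of \<zeta>]] that by simp
  qed (use z in auto)
  moreover have "Q (complex_of_real (norm z)) \<in> g ` ball 0 1" using z by (intro Qin) auto
  ultimately have "Q (complex_of_real (norm z)) \<in> g ` cball 0 (norm z)"
    using gg'(2) by (intro image_eqI[of _ _ "g' (Q (complex_of_real (norm z)))"]) auto
  then show ?thesis using Qval[of "complex_of_real (norm z)"] z zu by simp
qed

text \<open>The constant is the minimum of \<open>Re (g \<zeta>)\<close> over the compact disc
  \<open>cball 0 r\<close>, where the Schwarz lemma locates the quotient. Membership in the image of
  the open disc would give no positive bound.\<close>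

lemma starlike_coercive:
  fixes f :: "complex^'n \<Rightarrow> complex^'n"
  assumes g: "g holomorphic_on ball 0 1" "inj_on g (ball 0 1)" "g 0 = 1" "\<And>\<zeta>. \<zeta> \<in> ball 0 1 \<Longrightarrow> Re (g \<zeta>) > 0"
    and f: "f \<in> g_starlike g" and r: "0 \<le> r" "r < 1"
  obtains c where "c > 0" "\<And>w. norm w \<le> r \<Longrightarrow> c * (norm w)\<^sup>2 \<le> hfield f w \<bullet> w"
proof -
  have "compact ((\<lambda>\<zeta>. Re (g \<zeta>)) ` cball 0 r)"
    using r by (intro compact_continuous_image continuous_intros continuous_on_subset[OF holomorphic_on_imp_continuous_on[OF g(1)]]) auto
  then obtain c where c: "c \<in> (\<lambda>\<zeta>. Re (g \<zeta>)) ` cball 0 r" "\<And>x. x \<in> (\<lambda>\<zeta>. Re (g \<zeta>)) ` cball 0 r \<Longrightarrow> c \<le> x"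
    using compact_attains_inf[of "(\<lambda>\<zeta>. Re (g \<zeta>)) ` cball 0 r"] r(1) by (auto simp: image_is_empty)
  show thesis
  proof (rule that[of c])
    show "c > 0" using c(1) g(4) r by auto
    fix w :: "complex^'n" assume w: "norm w \<le> r"
    show "c * (norm w)\<^sup>2 \<le> hfield f w \<bullet> w"
    proof (cases "w = 0")
      case False
      have "herm_inner (hfield f w) w / of_real ((norm w)\<^sup>2) \<in> g ` cball 0 (norm w)"
        using w r False by (intro starlike_Schwarz[OF g(1-3) f]) auto
      then have "c \<le> Re (herm_inner (hfield f w) w / of_real ((norm w)\<^sup>2))"
        using c(2) w by fastforce
      also have "\<dots> = (hfield f w \<bullet> w) / (norm w)\<^sup>2"
        by (simp add: Re_herm_inner Re_divide_of_real flip: of_real_power)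
      finally show ?thesis using False by (simp add: field_simps)
    qed simp
  qed
qed

subsection \<open>Closedness of the set of starlike mappings\<close>

lemma norm_le_sum_components: "norm (x :: 'a::real_normed_vector^'n) \<le> (\<Sum>i\<in>UNIV. norm (x $ i))"
  unfolding norm_vec_def by (rule L2_set_le_sum) simp

lemma uniform_limit_componentwise:
  fixes f :: "'b \<Rightarrow> 'c \<Rightarrow> 'a::real_normed_vector^'n"
  assumes "\<And>i. uniform_limit S (\<lambda>k z. f k z $ i) (\<lambda>z. l z $ i) F"
  shows "uniform_limit S f l F"
proof (rule uniform_limitI)
  fix e :: real assume e: "e > 0"
  have "\<forall>\<^sub>F k in F. \<forall>i. \<forall>z\<in>S. dist (f k z $ i) (l z $ i) < e / CARD('n)"
    by (intro eventually_all_finite uniform_limitD[OF assms]) (use e in simp)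
  then show "\<forall>\<^sub>F k in F. \<forall>z\<in>S. dist (f k z) (l z) < e"
  proof eventually_elim
    case (elim k)
    show ?case
    proof
      fix z assume "z \<in> S"
      have "norm (f k z - l z) \<le> (\<Sum>i\<in>UNIV. norm ((f k z - l z) $ i))" by (rule norm_le_sum_components)
      also have "\<dots> < (\<Sum>i\<in>(UNIV::'n set). e / CARD('n))"
        using elim \<open>z \<in> S\<close> by (intro sum_strict_mono) (auto simp: dist_norm)
      also have "\<dots> = e" by simp
      finally show "dist (f k z) (l z) < e" by (simp add: dist_norm)
    qed
  qed
qed

lemma uniform_limit_Pair:
  assumes "uniform_limit S f l F" "uniform_limit S g m F"
  shows "uniform_limit S (\<lambda>k z. (f k z, g k z)) (\<lambda>z. (l z, m z)) F"
proof (rule uniform_limitI)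
  fix e :: real assume e: "e > 0"
  then have "\<forall>\<^sub>F k in F. \<forall>z\<in>S. dist (f k z) (l z) < e / 2" "\<forall>\<^sub>F k in F. \<forall>z\<in>S. dist (g k z) (m z) < e / 2"
    using uniform_limitD[OF assms(1), of "e / 2"] uniform_limitD[OF assms(2), of "e / 2"] by (simp_all only: half_gt_zero)
  then show "\<forall>\<^sub>F k in F. \<forall>z\<in>S. dist (f k z, g k z) (l z, m z) < e"
  proof eventually_elim
    case (elim k)
    show ?case
    proof
      fix z assume z: "z \<in> S"
      have "dist (f k z, g k z) (l z, m z) \<le> dist (f k z) (l z) + dist (g k z) (m z)"
        unfolding dist_Pair_Pair by (rule sqrt_sum_squares_le_sum) auto
      also have "\<dots> < e" using elim z by fastforce
      finally show "dist (f k z, g k z) (l z, m z) < e" .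
    qed
  qed
qed

text \<open>The limit has compact image, so some closed neighbourhood of it inside \<open>U\<close>
  is compact and eventually contains the images under \<open>F k\<close>; there \<open>G\<close> is
  uniformly continuous.\<close>

lemma uniform_limit_compact_compose:
  fixes G :: "'a::heine_borel \<Rightarrow> 'b::metric_space"
  assumes K: "compact (f ` K)" and lim: "uniform_limit K F f \<F>"
    and U: "open U" "f ` K \<subseteq> U" and G: "continuous_on U G"
  shows "uniform_limit K (\<lambda>k z. G (F k z)) (\<lambda>z. G (f z)) \<F>"
proof (cases "K = {}")
  case False
  then have ne: "f ` K \<noteq> {}" by simp
  obtain e where e: "e > 0" "{x. infdist x (f ` K) \<le> e} \<subseteq> U"
    using compact_in_open_separated[OF ne K U] by blast
  have "uniformly_continuous_on {x. infdist x (f ` K) \<le> e} G"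
    by (rule compact_uniformly_continuous[OF continuous_on_subset[OF G e(2)] compact_infdist_le[OF ne K e(1)]])
  moreover have "\<forall>\<^sub>F k in \<F>. F k ` K \<subseteq> {x. infdist x (f ` K) \<le> e}"
    using uniform_limitD[OF lim e(1)]
  proof eventually_elim
    case (elim k)
    have "infdist (F k z) (f ` K) \<le> e" if "z \<in> K" for z
      using infdist_le2[of "f z" "f ` K" "F k z" e] elim that by fastforce
    then show ?case by blast
  qed
  moreover have "f ` K \<subseteq> {x. infdist x (f ` K) \<le> e}" using e(1) by auto
  ultimately have "uniform_limit K (\<lambda>a b. G (F a b)) (G \<circ> f) \<F>"
    by (rule uniform_limit_compose[OF lim])
  then show ?thesis by (simp add: o_def)
qed simp

text \<open>Cauchy's estimate for the difference of \<open>\<phi> k\<close> and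
  \<open>\<psi>\<close> on balls of radius \<open>r' - r\<close>.\<close>

lemma uniform_limit_line_deriv:
  fixes \<phi> :: "'b \<Rightarrow> complex^'n \<Rightarrow> complex"
  assumes gh: "\<And>k. line_hol (\<phi> k) S" "line_hol \<psi> S" and S: "open S" "cball 0 r' \<subseteq> S" and "r < r'"
    and lim: "uniform_limit (cball 0 r') \<phi> \<psi> F"
  shows "uniform_limit (cball 0 r) (\<lambda>k z. line_deriv (\<phi> k) z v) (\<lambda>z. line_deriv \<psi> z v) F"
proof (rule uniform_limitI)
  fix e :: real assume e: "e > 0"
  define \<eta> where "\<eta> = e * (r' - r) / (norm v + 1)"
  have pos: "norm v + 1 > 0" by (smt (verit) norm_ge_zero)
  have \<eta>: "\<eta> > 0" using e assms(5) pos by (simp add: \<eta>_def)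
  show "\<forall>\<^sub>F k in F. \<forall>z\<in>cball 0 r. dist (line_deriv (\<phi> k) z v) (line_deriv \<psi> z v) < e"
    using uniform_limitD[OF lim \<eta>]
  proof eventually_elim
    case (elim k)
    show ?case
    proof
      fix z :: "complex^'n" assume z: "z \<in> cball 0 r"
      have sub: "cball z (r' - r) \<subseteq> cball 0 r'"
        using z by (auto simp: dist_norm) (smt (verit) norm_triangle_sub norm_minus_commute)
      have zS: "z \<in> S" using z assms(5) S(2) by auto
      have "norm (line_deriv (\<lambda>z. \<phi> k z - \<psi> z) z v) \<le> \<eta> * norm v / (r' - r)"
      proof (rule line_deriv_bound)
        show "line_hol (\<lambda>z. \<phi> k z - \<psi> z) S" by (intro line_hol_diff gh)
        show "norm (\<phi> k x - \<psi> x) \<le> \<eta>" if "x \<in> cball z (r' - r)" for x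
          using elim sub that by (fastforce simp: dist_norm)
      qed (use sub S assms(5) in auto)
      also have "\<eta> * norm v / (r' - r) = e * (norm v / (norm v + 1))"
        using assms(5) by (simp add: \<eta>_def)
      also have "\<dots> < e * 1" using e pos by (intro mult_strict_left_mono) (auto simp: field_simps)
      finally show "dist (line_deriv (\<phi> k) z v) (line_deriv \<psi> z v) < e"
        by (simp add: line_deriv_diff[OF gh(1) gh(2) S(1) zS] dist_norm)
    qed
  qed
qed

lemma uniform_limit_nth:
  fixes f :: "'b \<Rightarrow> 'c \<Rightarrow> 'a::real_normed_vector^'n"
  shows "uniform_limit S f l F \<Longrightarrow> uniform_limit S (\<lambda>k z. f k z $ i) (\<lambda>z. l z $ i) F"
  by (rule bounded_linear.uniform_limit[OF bounded_linear_vec_nth])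

lemma uniform_limit_Df:
  fixes f :: "complex^'n \<Rightarrow> complex^'n"
  assumes f: "\<And>k. cn_holomorphic_on (F k) S" "cn_holomorphic_on f S" and S: "open S" "cball 0 r' \<subseteq> S" and "r < r'"
    and lim: "uniform_limit (cball 0 r') F f \<F>"
  shows "uniform_limit (cball 0 r) (\<lambda>k z. Df (F k) z) (\<lambda>z. Df f z) \<F>"
proof (intro uniform_limit_componentwise)
  fix i j
  have "uniform_limit (cball 0 r) (\<lambda>k z. line_deriv (\<lambda>z. F k z $ i) z (axis j 1)) (\<lambda>z. line_deriv (\<lambda>z. f z $ i) z (axis j 1)) \<F>"
    by (rule uniform_limit_line_deriv[OF cn_holomorphic_imp_line_hol[OF f(1) S(1)] cn_holomorphic_imp_line_hol[OF f(2) S(1)] S \<open>r < r'\<close> uniform_limit_nth[OF lim]])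
  then show "uniform_limit (cball 0 r) (\<lambda>k z. Df (F k) z $ i $ j) (\<lambda>z. Df f z $ i $ j) \<F>"
  proof (rule uniform_limit_cong'[THEN iffD1, rotated -1])
    fix z :: "complex^'n" assume "z \<in> cball 0 r"
    then have z: "z \<in> S" using assms(5) S(2) by auto
    show "line_deriv (\<lambda>z. F k z $ i) z (axis j 1) = Df (F k) z $ i $ j" for k
      by (rule Df_component[OF f(1) S(1) z, symmetric])
    show "line_deriv (\<lambda>z. f z $ i) z (axis j 1) = Df f z $ i $ j"
      by (rule Df_component[OF f(2) S(1) z, symmetric])
  qed
qed

lemma continuous_on_det [continuous_intros]:
  fixes A :: "'a::topological_space \<Rightarrow> complex^'n^'n"
  assumes "continuous_on S A"
  shows "continuous_on S (\<lambda>x. det (A x))"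
  unfolding det_def by (intro continuous_intros assms)

lemma continuous_on_Df:
  assumes "cn_holomorphic_on f S" "open S"
  shows "continuous_on S (\<lambda>z. Df f z)"
proof -
  have "continuous_on S (\<lambda>z. \<chi> i j. Df f z $ i $ j)"
    by (intro continuous_intros line_hol_continuous line_hol_Df assms)
  then show ?thesis by simp
qed

lemma open_det_nonzero: "open {A :: complex^'n^'n. det A \<noteq> 0}"
proof -
  have "open ((\<lambda>A :: complex^'n^'n. det A) -` (- {0}))"
    by (rule open_vimage) (auto intro!: continuous_intros)
  then show ?thesis by (simp add: vimage_def)
qed

text \<open>\<open>hfield\<close> is one fixed function of derivative and value, continuous by
  Cramer's rule on the open set of invertible matrices, so convergence of both passes to it.\<close>

lemma uniform_limit_hfield:
  fixes f :: "complex^'n \<Rightarrow> complex^'n"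
  assumes f: "\<And>k. cn_holomorphic_on (F k) S" "cn_holomorphic_on f S" and S: "open S" "cball 0 r' \<subseteq> S" and r: "r < r'"
    and lim: "uniform_limit (cball 0 r') F f \<F>"
    and d: "\<And>k z. z \<in> S \<Longrightarrow> det (Df (F k) z) \<noteq> 0" "\<And>z. z \<in> S \<Longrightarrow> det (Df f z) \<noteq> 0"
  shows "uniform_limit (cball 0 r) (\<lambda>k. hfield (F k)) (hfield f) \<F>"
proof -
  define U where "U = {A :: complex^'n^'n. det A \<noteq> 0} \<times> (UNIV :: (complex^'n) set)"
  define G where "G = (\<lambda>(A :: complex^'n^'n, b :: complex^'n). (\<chi> k. det (\<chi> i j. if j = k then b $ i else A $ i $ j) / det A))"
  have sub: "cball 0 r \<subseteq> S" using S(2) r by auto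
  have "uniform_limit (cball 0 r) (\<lambda>k z. G (Df (F k) z, F k z)) (\<lambda>z. G (Df f z, f z)) \<F>"
  proof (rule uniform_limit_compact_compose[where G = G and F = "\<lambda>k z. (Df (F k) z, F k z)" and f = "\<lambda>z. (Df f z, f z)"])
    show "compact ((\<lambda>z. (Df f z, f z)) ` cball 0 r)"
      by (intro compact_continuous_image continuous_intros continuous_on_subset[OF continuous_on_Df[OF f(2) S(1)] sub]
        continuous_on_subset[OF cn_holomorphic_imp_continuous_on[OF f(2)] sub]) simp
    show "uniform_limit (cball 0 r) (\<lambda>k z. (Df (F k) z, F k z)) (\<lambda>z. (Df f z, f z)) \<F>"
      by (intro uniform_limit_Pair uniform_limit_Df[OF f S r lim] uniform_limit_on_subset[OF lim]) (use r in auto)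
    show "open U" unfolding U_def by (intro open_Times open_det_nonzero open_UNIV)
    show "(\<lambda>z. (Df f z, f z)) ` cball 0 r \<subseteq> U" using sub d(2) by (auto simp: U_def)
    have "continuous_on U (\<lambda>x. (\<chi> i j. if j = k then snd x $ i else fst x $ i $ j) :: complex^'n^'n)" for k
    proof (intro continuous_on_vec_lambda)
      show "continuous_on U (\<lambda>x. if j = k then snd x $ i else fst x $ i $ j)" for i j
        by (cases "j = k") (auto intro!: continuous_intros)
    qed
    note C = this
    show "continuous_on U G"
      unfolding G_def case_prod_unfold
    proof (rule continuous_on_vec_lambda, rule continuous_on_divide)
      show "continuous_on U (\<lambda>x. det (\<chi> i j. if j = k then snd x $ i else fst x $ i $ j))" for k
        by (rule continuous_on_det[OF C])
      show "continuous_on U (\<lambda>x. det (fst x))" by (intro continuous_intros)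
    qed (auto simp: U_def)
  qed
  then show ?thesis
  proof (rule uniform_limit_cong'[THEN iffD1, rotated -1])
    fix z :: "complex^'n" assume "z \<in> cball 0 r"
    then have z: "z \<in> S" using sub by auto
    show "G (Df (F k) z, F k z) = hfield (F k) z" for k
      by (simp add: G_def hfield_def matrix_inv_cramer[OF d(1)[OF z]])
    show "G (Df f z, f z) = hfield f z"
      by (simp add: G_def hfield_def matrix_inv_cramer[OF d(2)[OF z]])
  qed
qed

text \<open>The real inverse function theorem supplies the local inverse; its derivative is the
  inverse of a complex matrix, hence complex linear.\<close>

lemma locally_biholomorphicI:
  fixes f :: "complex^'n \<Rightarrow> complex^'n"
  assumes f: "cn_holomorphic_on f S" and S: "open S" and d: "\<And>z. z \<in> S \<Longrightarrow> det (Df f z) \<noteq> 0"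
  shows "cn_locally_biholomorphic_on f S"
  unfolding cn_locally_biholomorphic_on_def
proof
  fix x0 assume x0: "x0 \<in> S"
  define f' where "f' x = Blinfun ((*v) (Df f x))" for x
  have f': "blinfun_apply (f' x) = (*v) (Df f x)" for x
    unfolding f'_def by (rule bounded_linear_Blinfun_apply) (simp add: linear_linear matrix_vector_mul_bounded_linear)
  have der: "(f has_derivative blinfun_apply (f' x)) (at x)" if "x \<in> S" for x
    unfolding f' by (rule cn_holomorphic_has_derivative[OF f S that])
  have cont: "continuous_on S f'"
  proof (rule continuous_on_blinfun_componentwise)
    fix i :: "complex^'n"
    have "continuous_on S (\<lambda>x. \<chi> k. \<Sum>j\<in>UNIV. Df f x $ k $ j * i $ j)"
      by (intro continuous_intros line_hol_continuous line_hol_Df f S)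
    then show "continuous_on S (\<lambda>x. blinfun_apply (f' x) i)"
      by (simp add: f' matrix_vector_mult_def)
  qed
  define B where "B = Blinfun ((*v) (matrix_inv (Df f x0)))"
  have B: "blinfun_apply B = (*v) (matrix_inv (Df f x0))"
    unfolding B_def by (rule bounded_linear_Blinfun_apply) (simp add: linear_linear matrix_vector_mul_bounded_linear)
  have inv: "B o\<^sub>L f' x0 = id_blinfun"
    by (rule blinfun_eqI) (simp add: B f' matrix_vector_mul_assoc matrix_inv_works d x0)
  obtain U V g g' where U: "open U" "U \<subseteq> S" "x0 \<in> U" and V: "open V" and h: "homeomorphism U V f g"
    and g: "\<And>y. y \<in> V \<Longrightarrow> (g has_derivative (g' y)) (at y)"
      "\<And>y. y \<in> V \<Longrightarrow> g' y = Hilbert_Choice.inv (blinfun_apply (f'(g y)))"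
  proof (rule inverse_function_theorem[OF S der cont x0 inv])
    fix U V g g'
    assume "open U" "U \<subseteq> S" "x0 \<in> U" "open V" "homeomorphism U V f g"
      "\<And>y. y \<in> V \<Longrightarrow> (g has_derivative (g' y)) (at y)"
      "\<And>y. y \<in> V \<Longrightarrow> g' y = Hilbert_Choice.inv (blinfun_apply (f'(g y)))"
    then show thesis by (rule that)
  qed
  have fU: "f ` U = V" and gf: "\<And>x. x \<in> U \<Longrightarrow> g (f x) = x" and gV: "g ` V = U"
    using h by (auto simp: homeomorphism_def)
  have inj: "inj_on f U" using gf by (metis inj_onI)
  have "cn_holomorphic_on (inv_into U f) V"
    unfolding cn_holomorphic_on_def
  proof
    fix y assume y: "y \<in> V"
    define A where "A = Df f (g y)"
    have "det A \<noteq> 0" unfolding A_def using y gV U d by blast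
    then have "Hilbert_Choice.inv ((*v) A) = (*v) (matrix_inv A)"
      by (intro inv_unique_comp) (auto simp: fun_eq_iff matrix_vector_mul_assoc matrix_inv_works)
    then have "(g has_derivative (*v) (matrix_inv A)) (at y)"
      using g[OF y] by (simp add: f' A_def)
    then have "(inv_into U f has_derivative (*v) (matrix_inv A)) (at y)"
    proof (rule has_derivative_transform_within_open[OF _ V y])
      show "g x = inv_into U f x" if "x \<in> V" for x
        using that fU gf inj by (metis imageE inv_into_f_f)
    qed
    then show "\<exists>A. (inv_into U f has_derivative (*v) A) (at y within V)"
      using has_derivative_at_withinI by blast
  qed
  moreover have "cn_holomorphic_on f U"
    using f U unfolding cn_holomorphic_on_def by (meson has_derivative_subset subsetD)
  ultimately have "cn_biholomorphic_on f U"
    using U V fU inj by (simp add: cn_biholomorphic_on_def)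
  then show "\<exists>U. x0 \<in> U \<and> U \<subseteq> S \<and> cn_biholomorphic_on f U" using U by blast
qed

lemma closure_of_H_topologyD:
  assumes f: "f \<in> H_topology closure_of A" and K: "compact K" "K \<subseteq> unit_ball" "e > 0"
  shows "\<exists>k\<in>A. k \<in> H_ball \<and> (\<forall>z\<in>K. dist (k z) (f z) < e)"
proof -
  have fH: "f \<in> H_ball" using f by (auto simp: in_closure_of topspace_H_topology)
  \<comment> \<open>The explicit gap \<open>d\<close> makes openness a triangle inequality, without
    an attained maximum over \<open>K\<close>.\<close>
  define W where "W = {k \<in> H_ball. \<exists>d>0. \<forall>z\<in>K. dist (k z) (f z) < e - d}"
  have "H_open W"
    unfolding H_open_def
  proof (intro conjI ballI)
    show "W \<subseteq> H_ball" by (auto simp: W_def)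
    fix k assume "k \<in> W"
    then obtain d where d: "d > 0" "\<forall>z\<in>K. dist (k z) (f z) < e - d" by (auto simp: W_def)
    have "{j \<in> H_ball. \<forall>z\<in>K. dist (j z) (k z) < d/2} \<subseteq> W"
    proof
      fix j assume j: "j \<in> {j \<in> H_ball. \<forall>z\<in>K. dist (j z) (k z) < d/2}"
      have "dist (j z) (f z) < e - d/2" if "z \<in> K" for z
        using dist_triangle[of "j z" "f z" "k z"] j d that by fastforce
      then show "j \<in> W" using j d(1) unfolding W_def by (auto intro!: exI[of _ "d/2"])
    qed
    then show "\<exists>K e. compact K \<and> K \<subseteq> unit_ball \<and> e > 0 \<and>
        {h \<in> H_ball. \<forall>z\<in>K. dist (h z) (k z) < e} \<subseteq> W"
      using K d(1) by (intro exI[of _ K] exI[of _ "d/2"]) auto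
  qed
  moreover have "f \<in> W" using fH K(3) unfolding W_def by (auto intro!: exI[of _ "e/2"])
  ultimately obtain k where "k \<in> A" "k \<in> W"
    using f unfolding in_closure_of openin_H_topology by blast
  then show ?thesis using K(3) unfolding W_def by fastforce
qed

lemma closure_of_H_topologyI:
  assumes f: "f \<in> H_ball" and A: "A \<subseteq> H_ball"
    and ap: "\<And>K e. compact K \<Longrightarrow> K \<subseteq> unit_ball \<Longrightarrow> e > 0 \<Longrightarrow> \<exists>k\<in>A. \<forall>z\<in>K. dist (k z) (f z) < e"
  shows "f \<in> H_topology closure_of A"
  unfolding in_closure_of topspace_H_topology openin_H_topology
proof (intro conjI allI impI f)
  fix T assume T: "f \<in> T \<and> H_open T"
  then obtain K e where K: "compact K" "K \<subseteq> unit_ball" "e > 0" "{h \<in> H_ball. \<forall>z\<in>K. dist (h z) (f z) < e} \<subseteq> T"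
    unfolding H_open_def by meson
  from ap[OF K(1-3)] A K(4) show "\<exists>y. y \<in> A \<and> y \<in> T" by blast
qed

lemma compact_subset_ball:
  fixes K :: "'a::real_normed_vector set"
  assumes "compact K" "K \<subseteq> ball 0 R" "R > 0"
  obtains \<rho> where "0 < \<rho>" "\<rho> < R" "K \<subseteq> cball 0 \<rho>"
proof (cases "K = {}")
  case True
  then show thesis using that[of "R / 2"] assms(3) by simp
next
  case False
  obtain x where x: "x \<in> K" "\<And>y. y \<in> K \<Longrightarrow> norm y \<le> norm x"
    using continuous_attains_sup[OF assms(1) False, of norm] by (auto intro: continuous_intros)
  have "norm x < R" using x assms(2) by auto
  moreover have "K \<subseteq> cball 0 (max (norm x) (R / 2))"
    using x(2) by (auto simp: le_max_iff_disj)
  ultimately show thesis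
    using that[of "max (norm x) (R / 2)"] assms(3) by (simp add: less_max_iff_disj)
qed

lemma g_starlike_closed:
  fixes f :: "complex^'n \<Rightarrow> complex^'n"
  assumes g: "g holomorphic_on ball 0 1" "inj_on g (ball 0 1)" "g 0 = 1"
    and f: "f \<in> H_topology closure_of A" and A: "A \<subseteq> g_starlike g"
  shows "f \<in> g_starlike g"
proof -
  have fH: "f \<in> H_ball" using f by (auto simp: in_closure_of topspace_H_topology)
  then have fh: "cn_holomorphic_on f unit_ball" by (simp add: H_ball_def)
  \<comment> \<open>Exhausting the ball by closed balls turns membership in the closure into a
    sequence converging uniformly on each \<open>cball 0 r\<close> with
    \<open>r < 1\<close>.\<close>
  have "\<forall>n::nat. \<exists>k\<in>A. \<forall>z\<in>cball 0 (1 - inverse (Suc n)). dist (k z) (f z) < inverse (Suc n)"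
  proof
    fix n :: nat
    have "cball (0 :: complex^'n) (1 - inverse (Suc n)) \<subseteq> unit_ball"
    proof
      fix x :: "complex^'n" assume x: "x \<in> cball 0 (1 - inverse (Suc n))"
      have "inverse (real (Suc n)) > 0" by (rule positive_imp_inverse_positive) simp
      moreover have "norm x \<le> 1 - inverse (real (Suc n))" using x by (simp only: mem_cball_0)
      ultimately show "x \<in> unit_ball" unfolding mem_ball_0 by linarith
    qed
    from closure_of_H_topologyD[OF f compact_cball this, of "inverse (Suc n)"]
    show "\<exists>k\<in>A. \<forall>z\<in>cball 0 (1 - inverse (Suc n)). dist (k z) (f z) < inverse (Suc n)" by auto
  qed
  then obtain F where F: "\<And>n::nat. F n \<in> A" "\<And>n z. z \<in> cball 0 (1 - inverse (Suc n)) \<Longrightarrow> dist (F n z) (f z) < inverse (Suc n)"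
    by metis
  have lim: "uniform_limit (cball 0 r) F f sequentially" if "r < 1" for r
  proof (rule uniform_limitI)
    fix e :: real assume e: "e > 0"
    have "\<forall>\<^sub>F n in sequentially. inverse (real (Suc n)) < min e (1 - r)"
      using LIMSEQ_inverse_real_of_nat that e by (intro order_tendstoD(2)) auto
    then show "\<forall>\<^sub>F n in sequentially. \<forall>z\<in>cball 0 r. dist (F n z) (f z) < e"
    proof eventually_elim
      case (elim n)
      show ?case
      proof
        fix z :: "complex^'n" assume "z \<in> cball 0 r"
        then have "norm z \<le> 1 - inverse (real (Suc n))" using elim unfolding mem_cball_0 by linarith
        then have "dist (F n z) (f z) < inverse (real (Suc n))" by (intro F(2)) (simp only: mem_cball_0)
        then show "dist (F n z) (f z) < e" using elim by linarith
      qed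
    qed
  qed
  have FS: "F n \<in> g_starlike g" for n using F(1) A by blast
  then have FL: "F n \<in> LS_ball" for n by (auto simp: g_starlike_def)
  note p = LS_ball_props[OF FL]
  have ptw: "(\<lambda>n. F n z) \<longlonglongrightarrow> f z" if "z \<in> unit_ball" for z
    by (rule tendsto_uniform_limitI[OF lim[of "norm z"]]) (use that in auto)
  have f0: "f 0 = 0"
    using LIMSEQ_unique[OF ptw[of 0]] p(2) by simp
  have limD: "uniform_limit (cball 0 r) (\<lambda>n z. Df (F n) z) (\<lambda>z. Df f z) sequentially" if "r < 1" for r
    by (rule uniform_limit_Df[OF p(1) fh open_ball, where r' = "(r + 1) / 2"]) (use that in \<open>auto intro!: lim\<close>)
  have Df0: "Df f 0 = mat 1"
    using LIMSEQ_unique[OF tendsto_uniform_limitI[OF limD[of 0], of 0]] p(3) by simp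
  have det: "det (Df f z) \<noteq> 0" if z: "z \<in> unit_ball" for z
  proof (cases "z = 0")
    case True
    then show ?thesis by (simp add: Df0)
  next
    case False
    define S where "S = ball (0::complex) (1 / norm z)"
    have line: "{\<zeta>. 0 + \<zeta> *s z \<in> unit_ball} = S" using False by (auto simp: S_def norm_smult_vec field_simps)
    define D where "D \<zeta> = det (Df f (0 + \<zeta> *s z))" for \<zeta>
    have holD: "D holomorphic_on S"
      using line_hol_line[OF line_hol_det[OF line_hol_Df[OF fh open_ball]], of 0 z] unfolding D_def line .
    have one: "1 \<in> S" "0 \<in> S" using z False by (auto simp: S_def)
    show ?thesis
    \<comment> \<open>Hurwitz needs a nonconstant limit; a constant determinant equals its value 1
      at the origin.\<close>
    proof (cases "D constant_on S")
      case True
      then have "D 1 = D 0" using one unfolding constant_on_def by metis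
      then show ?thesis by (simp add: D_def Df0)
    next
      case nc: False
      have "D 1 \<noteq> 0"
      proof (rule Hurwitz_no_zeros[OF _ _ _ holD _ nc])
        show "open S" "connected S" by (auto simp: S_def)
        show "1 \<in> S" by (rule one)
        show "(\<lambda>\<zeta>. det (Df (F n) (0 + \<zeta> *s z))) holomorphic_on S" for n
          using line_hol_line[OF line_hol_det[OF line_hol_Df[OF p(1)[of n] open_ball]], of 0 z] unfolding line .
        show "det (Df (F n) (0 + \<zeta> *s z)) \<noteq> 0" if "\<zeta> \<in> S" for n \<zeta>
          using that line by (intro p(4)) auto
        fix K assume K: "compact K" "K \<subseteq> S"
        obtain \<rho> where \<rho>: "0 < \<rho>" "\<rho> < 1 / norm z" "K \<subseteq> cball 0 \<rho>"
          using compact_subset_ball[OF K[unfolded S_def]] False by auto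
        have r: "\<rho> * norm z < 1" using \<rho> False by (simp add: field_simps)
        have sub: "cball 0 (\<rho> * norm z) \<subseteq> unit_ball" using r by auto
        have "uniform_limit (cball 0 (\<rho> * norm z)) (\<lambda>n z. det (Df (F n) z)) (\<lambda>z. det (Df f z)) sequentially"
          by (rule uniform_limit_compact_compose[OF compact_continuous_image limD[OF r] open_UNIV])
            (auto intro!: continuous_intros continuous_on_subset[OF continuous_on_Df[OF fh open_ball] sub])
        then show "uniform_limit K (\<lambda>n \<zeta>. det (Df (F n) (0 + \<zeta> *s z))) D sequentially"
          unfolding D_def
          by (rule uniform_limit_compose') (use \<rho>(3) in \<open>auto simp: norm_smult_vec subset_iff intro!: mult_right_mono\<close>)
      qed
      then show ?thesis by (simp add: D_def)
    qed
  qed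
  have "cn_locally_biholomorphic_on f unit_ball"
    by (rule locally_biholomorphicI[OF fh open_ball det])
  then have fL: "f \<in> LS_ball" using fH f0 Df0 by (simp add: LS_ball_def)
  have "herm_inner (hfield f z) z / of_real ((norm z)\<^sup>2) \<in> g ` ball 0 1" if z: "z \<in> unit_ball - {0}" for z
  proof -
    have nz: "norm z < 1" using z by simp
    have "uniform_limit (cball 0 (norm z)) (\<lambda>k. hfield (F k)) (hfield f) sequentially"
      by (rule uniform_limit_hfield[OF p(1) fh open_ball, where r' = "(norm z + 1) / 2"])
        (use nz p(4) det in \<open>auto intro!: lim\<close>)
    then have "(\<lambda>k. hfield (F k) z) \<longlonglongrightarrow> hfield f z"
      by (rule tendsto_uniform_limitI) simp
    then have "(\<lambda>k. herm_inner (hfield (F k) z) z / of_real ((norm z)\<^sup>2)) \<longlonglongrightarrow> herm_inner (hfield f z) z / of_real ((norm z)\<^sup>2)"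
      unfolding herm_inner_def by (intro tendsto_intros) (use z in auto)
    \<comment> \<open>The image of the open disc need not be closed; this smaller image is, and it
      contains the quotients for all \<open>k\<close>.\<close>
    moreover have "compact (g ` cball 0 (norm z))"
      using nz by (intro compact_continuous_image continuous_on_subset[OF holomorphic_on_imp_continuous_on[OF g(1)]]) auto
    then have "closed (g ` cball 0 (norm z))" by (rule compact_imp_closed)
    moreover have "herm_inner (hfield (F k) z) z / of_real ((norm z)\<^sup>2) \<in> g ` cball 0 (norm z)" for k
      using z by (intro starlike_Schwarz[OF g FS]) auto
    ultimately have "herm_inner (hfield f z) z / of_real ((norm z)\<^sup>2) \<in> g ` cball 0 (norm z)"
      by (meson closed_sequentially)
    then show ?thesis using nz by auto
  qed
  then show ?thesis using fL by (simp add: g_starlike_def hfield_def)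
qed

subsection \<open>Approximation by automorphisms\<close>

lemma line_hol_components_bounded:
  fixes F :: "complex^'n \<Rightarrow> complex^'n"
  assumes "\<And>i. line_hol (\<lambda>z. F z $ i) S" "cball 0 r \<subseteq> S"
  obtains B where "B \<ge> 0" "\<And>z. z \<in> cball 0 r \<Longrightarrow> norm (F z) \<le> B"
proof -
  have "continuous_on (cball 0 r) (\<lambda>z. \<chi> i. F z $ i)"
    by (intro continuous_on_vec_lambda continuous_on_subset[OF line_hol_continuous[OF assms(1)] assms(2)])
  then have "bounded (F ` cball 0 r)"
    by (intro compact_imp_bounded compact_continuous_image) auto
  then obtain B where "\<And>z. z \<in> cball 0 r \<Longrightarrow> norm (F z) \<le> B" unfolding bounded_iff by blast
  then show thesis using that[of "max B 0"] by (simp add: le_max_iff_disj)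
qed

lemma norm_le_card_mult:
  assumes "\<And>i. norm (x $ i) \<le> b"
  shows "norm (x :: complex^'n) \<le> real CARD('n) * b"
  using order_trans[OF norm_le_sum_components[of x] sum_bounded_above[of UNIV "\<lambda>i. norm (x $ i)" b]] assms
  by simp

text \<open>The increment estimate is applied to each component; \<open>CARD('n)\<close> pays for
  summing the components, \<open>R - r\<close> for the geometric series.\<close>

lemma vanishing_order1_bound:
  fixes F :: "complex^'n \<Rightarrow> complex^'n"
  assumes F: "\<And>i. line_hol (\<lambda>z. F z $ i) S" "F 0 = 0" and S: "cball 0 R \<subseteq> S" and r: "r < R"
    and B: "\<And>z. z \<in> cball 0 R \<Longrightarrow> norm (F z) \<le> B" and w: "norm w \<le> r"
  shows "norm (F w) \<le> real CARD('n) * B / (R - r) * norm w"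
proof -
  have B0: "B \<ge> 0" using B[of 0] F(2) r w norm_ge_zero[of w] by simp
  have R: "0 < R" using r w norm_ge_zero[of w] by linarith
  have "norm (F w $ i) \<le> B / (R - r) * norm w" for i
  proof -
    have "norm (F (0 + w) $ i - F 0 $ i) \<le> B * (norm w / R) / (1 - norm w / R)"
      by (rule line_hol_increment1[OF F(1) S]) (use order_trans[OF Finite_Cartesian_Product.norm_nth_le B] r w in auto)
    also have "\<dots> = B * norm w / (R - norm w)" using R by (simp add: field_simps)
    also have "\<dots> \<le> B * norm w / (R - r)"
      using B0 r w by (intro divide_left_mono mult_pos_pos mult_nonneg_nonneg) auto
    finally show ?thesis using F(2) by simp
  qed
  from norm_le_card_mult[OF this] show ?thesis by simp
qed

text \<open>For a map without value and linear term at 0, a small bound on a ball becomes small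
  relative to \<open>(norm w)\<^sup>2\<close> on a smaller one; this turns uniform closeness into
  closeness to second order.\<close>

lemma vanishing_order2_bound:
  fixes F :: "complex^'n \<Rightarrow> complex^'n"
  assumes F: "\<And>i. line_hol (\<lambda>z. F z $ i) S" "F 0 = 0" "\<And>i v. line_deriv (\<lambda>z. F z $ i) 0 v = 0"
    and S: "cball 0 R \<subseteq> S" and r: "r < R"
    and B: "\<And>z. z \<in> cball 0 R \<Longrightarrow> norm (F z) \<le> B" and w: "norm w \<le> r"
  shows "norm (F w) \<le> real CARD('n) * B / (R * (R - r)) * (norm w)\<^sup>2"
proof -
  have B0: "B \<ge> 0" using B[of 0] F(2) r w norm_ge_zero[of w] by simp
  have R: "0 < R" using r w norm_ge_zero[of w] by linarith
  have "norm (F w $ i) \<le> B / (R * (R - r)) * (norm w)\<^sup>2" for i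
  proof -
    have "norm (F (0 + w) $ i - F 0 $ i - line_deriv (\<lambda>z. F z $ i) 0 w) \<le> B * (norm w / R)\<^sup>2 / (1 - norm w / R)"
      by (rule line_hol_increment2[OF F(1) S]) (use order_trans[OF Finite_Cartesian_Product.norm_nth_le B] r w in auto)
    also have "\<dots> = B * (norm w)\<^sup>2 / (R * (R - norm w))"
      using R r w by (simp add: field_simps power2_eq_square)
    also have "\<dots> \<le> B * (norm w)\<^sup>2 / (R * (R - r))"
      using B0 r w R by (intro divide_left_mono mult_left_mono mult_pos_pos mult_nonneg_nonneg) auto
    finally show ?thesis using F by simp
  qed
  from norm_le_card_mult[OF this] show ?thesis by simp
qed

lemma line_deriv_of_has_derivative:
  fixes f :: "complex^'n \<Rightarrow> complex^'n"
  assumes "cn_holomorphic_on f S" "open S" "a \<in> S" "(f has_derivative D) (at a)"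
  shows "line_deriv (\<lambda>z. f z $ i) a v = D v $ i"
  using has_derivative_unique[OF assms(4) cn_holomorphic_has_derivative[OF assms(1-3)]]
  by (simp add: line_deriv_component[OF assms(1-3)])

lemma line_deriv_nth: "line_deriv (\<lambda>z. z $ i) a v = v $ i"
  by (rule line_deriv_unique) (auto intro!: derivative_eq_intros)

lemma Aut_Cn_holomorphic: "E \<in> Aut_Cn \<Longrightarrow> cn_holomorphic_on E UNIV"
  by (simp add: Aut_Cn_def)

text \<open>Fields in \<open>aut_fields\<close> come from automorphisms tangent to the identity,
  which suits only the part of order two. So \<open>- hfield f w\<close> is split into
  \<open>- w\<close>, realised exactly by the dilation \<open>1 - s\<close>, and
  \<open>w - hfield f w\<close>, approximated by the polynomial field \<open>V\<close>.\<close>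

lemma automorphism_Euler_step:
  fixes f :: "complex^'n \<Rightarrow> complex^'n"
  assumes card: "CARD('n::finite) \<ge> 2" and f: "f \<in> LS_ball" and r: "0 < r" "r < 1" and \<delta>: "\<delta> > 0"
  obtains s0 where "s0 > 0" "\<And>s. 0 < s \<Longrightarrow> s < s0 \<Longrightarrow>
    \<exists>E\<in>Aut_Cn. E 0 = 0 \<and> (E has_derivative (\<lambda>v. complex_of_real (1 - s) *s v)) (at 0) \<and>
      (\<forall>w\<in>cball 0 r. norm (E w - w + complex_of_real s *s hfield f w) \<le> s * \<delta> * (norm w)\<^sup>2)"
proof -
  note p = LS_ball_props[OF f]
  define r1 where "r1 = (1 + r) / 2"
  have r1: "r < r1" "r1 < 1" "0 < r1" using r by (auto simp: r1_def)
  note gh = line_hol_hfield[OF p(1) open_ball p(4)]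
  have h0: "hfield f 0 = 0" and hd: "\<And>i v. line_deriv (\<lambda>z. hfield f z $ i) 0 v = v $ i"
    using hfield_normalized[OF p(1) open_ball _ p(2,3,4)] by auto
  \<comment> \<open>Three errors of size \<open>\<eta>\<close> per component, passed through the
    order-two bound, give exactly \<open>\<delta>\<close>.\<close>
  define \<eta> where "\<eta> = \<delta> * (r1 * (r1 - r)) / (3 * real CARD('n) * real CARD('n))"
  have n: "real CARD('n) > 0" by simp
  have \<eta>: "\<eta> > 0" using \<delta> r1 by (simp add: \<eta>_def)
  have "\<exists>q. polyfun 2 q \<and> (\<forall>w\<in>cball 0 r1. norm ((w - hfield f w) $ i - q w) \<le> \<eta>)" for i
  proof -
    have g: "line_hol (\<lambda>w. (w - hfield f w) $ i) unit_ball"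
      using line_hol_diff[OF line_hol_nth gh[of i], of i] by simp
    have "line_deriv (\<lambda>w. (w - hfield f w) $ i) 0 v = 0" for v
      using line_deriv_diff[OF line_hol_nth gh[of i] open_ball, of 0 i v] hd[of i v] by (simp add: line_deriv_nth)
    moreover have "(0 - hfield f 0) $ i = 0" by (simp add: h0)
    ultimately obtain p where "polyfun 2 p" "\<And>w. w \<in> cball 0 r1 \<Longrightarrow> norm ((w - hfield f w) $ i - p w) \<le> \<eta>"
      using polynomial_approximation[OF g _ _ r1(3,2) \<eta>] by metis
    then show ?thesis by blast
  qed
  then obtain q where q: "\<And>i. polyfun 2 (q i)" "\<And>i w. w \<in> cball 0 r1 \<Longrightarrow> norm ((w - hfield f w) $ i - q i w) \<le> \<eta>"
    by metis
  define V where "V w = (\<chi> i. q i w)" for w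
  have VA: "V \<in> aut_fields" using aut_fields_polynomial_map[OF card q(1)] by (simp add: V_def[abs_def])
  obtain \<Phi> where cV: "continuous_on UNIV V" and \<Phi>: "\<And>s. \<Phi> s \<in> Aut_Cn" "\<And>s. \<Phi> s 0 = 0"
    "\<And>s. (\<Phi> s has_derivative (\<lambda>h. h)) (at 0)"
    and lV: "\<And>R. uniform_limit (cball 0 R) (\<lambda>s w. inverse s *s (\<Phi> s w - w)) V (at 0)"
    using aut_fieldsE[OF VA] by blast
  have "bounded (V ` cball 0 r1)"
    by (intro compact_imp_bounded compact_continuous_image continuous_on_subset[OF cV]) auto
  then obtain M where M: "\<And>w. w \<in> cball 0 r1 \<Longrightarrow> norm (V w) \<le> M" unfolding bounded_iff by blast
  have M0: "M \<ge> 0" using order_trans[OF norm_ge_zero M[of 0]] r1(3) by simp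
  obtain d where d: "d > 0" "\<And>s w. s \<noteq> 0 \<Longrightarrow> norm s < d \<Longrightarrow> w \<in> cball 0 r1 \<Longrightarrow> dist (inverse s *s (\<Phi> s w - w)) (V w) < \<eta>"
    using uniform_limitD[OF lV[of r1] \<eta>] unfolding eventually_at by auto
  \<comment> \<open>The last entry keeps the cross term of dilation and step, of size
    \<open>s * (M + \<eta>)\<close>, below \<open>\<eta>\<close>.\<close>
  define s0 where "s0 = min d (min 1 (\<eta> / (M + \<eta>)))"
  show thesis
  proof (rule that)
    show "s0 > 0" using d(1) \<eta> M0 by (simp add: s0_def)
    fix s :: real assume s: "0 < s" "s < s0"
    define \<sigma> where "\<sigma> = complex_of_real s"
    have \<sigma>: "\<sigma> \<noteq> 0" "norm \<sigma> = s" using s by (auto simp: \<sigma>_def)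
    have s1: "s < 1" "s < d" using s by (simp_all add: s0_def)
    have s2: "s * (M + \<eta>) \<le> \<eta>" using s(2) M0 \<eta> by (simp add: s0_def field_simps)
    have \<sigma>1: "1 - \<sigma> = complex_of_real (1 - s)" by (simp add: \<sigma>_def)
    define E where "E w = (1 - \<sigma>) *s \<Phi> \<sigma> w" for w
    have "1 - \<sigma> \<noteq> 0" unfolding \<sigma>1 of_real_eq_0_iff using s1 by simp
    from Aut_Cn_compose[OF Aut_Cn_smult[OF this] \<Phi>(1)[of \<sigma>]]
    have EA: "E \<in> Aut_Cn" by (simp add: E_def[abs_def])
    have E0: "E 0 = 0" by (simp add: E_def \<Phi>)
    have Ed: "(E has_derivative (\<lambda>v. (1 - \<sigma>) *s v)) (at 0)"
      using has_derivative_smult[OF has_derivative_const[of "1 - \<sigma>"] \<Phi>(3)[of \<sigma>]] by (simp add: E_def[abs_def])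
    \<comment> \<open>Error per unit of time; it vanishes to second order at 0, so a uniform bound
      suffices.\<close>
    define e where "e w = inverse \<sigma> *s (E w - w) + hfield f w" for w
    have gE: "line_hol (\<lambda>w. E w $ i) unit_ball" for i
      by (rule line_hol_subset[OF cn_holomorphic_imp_line_hol[OF Aut_Cn_holomorphic[OF EA] open_UNIV]]) simp
    have e_nth: "(\<lambda>w. e w $ i) = (\<lambda>w. inverse \<sigma> * (E w $ i - w $ i) + hfield f w $ i)" for i
      by (simp add: e_def right_diff_distrib)
    have g1: "line_hol (\<lambda>w. inverse \<sigma> * (E w $ i - w $ i)) unit_ball" and g2: "line_hol (\<lambda>w. E w $ i - w $ i) unit_ball" for i
      by (intro line_hol_mult line_hol_const line_hol_diff gE line_hol_nth)+
    have ge: "line_hol (\<lambda>w. e w $ i) unit_ball" for i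
      unfolding e_nth by (rule line_hol_add[OF g1 gh])
    have ed: "line_deriv (\<lambda>w. e w $ i) 0 v = 0" for i v
    proof -
      have z: "(0 :: complex^'n) \<in> unit_ball" by simp
      have "line_deriv (\<lambda>w. E w $ i) 0 v = (1 - \<sigma>) * v $ i"
        using line_deriv_of_has_derivative[OF Aut_Cn_holomorphic[OF EA] open_UNIV _ Ed, of i v] by (simp add: left_diff_distrib)
      moreover have "line_deriv (\<lambda>w. inverse \<sigma>) 0 v = 0" by (rule line_deriv_unique) auto
      ultimately have "line_deriv (\<lambda>w. inverse \<sigma> * (E w $ i - w $ i)) 0 v = inverse \<sigma> * ((1 - \<sigma>) * v $ i - v $ i)"
        using line_deriv_mult[OF line_hol_const g2 open_ball z, of "inverse \<sigma>" i v] line_deriv_diff[OF gE line_hol_nth open_ball z, of i i v]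
        by (simp add: line_deriv_nth)
      then show ?thesis
        unfolding e_nth using line_deriv_add[OF g1 gh open_ball z, of i i v] hd[of i v] \<sigma>(1) by (simp add: field_simps)
    qed
    have eb: "norm (e w) \<le> real CARD('n) * (3 * \<eta>)" if w: "w \<in> cball 0 r1" for w
    proof (rule norm_le_card_mult)
      fix i
      define A where "A = inverse \<sigma> *s (\<Phi> \<sigma> w - w)"
      have dA: "norm (A - V w) < \<eta>" using d(2)[OF \<sigma>(1) _ w] \<sigma>(2) s1(2) by (simp add: A_def dist_norm)
      have nA: "norm A \<le> M + \<eta>" using norm_triangle_ineq2[of A "V w"] dA M[OF w] by linarith
      \<comment> \<open>Step against field, field against target, and the cross term of dilation and
        step.\<close>
      have "e w $ i = (A - V w) $ i - ((w - hfield f w) $ i - q i w) - \<sigma> * A $ i"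
        using \<sigma>(1) by (simp add: e_def E_def A_def V_def field_simps)
      then have "norm (e w $ i) \<le> norm ((A - V w) $ i) + norm ((w - hfield f w) $ i - q i w) + norm (\<sigma> * A $ i)"
        by (metis norm_triangle_ineq4 order_trans add_right_mono)
      moreover have "norm ((A - V w) $ i) \<le> \<eta>" using Finite_Cartesian_Product.norm_nth_le[of "A - V w" i] dA by linarith
      moreover have "norm (\<sigma> * A $ i) \<le> \<eta>"
      proof -
        have "norm (\<sigma> * A $ i) \<le> s * (M + \<eta>)"
          unfolding norm_mult \<sigma>(2) using Finite_Cartesian_Product.norm_nth_le[of A i] nA s(1) by (intro mult_left_mono) auto
        then show ?thesis using s2 by linarith
      qed
      ultimately show "norm (e w $ i) \<le> 3 * \<eta>" using q(2)[OF w, of i] by linarith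
    qed
    have sub: "cball (0 :: complex^'n) r1 \<subseteq> unit_ball" using r1(2) by auto
    have e0: "e 0 = 0" by (simp add: e_def E0 h0)
    have "norm (E w - w + \<sigma> *s hfield f w) \<le> s * \<delta> * (norm w)\<^sup>2" if w: "w \<in> cball 0 r" for w
    proof -
      have "norm (e w) \<le> real CARD('n) * (real CARD('n) * (3 * \<eta>)) / (r1 * (r1 - r)) * (norm w)\<^sup>2"
        by (rule vanishing_order2_bound[OF ge e0 ed sub r1(1) eb]) (use w in auto)
      also have "real CARD('n) * (real CARD('n) * (3 * \<eta>)) / (r1 * (r1 - r)) = \<delta>"
        using n r1 by (simp add: \<eta>_def)
      finally have "norm (e w) \<le> \<delta> * (norm w)\<^sup>2" .
      moreover have "E w - w + \<sigma> *s hfield f w = \<sigma> *s e w"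
        using \<sigma>(1) by (simp add: e_def vec_eq_iff field_simps)
      ultimately show ?thesis using s(1) by (simp add: norm_smult_vec \<sigma>(2) mult_left_mono mult.assoc)
    qed
    then show "\<exists>E\<in>Aut_Cn. E 0 = 0 \<and> (E has_derivative (\<lambda>v. complex_of_real (1 - s) *s v)) (at 0) \<and>
      (\<forall>w\<in>cball 0 r. norm (E w - w + complex_of_real s *s hfield f w) \<le> s * \<delta> * (norm w)\<^sup>2)"
      using EA E0 Ed by (intro bexI[of _ E]) (auto simp: \<sigma>1[symmetric] \<sigma>_def[symmetric])
  qed
qed

text \<open>Balls of radius \<open>R\<close> around points of norm at most \<open>r\<close> stay
  inside \<open>cball 0 (r + R)\<close>, so one bound of \<open>f\<close> feeds all line estimates;
  half the radius keeps the geometric factor at most 2.\<close>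

lemma second_order_Taylor_bound:
  fixes f :: "complex^'n \<Rightarrow> complex^'n"
  assumes f: "cn_holomorphic_on f unit_ball" and r: "0 < r" "r < 1"
  obtains C L \<rho> where "C \<ge> 0" "L \<ge> 0" "\<rho> > 0"
    "\<And>w v. norm w \<le> r \<Longrightarrow> norm v \<le> \<rho> \<Longrightarrow> norm (f (w + v) - f w - Df f w *v v) \<le> C * (norm v)\<^sup>2"
    "\<And>w v. norm w \<le> r \<Longrightarrow> norm (Df f w *v v) \<le> L * norm v"
proof -
  define R where "R = (1 - r) / 2"
  have R: "R > 0" "r + R < 1" using r by (auto simp: R_def field_simps)
  note gf = cn_holomorphic_imp_line_hol[OF f open_ball]
  have "cball (0 :: complex^'n) (r + R) \<subseteq> unit_ball" using R by auto
  then obtain B where B: "B \<ge> 0" "\<And>z. z \<in> cball 0 (r + R) \<Longrightarrow> norm (f z) \<le> B"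
    using line_hol_components_bounded[OF gf] by blast
  have in_c: "x \<in> cball 0 (r + R)" if "norm w \<le> r" "x \<in> cball w R" for x w :: "complex^'n"
    using norm_triangle_sub[of x w] that by (simp add: dist_norm norm_minus_commute)
  have sub: "cball w R \<subseteq> unit_ball" if "norm w \<le> r" for w :: "complex^'n"
    using in_c[OF that] R by fastforce
  have Bi: "norm (f x $ i) \<le> B" if "norm w \<le> r" "x \<in> cball w R" for x w i
    using order_trans[OF Finite_Cartesian_Product.norm_nth_le B(2)[OF in_c[OF that]]] .
  show thesis
  proof (rule that[of "real CARD('n) * (2 * B / R\<^sup>2)" "real CARD('n) * (B / R)" "R / 2"])
    fix w v :: "complex^'n" assume w: "norm w \<le> r"
    have wb: "w \<in> unit_ball" using w r by simp
    have "norm ((Df f w *v v) $ i) \<le> B / R * norm v" for i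
      using line_deriv_bound[OF gf sub[OF w] Bi[OF w] R(1), of i v] line_deriv_component[OF f open_ball wb, of i v] by simp
    from norm_le_card_mult[OF this] show "norm (Df f w *v v) \<le> real CARD('n) * (B / R) * norm v" by (simp add: mult.assoc)
    assume v: "norm v \<le> R / 2"
    have "norm ((f (w + v) - f w - Df f w *v v) $ i) \<le> 2 * B / R\<^sup>2 * (norm v)\<^sup>2" for i
    proof -
      have "norm (f (w + v) $ i - f w $ i - line_deriv (\<lambda>z. f z $ i) w v) \<le> B * (norm v / R)\<^sup>2 / (1 - norm v / R)"
        by (rule line_hol_increment2[OF gf sub[OF w] Bi[OF w]]) (use v R in auto)
      also have "\<dots> \<le> B * (norm v / R)\<^sup>2 / (1 / 2)"
        using v R B(1) by (intro divide_left_mono) (auto simp: field_simps)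
      finally show ?thesis by (simp add: line_deriv_component[OF f open_ball wb] power_divide mult_ac)
    qed
    from norm_le_card_mult[OF this] show "norm (f (w + v) - f w - Df f w *v v) \<le> real CARD('n) * (2 * B / R\<^sup>2) * (norm v)\<^sup>2"
      by (simp add: mult.assoc)
  qed (use B R in auto)
qed

lemma of_real_smult: "complex_of_real a *s v = a *\<^sub>R (v :: complex^'n)"
  unfolding vec_eq_iff by (simp only: vector_smult_component vector_scaleR_component scaleR_conv_of_real[where 'a = complex] simp_thms)

text \<open>Near 0 the map is close to the identity; on the remaining compact shell its norm has a
  positive minimum.\<close>

lemma linear_lower_bound:
  fixes f :: "complex^'n \<Rightarrow> complex^'n"
  assumes f: "f \<in> LS_ball" and nz: "\<And>w. norm w \<le> r \<Longrightarrow> w \<noteq> 0 \<Longrightarrow> f w \<noteq> 0" and r: "0 < r" "r < 1"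
    and C: "C \<ge> 0" "\<And>w. norm w \<le> r \<Longrightarrow> norm (f w - w) \<le> C * (norm w)\<^sup>2"
  obtains m where "m > 0" "\<And>w. norm w \<le> r \<Longrightarrow> m * norm w \<le> norm (f w)"
proof -
  define \<rho> where "\<rho> = min r (1 / (2 * C + 1))"
  have \<rho>: "\<rho> > 0" "C * \<rho> \<le> 1 / 2"
  proof -
    show "\<rho> > 0" using r C(1) by (simp add: \<rho>_def)
    have "C * \<rho> \<le> C * (1 / (2 * C + 1))" using C(1) by (intro mult_left_mono) (auto simp: \<rho>_def)
    also have "\<dots> \<le> 1 / 2" using C(1) by (simp add: field_simps)
    finally show "C * \<rho> \<le> 1 / 2" .
  qed
  have small: "norm w / 2 \<le> norm (f w)" if "norm w \<le> \<rho>" for w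
  proof -
    have "norm (f w - w) \<le> C * (norm w)\<^sup>2" using that by (intro C(2)) (simp add: \<rho>_def)
    also have "\<dots> \<le> (C * \<rho>) * norm w"
      using that C(1) by (simp add: power2_eq_square mult.assoc[symmetric] mult_right_mono mult_left_mono)
    also have "\<dots> \<le> 1 / 2 * norm w" using \<rho>(2) by (intro mult_right_mono) auto
    finally show ?thesis using norm_triangle_ineq2[of w "w - f w"] by (simp add: norm_minus_commute)
  qed
  define K where "K = cball (0 :: complex^'n) r - ball 0 \<rho>"
  have "compact K" unfolding K_def by (intro compact_diff) auto
  moreover have "continuous_on K (\<lambda>w. norm (f w))"
    by (intro continuous_intros continuous_on_subset[OF cn_holomorphic_imp_continuous_on[OF LS_ball_props(1)[OF f]]])
      (use r in \<open>auto simp: K_def\<close>)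
  ultimately obtain \<mu> where \<mu>: "\<mu> > 0" "\<And>w. w \<in> K \<Longrightarrow> \<mu> \<le> norm (f w)"
  proof (cases "K = {}")
    case False
    assume "compact K" "continuous_on K (\<lambda>w. norm (f w))"
    from continuous_attains_inf[OF this(1) False this(2)]
    obtain x where x: "x \<in> K" "\<And>w. w \<in> K \<Longrightarrow> norm (f x) \<le> norm (f w)" by blast
    have "f x \<noteq> 0" using x(1) \<rho>(1) by (intro nz) (auto simp: K_def)
    then show thesis using that[of "norm (f x)"] x(2) by simp
  qed (use that[of 1] in auto)
  show thesis
  proof (rule that[of "min (1 / 2) \<mu>"])
    show "min (1 / 2) \<mu> > 0" using \<mu> by simp
    fix w :: "complex^'n" assume w: "norm w \<le> r"
    show "min (1 / 2) \<mu> * norm w \<le> norm (f w)"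
    proof (cases "norm w \<le> \<rho>")
      case True
      have "min (1 / 2) \<mu> * norm w \<le> 1 / 2 * norm w" by (intro mult_right_mono) auto
      then show ?thesis using small[OF True] by linarith
    next
      case False
      then have "\<mu> \<le> norm (f w)" using w by (intro \<mu>(2)) (auto simp: K_def)
      moreover have "min (1 / 2) \<mu> * norm w \<le> \<mu> * 1" using w r \<mu>(1) by (intro mult_mono) auto
      ultimately show ?thesis by linarith
    qed
  qed
qed

text \<open>By Taylor's formula and \<open>Df f w *v hfield f w = f w\<close>, the first-order
  change of \<open>f\<close> is -s f(w) plus the image of the step error. The norm does not grow
  because the displacement has inner product at most -(c/2)|w|^2 with \<open>w\<close>, which
  outweighs its square for small \<open>s\<close>.\<close>

lemma automorphism_semiconjugacy_step:
  fixes f :: "complex^'n \<Rightarrow> complex^'n"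
  assumes card: "CARD('n::finite) \<ge> 2" and f: "f \<in> LS_ball" and r: "0 < r" "r < 1"
    and c: "c > 0" "\<And>w. norm w \<le> r \<Longrightarrow> c * (norm w)\<^sup>2 \<le> hfield f w \<bullet> w"
    and \<delta>: "\<delta> > 0"
  obtains s E where "0 < s" "s \<le> 1 / 2" "E \<in> Aut_Cn" "E 0 = 0"
    "(E has_derivative (\<lambda>v. complex_of_real (1 - s) *s v)) (at 0)"
    "\<And>w. norm w \<le> r \<Longrightarrow> norm (E w) \<le> norm w"
    "\<And>w. norm w \<le> r \<Longrightarrow> norm (f (E w) - complex_of_real (1 - s) *s f w) \<le> s * \<delta> * (norm w)\<^sup>2"
proof -
  note p = LS_ball_props[OF f]
  note gh = line_hol_hfield[OF p(1) open_ball p(4)]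
  have h0: "hfield f 0 = 0" using hfield_normalized(1)[OF p(1) open_ball _ p(2,3,4)] by simp
  obtain C L \<rho> where C: "C \<ge> 0" and L: "L \<ge> 0" and \<rho>: "\<rho> > 0"
    and T: "\<And>w v. norm w \<le> r \<Longrightarrow> norm v \<le> \<rho> \<Longrightarrow> norm (f (w + v) - f w - Df f w *v v) \<le> C * (norm v)\<^sup>2"
    and LL: "\<And>w v. norm w \<le> r \<Longrightarrow> norm (Df f w *v v) \<le> L * norm v"
    using second_order_Taylor_bound[OF p(1) r] by blast
  define R where "R = (1 + r) / 2"
  have R: "r < R" "R < 1" using r by (auto simp: R_def)
  have sub: "cball (0 :: complex^'n) R \<subseteq> unit_ball" using R by auto
  obtain B where B: "B \<ge> 0" "\<And>z. z \<in> cball 0 R \<Longrightarrow> norm (hfield f z) \<le> B"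
    using line_hol_components_bounded[OF gh sub] by blast
  define M where "M = real CARD('n) * B / (R - r)"
  have M0: "M \<ge> 0" using B(1) R by (simp add: M_def)
  have M: "norm (hfield f w) \<le> M * norm w" if "norm w \<le> r" for w
    unfolding M_def by (rule vanishing_order1_bound[OF gh h0 sub R(1) B(2) that])
  \<comment> \<open>The first bound leaves half of the coercivity after the error is subtracted; the
    second keeps \<open>Df f\<close> of the error below \<open>\<delta> / 2\<close>.\<close>
  define \<delta>1 where "\<delta>1 = min (c / 2) (\<delta> / (2 * (L + 1)))"
  have \<delta>1: "\<delta>1 > 0" "\<delta>1 \<le> c / 2" "L * \<delta>1 \<le> \<delta> / 2"
  proof -
    show "\<delta>1 > 0" using c(1) \<delta> L by (simp add: \<delta>1_def)
    show "\<delta>1 \<le> c / 2" by (simp only: \<delta>1_def min.cobounded1)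
    have "L * \<delta>1 \<le> L * (\<delta> / (2 * (L + 1)))" using L by (intro mult_left_mono) (auto simp: \<delta>1_def)
    also have "\<dots> \<le> \<delta> / 2" using L \<delta> by (simp add: field_simps)
    finally show "L * \<delta>1 \<le> \<delta> / 2" .
  qed
  obtain s0 where s0: "s0 > 0" and st: "\<And>s. 0 < s \<Longrightarrow> s < s0 \<Longrightarrow>
    \<exists>E\<in>Aut_Cn. E 0 = 0 \<and> (E has_derivative (\<lambda>v. complex_of_real (1 - s) *s v)) (at 0) \<and>
      (\<forall>w\<in>cball 0 r. norm (E w - w + complex_of_real s *s hfield f w) \<le> s * \<delta>1 * (norm w)\<^sup>2)"
    using automorphism_Euler_step[OF card f r \<delta>1(1)] by blast
  define N where "N = M + \<delta>1"
  have N: "N > 0" using M0 \<delta>1 by (simp add: N_def)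
  \<comment> \<open>In order: existence of the step, \<open>1 - s \<ge> 1 / 2\<close>, validity of
    the Taylor bound, no growth of the norm, and a quadratic Taylor term of at most
    \<open>\<delta> / 2\<close>. \<open>N\<close> bounds the displacement per unit of time relative
    to \<open>norm w\<close>.\<close>
  define s where "s = min (s0 / 2) (min (1 / 2) (min (\<rho> / N) (min (c / N\<^sup>2) (\<delta> / (2 * (C + 1) * N\<^sup>2)))))"
  have s: "0 < s" "s < s0" "s \<le> 1 / 2" "s \<le> \<rho> / N" "s \<le> c / N\<^sup>2" "s \<le> \<delta> / (2 * (C + 1) * N\<^sup>2)"
  proof -
    show "0 < s" unfolding s_def min_less_iff_conj using s0 \<rho> N c(1) \<delta> C by auto
    have "s \<le> s0 / 2" by (simp only: s_def min_le_iff_disj order_refl simp_thms)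
    then show "s < s0" using s0 by linarith
  qed (simp_all only: s_def min_le_iff_disj order_refl simp_thms)
  have sN: "s * N \<le> \<rho>" "s * N\<^sup>2 \<le> c" "s * C * N\<^sup>2 \<le> \<delta> / 2"
  proof -
    show "s * N \<le> \<rho>" "s * N\<^sup>2 \<le> c" using s(4,5) N by (auto simp: field_simps)
    have "s * (C * N\<^sup>2) \<le> \<delta> / (2 * (C + 1) * N\<^sup>2) * (C * N\<^sup>2)" using s(6) C by (intro mult_right_mono) auto
    also have "\<dots> = \<delta> / 2 * (C / (C + 1))"
    proof -
      define P where "P = C + 1"
      have "P > 0" using C by (simp add: P_def)
      then show ?thesis unfolding P_def[symmetric] using N by (simp add: field_simps)
    qed
    also have "\<dots> \<le> \<delta> / 2 * 1" using \<delta> C by (intro mult_left_mono) auto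
    finally show "s * C * N\<^sup>2 \<le> \<delta> / 2" by (simp add: mult.assoc)
  qed
  obtain E where E: "E \<in> Aut_Cn" "E 0 = 0" "(E has_derivative (\<lambda>v. complex_of_real (1 - s) *s v)) (at 0)"
    and Ew: "\<And>w. w \<in> cball 0 r \<Longrightarrow> norm (E w - w + complex_of_real s *s hfield f w) \<le> s * \<delta>1 * (norm w)\<^sup>2"
    using st[OF s(1,2)] by blast
  define e where "e w = (1 / s) *\<^sub>R (E w - w + complex_of_real s *s hfield f w)" for w
  define k where "k w = e w - hfield f w" for w
  have Ek: "E w = w + s *\<^sub>R k w" for w
    using s(1) by (simp add: k_def e_def of_real_smult algebra_simps)
  have ne: "norm (e w) \<le> \<delta>1 * (norm w)\<^sup>2" if "norm w \<le> r" for w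
  proof -
    have "norm (e w) = (1 / s) * norm (E w - w + complex_of_real s *s hfield f w)"
      unfolding e_def norm_scaleR using s(1) by simp
    also have "\<dots> \<le> (1 / s) * (s * \<delta>1 * (norm w)\<^sup>2)"
      using Ew[of w] that s(1) by (intro mult_left_mono) auto
    finally show ?thesis using s(1) by simp
  qed
  have sq: "(norm w)\<^sup>2 \<le> norm w" if "norm w \<le> r" for w :: "complex^'n"
    using mult_left_mono[of "norm w" 1 "norm w"] that r by (simp add: power2_eq_square)
  have nk: "norm (k w) \<le> N * norm w" if w: "norm w \<le> r" for w
  proof -
    have "norm (k w) \<le> norm (e w) + norm (hfield f w)" unfolding k_def by (rule norm_triangle_ineq4)
    also have "\<dots> \<le> \<delta>1 * norm w + M * norm w"
      using ne[OF w] M[OF w] mult_left_mono[OF sq[OF w] less_imp_le[OF \<delta>1(1)]] by linarith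
    finally show ?thesis by (simp add: N_def algebra_simps)
  qed
  show thesis
  proof (rule that[OF s(1,3) E])
    fix w :: "complex^'n" assume w: "norm w \<le> r"
    have n2: "(norm (k w))\<^sup>2 \<le> N\<^sup>2 * (norm w)\<^sup>2"
      using power_mono[OF nk[OF w] norm_ge_zero, of 2] by (simp add: power_mult_distrib)
    have "k w \<bullet> w \<le> \<delta>1 * (norm w)\<^sup>2 - c * (norm w)\<^sup>2"
    proof -
      have "e w \<bullet> w \<le> norm (e w) * norm w" by (rule norm_cauchy_schwarz)
      also have "\<dots> \<le> (\<delta>1 * (norm w)\<^sup>2) * 1"
        using ne[OF w] w r \<delta>1(1) by (intro mult_mono) auto
      finally show ?thesis using c(2)[OF w] by (simp add: k_def inner_diff_left)
    qed
    also have "\<dots> \<le> - (c / 2) * (norm w)\<^sup>2"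
      using mult_right_mono[OF \<delta>1(2), of "(norm w)\<^sup>2"] by (simp add: algebra_simps)
    finally have kw: "k w \<bullet> w \<le> - (c / 2) * (norm w)\<^sup>2" .
    have "(norm (E w))\<^sup>2 = (norm w)\<^sup>2 + 2 * s * (k w \<bullet> w) + s\<^sup>2 * (norm (k w))\<^sup>2"
      unfolding Ek using dot_norm[of w "s *\<^sub>R k w"]
      by (simp add: inner_commute[of w] power_mult_distrib)
    also have "\<dots> \<le> (norm w)\<^sup>2 + 2 * s * (- (c / 2) * (norm w)\<^sup>2) + s\<^sup>2 * (N\<^sup>2 * (norm w)\<^sup>2)"
      using kw n2 s(1) by (intro add_mono mult_left_mono) auto
    also have "\<dots> = (norm w)\<^sup>2 + s * (norm w)\<^sup>2 * (s * N\<^sup>2 - c)" by (simp add: power2_eq_square algebra_simps)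
    also have "\<dots> \<le> (norm w)\<^sup>2" using sN(2) s(1) by (simp add: mult_nonneg_nonpos)
    finally show "norm (E w) \<le> norm w" using power2_le_imp_le norm_ge_zero by blast
    have wb: "w \<in> unit_ball" using w r by simp
    have "norm (s *\<^sub>R k w) \<le> s * (N * norm w)" using nk[OF w] s(1) by (simp add: mult_left_mono)
    also have "\<dots> \<le> s * (N * 1)" using w r s(1) N by (intro mult_left_mono) auto
    finally have "norm (s *\<^sub>R k w) \<le> \<rho>" using sN(1) by simp
    from T[OF w this]
    have 1: "norm (f (E w) - f w - Df f w *v (s *\<^sub>R k w)) \<le> C * (norm (s *\<^sub>R k w))\<^sup>2" by (simp add: Ek)
    have "C * (norm (s *\<^sub>R k w))\<^sup>2 = C * s\<^sup>2 * (norm (k w))\<^sup>2" by (simp add: power_mult_distrib)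
    also have "\<dots> \<le> C * s\<^sup>2 * (N\<^sup>2 * (norm w)\<^sup>2)" using n2 C by (intro mult_left_mono) auto
    also have "\<dots> = s * (s * C * N\<^sup>2) * (norm w)\<^sup>2" by (simp add: power2_eq_square)
    also have "\<dots> \<le> s * (\<delta> / 2) * (norm w)\<^sup>2" using sN(3) s(1) by (intro mult_right_mono mult_left_mono) auto
    finally have 2: "C * (norm (s *\<^sub>R k w))\<^sup>2 \<le> s * (\<delta> / 2) * (norm w)\<^sup>2" .
    have 3: "Df f w *v (s *\<^sub>R k w) = s *\<^sub>R (Df f w *v e w) - s *\<^sub>R f w"
    proof -
      have "Df f w *v (s *\<^sub>R k w) = s *\<^sub>R (Df f w *v k w)"
        by (simp only: of_real_smult[symmetric] vector_scalar_commute)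
      moreover have "Df f w *v k w = Df f w *v e w - f w"
        by (simp only: k_def matrix_vector_mult_diff_distrib Df_hfield[OF p(4)[OF wb]])
      ultimately show ?thesis by (simp only: scaleR_diff_right)
    qed
    have "norm (s *\<^sub>R (Df f w *v e w)) \<le> s * (L * (\<delta>1 * (norm w)\<^sup>2))"
      using order_trans[OF LL[OF w] mult_left_mono[OF ne[OF w] L]] s(1) by (simp add: mult_left_mono)
    also have "\<dots> = s * (L * \<delta>1) * (norm w)\<^sup>2" by simp
    also have "\<dots> \<le> s * (\<delta> / 2) * (norm w)\<^sup>2" using \<delta>1(3) s(1) by (intro mult_right_mono mult_left_mono) auto
    finally have 4: "norm (s *\<^sub>R (Df f w *v e w)) \<le> s * (\<delta> / 2) * (norm w)\<^sup>2" .
    have "f (E w) - complex_of_real (1 - s) *s f w = (f (E w) - f w - Df f w *v (s *\<^sub>R k w)) + s *\<^sub>R (Df f w *v e w)"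
      unfolding 3 of_real_smult by (simp add: algebra_simps)
    then have "norm (f (E w) - complex_of_real (1 - s) *s f w) \<le> norm (f (E w) - f w - Df f w *v (s *\<^sub>R k w)) + norm (s *\<^sub>R (Df f w *v e w))"
      by (metis norm_triangle_ineq)
    then show "norm (f (E w) - complex_of_real (1 - s) *s f w) \<le> s * \<delta> * (norm w)\<^sup>2" using 1 2 4 by (simp add: field_simps)
  qed
qed

section \<open>Iteration and rescaling of the automorphism\<close>

lemma Aut_Cn_funpow: "E \<in> Aut_Cn \<Longrightarrow> E ^^ k \<in> Aut_Cn"
proof (induction k)
  case 0
  then show ?case using Aut_Cn_id by (simp add: id_def)
next
  case (Suc k)
  from Aut_Cn_compose[OF Suc.prems Suc.IH[OF Suc.prems]] show ?case by (simp add: o_def)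
qed

text \<open>The exact derivative \<open>c\<close> at the fixed point is what lets division by
  \<open>c ^ k\<close> restore the normalisation.\<close>

lemma funpow_has_derivative_smult:
  fixes E :: "complex^'n \<Rightarrow> complex^'n"
  assumes "E 0 = 0" "(E has_derivative (\<lambda>v. c *s v)) (at 0)"
  shows "(E ^^ k) 0 = 0 \<and> ((E ^^ k) has_derivative (\<lambda>v. c ^ k *s v)) (at 0)"
proof (induction k)
  case 0
  show ?case by (simp add: id_def)
next
  case (Suc k)
  from diff_chain_at[of "E ^^ k" "\<lambda>v. c ^ k *s v" 0 E "\<lambda>v. c *s v"] Suc assms
  show ?case by (simp add: o_def)
qed

text \<open>The iterates \<open>E\<^sup>k\<close> contract to the origin, and \<open>f \<circ> E\<close> is close to \<open>(1 - s) f\<close> to second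
  order at the origin; hence \<open>(1 - s)\<^sup>-\<^sup>k (f \<circ> E\<^sup>k)\<close> stays close to \<open>f\<close> uniformly in \<open>k\<close>,
  while it differs from \<open>(1 - s)\<^sup>-\<^sup>k E\<^sup>k\<close> by a null sequence.\<close>

lemma iterate_semiconjugacy:
  fixes f E :: "'a::real_normed_vector \<Rightarrow> 'a"
  assumes s: "0 < s" "s \<le> 1 / 2"
    and E: "\<And>w. norm w \<le> r \<Longrightarrow> norm (E w) \<le> norm w"
    and fE: "\<And>w. norm w \<le> r \<Longrightarrow> norm (f (E w) - (1 - s) *\<^sub>R f w) \<le> s * \<delta> * (norm w)\<^sup>2"
    and m: "m > 0" "\<And>w. norm w \<le> r \<Longrightarrow> m * norm w \<le> norm (f w)"
    and B: "\<And>w. norm w \<le> r \<Longrightarrow> norm (f w) \<le> B"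
    and D: "D = ((B + 1) / m)\<^sup>2" "2 * \<delta> * D \<le> 1" "\<delta> \<ge> 0"
    and z: "norm z \<le> r"
  shows "norm ((E ^^ k) z) \<le> r \<and> (norm ((E ^^ k) z))\<^sup>2 \<le> D * ((1 - s) ^ k)\<^sup>2 \<and>
    norm ((1 / (1 - s) ^ k) *\<^sub>R f ((E ^^ k) z) - f z) \<le> 2 * \<delta> * D * (1 - (1 - s) ^ k)"
proof -
  define \<kappa> where "\<kappa> = 1 - s"
  have l: "\<kappa> > 0" "\<kappa> \<ge> 1 / 2" "\<kappa> \<le> 1" using s by (auto simp: \<kappa>_def)
  have D0: "D \<ge> 0" by (simp add: D)
  have B0: "B \<ge> 0" using B[OF z] norm_ge_zero order_trans by blast
  \<comment> \<open>Closeness forces contraction: the rescaled value has norm at most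
    \<open>B + 1\<close>, so the lower bound \<open>m\<close> gives
    \<open>norm w \<le> (B + 1) / m * \<kappa> ^ k\<close>, whence the constant
    \<open>D\<close>.\<close>
  have decay: "(norm w)\<^sup>2 \<le> D * (\<kappa> ^ k)\<^sup>2"
    if w: "norm w \<le> r" and G: "norm ((1 / \<kappa> ^ k) *\<^sub>R f w - f z) \<le> 2 * \<delta> * D * (1 - \<kappa> ^ k)" for w k
  proof -
    have "2 * \<delta> * D * (1 - \<kappa> ^ k) \<le> 1 * 1"
      using D D0 l by (intro mult_mono) (auto simp: power_le_one)
    then have "norm ((1 / \<kappa> ^ k) *\<^sub>R f w) \<le> B + 1"
      using norm_triangle_sub[of "(1 / \<kappa> ^ k) *\<^sub>R f w" "f z"] G B[OF z] by linarith
    then have "norm (f w) \<le> (B + 1) * \<kappa> ^ k" using l by (simp add: field_simps)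
    then have "norm w \<le> (B + 1) / m * \<kappa> ^ k" using m(2)[OF w] m(1) by (simp add: field_simps)
    from power_mono[OF this norm_ge_zero, of 2] show ?thesis by (simp add: D power_mult_distrib power_divide)
  qed
  \<comment> \<open>The bound has telescoping form: one step adds at most
    \<open>2 * s * \<delta> * D * \<kappa> ^ k\<close>, which is \<open>2 * \<delta> * D\<close>
    times the difference of consecutive powers of \<open>\<kappa>\<close>. Decay and closeness feed
    each other in the induction.\<close>
  have "norm ((E ^^ k) z) \<le> r \<and> norm ((1 / \<kappa> ^ k) *\<^sub>R f ((E ^^ k) z) - f z) \<le> 2 * \<delta> * D * (1 - \<kappa> ^ k)"
  proof (induction k)
    case 0
    then show ?case using z by simp
  next
    case (Suc k)
    define w where "w = (E ^^ k) z"
    have w: "norm w \<le> r" using Suc by (simp add: w_def)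
    have G: "norm ((1 / \<kappa> ^ k) *\<^sub>R f w - f z) \<le> 2 * \<delta> * D * (1 - \<kappa> ^ k)" using Suc by (simp add: w_def)
    define X Y where "X = (1 / \<kappa> ^ k) *\<^sub>R f w - f z" and "Y = f (E w) - \<kappa> *\<^sub>R f w"
    have eq: "(1 / \<kappa> ^ Suc k) *\<^sub>R f (E w) - f z = X + (1 / \<kappa> ^ Suc k) *\<^sub>R Y"
      using l by (simp add: scaleR_diff_right X_def Y_def)
    have "norm ((1 / \<kappa> ^ Suc k) *\<^sub>R f (E w) - f z) \<le> norm X + (1 / \<kappa> ^ Suc k) * norm Y"
      using norm_triangle_ineq[of X "(1 / \<kappa> ^ Suc k) *\<^sub>R Y"] l unfolding eq by simp
    also have "(1 / \<kappa> ^ Suc k) * norm Y \<le> (1 / \<kappa> ^ Suc k) * (s * \<delta> * (D * (\<kappa> ^ k)\<^sup>2))"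
    proof (intro mult_left_mono)
      have "norm (f (E w) - \<kappa> *\<^sub>R f w) \<le> s * \<delta> * (norm w)\<^sup>2" using fE[OF w] by (simp add: \<kappa>_def)
      also have "\<dots> \<le> s * \<delta> * (D * (\<kappa> ^ k)\<^sup>2)" using decay[OF w G] s D by (intro mult_left_mono) auto
      finally show "norm Y \<le> s * \<delta> * (D * (\<kappa> ^ k)\<^sup>2)" by (simp add: Y_def)
    qed (use l in auto)
    also have "\<dots> = (1 / \<kappa>) * (s * \<delta> * D * \<kappa> ^ k)" using l by (simp add: power2_eq_square field_simps)
    also have "\<dots> \<le> 2 * (s * \<delta> * D * \<kappa> ^ k)" using l s D D0 by (intro mult_right_mono) (auto simp: field_simps)
    finally have "norm ((1 / \<kappa> ^ Suc k) *\<^sub>R f (E w) - f z) \<le> 2 * \<delta> * D * (1 - \<kappa> ^ k) + 2 * (s * \<delta> * D * \<kappa> ^ k)"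
      using G unfolding X_def by linarith
    also have "\<dots> = 2 * \<delta> * D * (1 - \<kappa> ^ Suc k)" by (simp add: \<kappa>_def algebra_simps)
    finally show ?case using E[OF w] w by (simp add: w_def)
  qed
  then show ?thesis using decay by (simp add: \<kappa>_def)
qed

lemma starlike_automorphism_approximation:
  fixes f :: "complex^'n \<Rightarrow> complex^'n"
  assumes card: "CARD('n::finite) \<ge> 2" and f: "f \<in> LS_ball" and r: "0 < r" "r < 1"
    and c: "c > 0" "\<And>w. norm w \<le> r \<Longrightarrow> c * (norm w)\<^sup>2 \<le> hfield f w \<bullet> w"
    and \<epsilon>: "\<epsilon> > 0"
  obtains F where "F \<in> Aut_Cn" "F 0 = 0" "(F has_derivative (\<lambda>v. v)) (at 0)"
    "\<And>z. norm z \<le> r \<Longrightarrow> norm (F z - f z) \<le> \<epsilon>"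
proof -
  note p = LS_ball_props[OF f]
  note gf = cn_holomorphic_imp_line_hol[OF p(1) open_ball]
  define R where "R = (1 + r) / 2"
  have R: "r < R" "R < 1" using r by (auto simp: R_def)
  have sub: "cball (0 :: complex^'n) R \<subseteq> unit_ball" using R by auto
  have z0: "(0 :: complex^'n) \<in> unit_ball" by simp
  have gfi: "line_hol (\<lambda>z. (f z - z) $ i) unit_ball" for i
    using line_hol_diff[OF gf line_hol_nth, of i i] by simp
  have dfi: "line_deriv (\<lambda>z. (f z - z) $ i) 0 v = 0" for i v
    using line_deriv_diff[OF gf line_hol_nth open_ball z0, of i i v] line_deriv_component[OF p(1) open_ball z0, of i v]
    by (simp add: line_deriv_nth p(3))
  obtain B1 where B1: "B1 \<ge> 0" "\<And>z. z \<in> cball 0 R \<Longrightarrow> norm (f z - z) \<le> B1"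
    using line_hol_components_bounded[OF gfi sub] by blast
  define C where "C = real CARD('n) * B1 / (R * (R - r))"
  have C0: "C \<ge> 0" using B1(1) R r by (simp add: C_def)
  have C: "norm (f w - w) \<le> C * (norm w)\<^sup>2" if "norm w \<le> r" for w
    unfolding C_def by (rule vanishing_order2_bound[OF gfi _ dfi sub R(1) B1(2) that]) (simp add: p(2))
  \<comment> \<open>A zero of \<open>f\<close> is a zero of \<open>hfield f\<close>, which
    coercivity excludes away from 0.\<close>
  have nz: "f w \<noteq> 0" if "norm w \<le> r" "w \<noteq> 0" for w
  proof
    assume "f w = 0"
    then have "hfield f w = 0" by (simp add: hfield_def)
    then have "c * (norm w)\<^sup>2 \<le> 0" using c(2)[OF that(1)] by simp
    then show False using c(1) that(2) by (simp add: mult_le_0_iff)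
  qed
  obtain m where m: "m > 0" "\<And>w. norm w \<le> r \<Longrightarrow> m * norm w \<le> norm (f w)"
    using linear_lower_bound[OF f nz r C0 C] by blast
  obtain B where B: "B \<ge> 0" "\<And>z. z \<in> cball 0 R \<Longrightarrow> norm (f z) \<le> B"
    using line_hol_components_bounded[OF gf sub] by blast
  define D where "D = ((B + 1) / m)\<^sup>2"
  have D0: "D > 0" using B(1) m(1) by (simp add: D_def)
  \<comment> \<open>\<open>D\<close> depends only on \<open>f\<close> and \<open>r\<close>, so
    \<open>\<delta>\<close> is fixed before the step \<open>E\<close>. The iteration then costs at
    most half of \<open>\<epsilon>\<close>; the exponent \<open>k\<close>, chosen last, makes
    replacing \<open>f\<close> by the identity near 0 cost the other half.\<close>
  define \<delta> where "\<delta> = min 1 (\<epsilon> / 2) / (2 * D)"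
  have \<delta>: "\<delta> > 0" "2 * \<delta> * D \<le> 1" "2 * \<delta> * D \<le> \<epsilon> / 2" using D0 \<epsilon> by (auto simp: \<delta>_def)
  obtain s E where s: "0 < s" "s \<le> 1 / 2" and E: "E \<in> Aut_Cn" "E 0 = 0"
    "(E has_derivative (\<lambda>v. complex_of_real (1 - s) *s v)) (at 0)"
    and Ew: "\<And>w. norm w \<le> r \<Longrightarrow> norm (E w) \<le> norm w"
    and fE: "\<And>w. norm w \<le> r \<Longrightarrow> norm (f (E w) - complex_of_real (1 - s) *s f w) \<le> s * \<delta> * (norm w)\<^sup>2"
    using automorphism_semiconjugacy_step[OF card f r c \<delta>(1)] by blast
  have it: "norm ((E ^^ k) z) \<le> r \<and> (norm ((E ^^ k) z))\<^sup>2 \<le> D * ((1 - s) ^ k)\<^sup>2 \<and>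
    norm ((1 / (1 - s) ^ k) *\<^sub>R f ((E ^^ k) z) - f z) \<le> 2 * \<delta> * D * (1 - (1 - s) ^ k)" if "norm z \<le> r" for k z
    by (rule iterate_semiconjugacy[OF s Ew fE[unfolded of_real_smult] m B(2) D_def \<delta>(2) _ that]) (use R \<delta>(1) in auto)
  have "(\<lambda>k. C * D * (1 - s) ^ k) \<longlonglongrightarrow> C * D * 0"
    using s by (intro tendsto_intros LIMSEQ_power_zero) auto
  then have "\<forall>\<^sub>F k in sequentially. C * D * (1 - s) ^ k < \<epsilon> / 2"
    using \<epsilon> by (intro order_tendstoD(2)) auto
  then obtain k where k: "C * D * (1 - s) ^ k < \<epsilon> / 2" unfolding eventually_sequentially by blast
  define \<kappa> where "\<kappa> = (1 - s) ^ k"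
  have l: "\<kappa> > 0" "\<kappa> \<le> 1" using s by (auto simp: \<kappa>_def power_le_one)
  define F where "F z = complex_of_real (1 / \<kappa>) *s (E ^^ k) z" for z
  show thesis
  proof (rule that[of F])
    have "complex_of_real (1 / \<kappa>) \<noteq> 0" using l by simp
    from Aut_Cn_compose[OF Aut_Cn_smult[OF this] Aut_Cn_funpow[OF E(1), of k]]
    show "F \<in> Aut_Cn" by (simp add: F_def[abs_def])
    note fp = funpow_has_derivative_smult[OF E(2,3), of k]
    show "F 0 = 0" using fp by (simp add: F_def)
    have "(F has_derivative (\<lambda>v. complex_of_real (1 / \<kappa>) *s (complex_of_real (1 - s) ^ k *s v))) (at 0)"
      unfolding F_def[abs_def]
      using has_derivative_smult[OF has_derivative_const conjunct2[OF fp], of "complex_of_real (1 / \<kappa>)"] by simp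
    moreover have "complex_of_real (1 / \<kappa>) *s (complex_of_real (1 - s) ^ k *s v) = v" for v :: "complex^'n"
    proof -
      have "complex_of_real (1 - s) ^ k = complex_of_real \<kappa>" by (simp only: \<kappa>_def of_real_power)
      then show ?thesis by (simp only: of_real_smult scaleR_scaleR) (use l in simp)
    qed
    ultimately show "(F has_derivative (\<lambda>v. v)) (at 0)" by simp
    fix z :: "complex^'n" assume z: "norm z \<le> r"
    define w where "w = (E ^^ k) z"
    have w: "norm w \<le> r" "(norm w)\<^sup>2 \<le> D * \<kappa>\<^sup>2" "norm ((1 / \<kappa>) *\<^sub>R f w - f z) \<le> 2 * \<delta> * D * (1 - \<kappa>)"
      using it[OF z, of k] by (auto simp: w_def \<kappa>_def)
    \<comment> \<open>Since \<open>w\<close> is of order \<open>\<kappa>\<close>, the difference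
      \<open>w - f w\<close> is quadratic in \<open>\<kappa>\<close> and remains small after
      division by \<open>\<kappa>\<close>.\<close>
    have "norm ((1 / \<kappa>) *\<^sub>R (w - f w)) \<le> (1 / \<kappa>) * (C * (D * \<kappa>\<^sup>2))"
      using order_trans[OF C[OF w(1)] mult_left_mono[OF w(2) C0]] l
      by (simp add: norm_minus_commute divide_right_mono)
    also have "\<dots> = C * D * \<kappa>" using l by (simp add: power2_eq_square)
    also have "\<dots> < \<epsilon> / 2" using k by (simp add: \<kappa>_def)
    finally have 1: "norm ((1 / \<kappa>) *\<^sub>R (w - f w)) < \<epsilon> / 2" .
    have "2 * \<delta> * D * (1 - \<kappa>) \<le> 2 * \<delta> * D * 1" using \<delta>(1) D0 l by (intro mult_left_mono) auto
    then have 2: "norm ((1 / \<kappa>) *\<^sub>R f w - f z) \<le> \<epsilon> / 2" using w(3) \<delta>(3) by linarith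
    have "F z - f z = (1 / \<kappa>) *\<^sub>R (w - f w) + ((1 / \<kappa>) *\<^sub>R f w - f z)"
      unfolding F_def of_real_smult w_def by (simp add: scaleR_diff_right)
    then have "norm (F z - f z) \<le> norm ((1 / \<kappa>) *\<^sub>R (w - f w)) + norm ((1 / \<kappa>) *\<^sub>R f w - f z)"
      by (metis norm_triangle_ineq)
    then show "norm (F z - f z) \<le> \<epsilon>" using 1 2 by linarith
  qed
qed

section \<open>Starlike dilations of approximating automorphisms\<close>

lemma Aut_Cn_det_nonzero:
  fixes F :: "complex^'n \<Rightarrow> complex^'n"
  assumes "F \<in> Aut_Cn"
  shows "det (Df F z) \<noteq> 0"
proof -
  have F: "cn_holomorphic_on F UNIV" "cn_holomorphic_on (inv F) UNIV" "bij F"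
    using assms by (auto simp: Aut_Cn_def)
  show ?thesis
    by (rule det_nonzero_of_left_inverse[OF cn_holomorphic_has_derivative[OF F(1)]
          cn_holomorphic_has_derivative[OF F(2)], of z UNIV])
      (use F(3) in \<open>auto simp: bij_is_inj\<close>)
qed

text \<open>The chain rule cancels the two dilation factors in the derivative, so the quotient of
  the dilation at \<open>z\<close> is that of \<open>F\<close> at \<open>\<rho>\<close> times
  \<open>z\<close>; control on radius \<open>\<rho>\<close> therefore gives starlikeness on the
  whole ball.\<close>

lemma dilated_automorphism_starlike:
  fixes F :: "complex^'n \<Rightarrow> complex^'n"
  assumes F: "F \<in> Aut_Cn" "F 0 = 0" "(F has_derivative (\<lambda>v. v)) (at 0)" and \<rho>: "0 < \<rho>"
    and st: "\<And>z. norm z < \<rho> \<Longrightarrow> z \<noteq> 0 \<Longrightarrow> herm_inner (hfield F z) z / of_real ((norm z)\<^sup>2) \<in> g ` ball 0 1"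
  defines "\<Psi> \<equiv> restrict (\<lambda>z. complex_of_real (1 / \<rho>) *s F (complex_of_real \<rho> *s z)) unit_ball"
  shows "\<Psi> \<in> g_starlike g \<inter> A_ball"
proof -
  define \<Theta> where "\<Theta> z = complex_of_real (1 / \<rho>) *s F (complex_of_real \<rho> *s z)" for z
  have Psi: "\<Psi> = restrict \<Theta> unit_ball" by (simp add: \<Psi>_def \<Theta>_def[abs_def])
  have c: "complex_of_real \<rho> \<noteq> 0" "complex_of_real (1 / \<rho>) \<noteq> 0" using \<rho> by auto
  from Aut_Cn_compose[OF Aut_Cn_smult[OF c(2)] Aut_Cn_compose[OF F(1) Aut_Cn_smult[OF c(1)]]]
  have TA: "\<Theta> \<in> Aut_Cn" by (simp add: \<Theta>_def[abs_def])
  note Th = Aut_Cn_holomorphic[OF TA]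
  have derT: "(\<Theta> has_derivative (*v) (Df F (complex_of_real \<rho> *s z))) (at z)" for z
  proof -
    have "(F has_derivative (*v) (Df F (complex_of_real \<rho> *s z))) (at (complex_of_real \<rho> *s z))"
      by (rule cn_holomorphic_has_derivative[OF Aut_Cn_holomorphic[OF F(1)]]) auto
    moreover have "((\<lambda>z. complex_of_real \<rho> *s z) has_derivative (\<lambda>v. complex_of_real \<rho> *s v)) (at z)"
      using has_derivative_smult[OF has_derivative_const has_derivative_ident, of "complex_of_real \<rho>" z UNIV] by simp
    ultimately have "((\<lambda>z. F (complex_of_real \<rho> *s z)) has_derivative (\<lambda>v. Df F (complex_of_real \<rho> *s z) *v (complex_of_real \<rho> *s v))) (at z)"
      using diff_chain_at[of "\<lambda>z. complex_of_real \<rho> *s z"] by (fastforce simp: o_def)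
    from has_derivative_smult[OF has_derivative_const this, of "complex_of_real (1 / \<rho>)"]
    have "(\<Theta> has_derivative (\<lambda>v. complex_of_real (1 / \<rho>) *s (Df F (complex_of_real \<rho> *s z) *v (complex_of_real \<rho> *s v)))) (at z)"
      by (simp add: \<Theta>_def[abs_def])
    moreover have "complex_of_real (1 / \<rho>) *s (A *v (complex_of_real \<rho> *s v)) = A *v v" for A :: "complex^'n^'n" and v
      using c by (simp add: vector_scalar_commute[symmetric])
    ultimately show ?thesis by simp
  qed
  have der: "(\<Psi> has_derivative (*v) (Df F (complex_of_real \<rho> *s z))) (at z)" if "z \<in> unit_ball" for z
    by (rule has_derivative_transform_within_open[OF derT open_ball that]) (simp add: Psi)
  have DP: "Df \<Psi> z = Df F (complex_of_real \<rho> *s z)" if "z \<in> unit_ball" for z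
    by (rule Df_unique[OF der[OF that]])
  have hol: "cn_holomorphic_on \<Psi> unit_ball"
    unfolding cn_holomorphic_on_def using der has_derivative_at_withinI by blast
  have "\<Psi> \<in> H_ball" unfolding H_ball_def using hol by (simp add: Psi)
  moreover have "cn_locally_biholomorphic_on \<Psi> unit_ball"
    by (rule locally_biholomorphicI[OF hol open_ball]) (simp add: DP Aut_Cn_det_nonzero[OF F(1)])
  moreover have "\<Psi> 0 = 0" by (simp add: Psi \<Theta>_def F(2))
  moreover have "Df \<Psi> 0 = mat 1"
  proof -
    have "(\<lambda>v :: complex^'n. v) = (*v) (mat 1)" by (simp add: fun_eq_iff)
    then have "Df F 0 = mat 1" using F(3) by (intro Df_unique) simp
    then show ?thesis using DP[of 0] by simp
  qed
  ultimately have "\<Psi> \<in> LS_ball" by (simp add: LS_ball_def)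
  moreover have "herm_inner (matrix_inv (Df \<Psi> z) *v \<Psi> z) z / of_real ((norm z)\<^sup>2) \<in> g ` ball 0 1"
    if z: "z \<in> unit_ball - {0}" for z
  proof -
    define y where "y = complex_of_real \<rho> *s z"
    have ny: "norm y = \<rho> * norm z" using \<rho> by (simp add: y_def norm_smult_vec)
    have "matrix_inv (Df \<Psi> z) *v \<Psi> z = complex_of_real (1 / \<rho>) *s hfield F y"
      using z DP[of z] by (simp add: Psi \<Theta>_def hfield_def y_def vector_scalar_commute[symmetric])
    then have "herm_inner (matrix_inv (Df \<Psi> z) *v \<Psi> z) z / of_real ((norm z)\<^sup>2) =
        complex_of_real (1 / \<rho>) * herm_inner (hfield F y) z / of_real ((norm z)\<^sup>2)"
      by (simp only: herm_inner_smult)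
    also have "\<dots> = herm_inner (hfield F y) y / of_real ((norm y)\<^sup>2)"
      unfolding ny using c(1) z by (simp add: y_def herm_inner_smult power2_eq_square field_simps)
    also have "\<dots> \<in> g ` ball 0 1"
    proof (rule st)
      show "norm y < \<rho>" using z \<rho> by (simp add: ny)
      show "y \<noteq> 0" using z c(1) by (simp add: y_def)
    qed
    finally show ?thesis .
  qed
  ultimately have "\<Psi> \<in> g_starlike g" by (simp add: g_starlike_def)
  moreover have "\<Psi> \<in> A_ball" using TA by (auto simp: A_ball_def Psi)
  ultimately show ?thesis by blast
qed

lemma dilation_approximation:
  fixes f :: "complex^'n \<Rightarrow> complex^'n"
  assumes f: "continuous_on unit_ball f" and r: "0 < r" "r < 1" and e: "e > 0"
  obtains \<rho> where "r < \<rho>" "\<rho> < 1"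
    "\<And>z. norm z \<le> r \<Longrightarrow> norm (complex_of_real (1 / \<rho>) *s f (complex_of_real \<rho> *s z) - f z) < e"
proof -
  have cf: "continuous_on (cball 0 r) f" by (rule continuous_on_subset[OF f]) (use r in auto)
  have uc: "uniformly_continuous_on (cball 0 r) f"
    by (intro compact_uniformly_continuous cf) auto
  have "bounded (f ` cball 0 r)" by (intro compact_imp_bounded compact_continuous_image cf) auto
  then obtain B where B: "\<And>z. z \<in> cball 0 r \<Longrightarrow> norm (f z) \<le> B" unfolding bounded_iff by blast
  obtain d where d: "d > 0" "\<And>x y. x \<in> cball 0 r \<Longrightarrow> y \<in> cball 0 r \<Longrightarrow> dist y x < d \<Longrightarrow> dist (f y) (f x) < e / 4"
    using uc e unfolding uniformly_continuous_on_def by (metis divide_pos_pos zero_less_numeral)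
  \<comment> \<open>Displacement of the argument plus change of the outer factor; the limit is
    \<open>e / 4\<close>, below \<open>e\<close>.\<close>
  have lim: "((\<lambda>\<rho>. e / 4 / \<rho> + B * (1 / \<rho> - 1)) \<longlongrightarrow> e / 4 / 1 + B * (1 / 1 - 1)) (at_left 1)"
    by (intro tendsto_intros) auto
  have "\<forall>\<^sub>F \<rho> in at_left 1. e / 4 / \<rho> + B * (1 / \<rho> - 1) < e"
    by (rule order_tendstoD(2)[OF lim]) (use e in simp)
  moreover have "\<forall>\<^sub>F \<rho> in at_left 1. max r (1 - d) < \<rho> \<and> \<rho> < 1"
    unfolding eventually_at_left_field using r d(1) by (intro exI[of _ "max r (1 - d)"]) auto
  ultimately have "\<forall>\<^sub>F \<rho> in at_left (1::real). e / 4 / \<rho> + B * (1 / \<rho> - 1) < e \<and> max r (1 - d) < \<rho> \<and> \<rho> < 1"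
    by (rule eventually_conj)
  then obtain \<rho> where \<rho>: "e / 4 / \<rho> + B * (1 / \<rho> - 1) < e" "max r (1 - d) < \<rho>" "\<rho> < 1"
    using eventually_happens'[OF trivial_limit_at_left_real] by blast
  show thesis
  proof (rule that[of \<rho>])
    show "r < \<rho>" "\<rho> < 1" using \<rho> by auto
    have p: "0 < \<rho>" using \<rho>(2) r by linarith
    fix z :: "complex^'n" assume z: "norm z \<le> r"
    define y where "y = complex_of_real \<rho> *s z"
    have "norm y \<le> 1 * r" using z p \<rho>(3) r unfolding y_def norm_smult_vec by (intro mult_mono) auto
    then have y: "y \<in> cball 0 r" by simp
    have "y - z = (\<rho> - 1) *\<^sub>R z" by (simp only: y_def of_real_smult scaleR_diff_left scaleR_one)
    then have "dist y z = (1 - \<rho>) * norm z" using \<rho>(3) by (simp add: dist_norm)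
    also have "\<dots> \<le> (1 - \<rho>) * 1" using z r \<rho>(3) by (intro mult_left_mono) auto
    finally have "dist y z < d" using \<rho>(2) by simp
    then have 1: "norm (f y - f z) < e / 4" using d(2)[of z y] y z by (simp add: dist_norm)
    have "complex_of_real (1 / \<rho>) *s f y - f z = (1 / \<rho>) *\<^sub>R (f y - f z) + (1 / \<rho> - 1) *\<^sub>R f z"
      unfolding of_real_smult by (simp add: algebra_simps)
    then have "norm (complex_of_real (1 / \<rho>) *s f y - f z) \<le> norm ((1 / \<rho>) *\<^sub>R (f y - f z)) + norm ((1 / \<rho> - 1) *\<^sub>R f z)"
      by (simp only: norm_triangle_ineq)
    also have "\<dots> = (1 / \<rho>) * norm (f y - f z) + (1 / \<rho> - 1) * norm (f z)"
      using p \<rho>(3) unfolding norm_scaleR by simp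
    also have "\<dots> \<le> (1 / \<rho>) * (e / 4) + (1 / \<rho> - 1) * B"
      using 1 B[of z] z p \<rho>(3) by (intro add_mono mult_left_mono) auto
    also have "\<dots> < e" using \<rho>(1) by (simp add: mult.commute)
    finally show "norm (complex_of_real (1 / \<rho>) *s f (complex_of_real \<rho> *s z) - f z) < e" by (simp add: y_def)
  qed
qed

text \<open>The image of \<open>cball 0 \<rho>\<close> under \<open>g\<close> is compact in the open
  image of the disc, which leaves room for an error. The quotient divides by |z|^2, so the fields
  must be close relative to \<open>norm z\<close>; they are, as both vanish at 0.\<close>

lemma starlike_nearby:
  fixes f :: "complex^'n \<Rightarrow> complex^'n"
  assumes g: "g holomorphic_on ball 0 1" "inj_on g (ball 0 1)" "g 0 = 1"
    and f: "f \<in> g_starlike g" and r: "0 < \<rho>" "\<rho> < r" "r < 1"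
    and F: "\<And>k::nat. F k \<in> Aut_Cn" "\<And>k. F k 0 = 0" and lim: "uniform_limit (cball 0 r) F f sequentially"
  shows "\<forall>\<^sub>F k in sequentially. \<forall>z. norm z < \<rho> \<longrightarrow> z \<noteq> 0 \<longrightarrow>
    herm_inner (hfield (F k) z) z / of_real ((norm z)\<^sup>2) \<in> g ` ball 0 1"
proof -
  have fL: "f \<in> LS_ball" using f by (simp add: g_starlike_def)
  note p = LS_ball_props[OF fL]
  define R where "R = (\<rho> + r) / 2"
  have R: "\<rho> < R" "R < r" using r by (auto simp: R_def)
  have sub: "cball (0 :: complex^'n) R \<subseteq> unit_ball" "cball (0 :: complex^'n) r \<subseteq> unit_ball" using R r by auto
  have Fh: "cn_holomorphic_on (F k) unit_ball" for k
    using Aut_Cn_holomorphic[OF F(1)[of k]] unfolding cn_holomorphic_on_def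
    using has_derivative_at_withinI by (metis UNIV_I)
  have dF: "det (Df (F k) z) \<noteq> 0" for k z by (rule Aut_Cn_det_nonzero[OF F(1)])
  have "compact (g ` cball 0 \<rho>)"
    using r by (intro compact_continuous_image continuous_on_subset[OF holomorphic_on_imp_continuous_on[OF g(1)]]) auto
  moreover have "open (g ` ball 0 1)" by (rule open_mapping_thm3[OF g(1) open_ball g(2)])
  moreover have "g ` cball 0 \<rho> \<subseteq> g ` ball 0 1" using r by (intro image_mono) auto
  moreover have "g ` cball 0 \<rho> \<noteq> {}" using r by simp
  ultimately obtain \<epsilon> where \<epsilon>: "\<epsilon> > 0" "{x. infdist x (g ` cball 0 \<rho>) \<le> \<epsilon>} \<subseteq> g ` ball 0 1"
    using compact_in_open_separated[of "g ` cball 0 \<rho>" "g ` ball 0 1"] by blast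
  define \<eta> where "\<eta> = \<epsilon> * (R - \<rho>) / real CARD('n)"
  have \<eta>: "\<eta> > 0" using \<epsilon>(1) R by (simp add: \<eta>_def)
  have "uniform_limit (cball 0 R) (\<lambda>k. hfield (F k)) (hfield f) sequentially"
    by (rule uniform_limit_hfield[OF Fh p(1) open_ball sub(2) R(2) lim dF p(4)])
  from uniform_limitD[OF this \<eta>] show ?thesis
  proof eventually_elim
    case (elim k)
    show ?case
    proof (intro allI impI)
      fix z :: "complex^'n" assume z: "norm z < \<rho>" "z \<noteq> 0"
      define H where "H w = hfield (F k) w - hfield f w" for w
      have "norm (H z) \<le> real CARD('n) * \<eta> / (R - \<rho>) * norm z"
      proof (rule vanishing_order1_bound[OF _ _ sub(1) R(1)])
        show "line_hol (\<lambda>z. H z $ i) unit_ball" for i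
          using line_hol_diff[OF line_hol_hfield[OF Fh[of k] open_ball dF] line_hol_hfield[OF p(1) open_ball p(4)], of i i]
          by (simp add: H_def)
        show "H 0 = 0" by (simp add: H_def hfield_def F(2) p(2))
        show "norm (H w) \<le> \<eta>" if "w \<in> cball 0 R" for w
          using elim that by (fastforce simp: H_def dist_norm)
      qed (use z in auto)
      also have "real CARD('n) * \<eta> / (R - \<rho>) = \<epsilon>" using R by (simp add: \<eta>_def)
      finally have Hz: "norm (H z) \<le> \<epsilon> * norm z" .
      define a where "a = herm_inner (hfield f z) z / of_real ((norm z)\<^sup>2)"
      define b where "b = herm_inner (hfield (F k) z) z / of_real ((norm z)\<^sup>2)"
      have "a \<in> g ` cball 0 (norm z)" unfolding a_def using z r by (intro starlike_Schwarz[OF g f]) auto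
      then have a: "a \<in> g ` cball 0 \<rho>" using z by fastforce
      have "b - a = herm_inner (H z) z / of_real ((norm z)\<^sup>2)"
        by (simp only: a_def b_def H_def herm_inner_diff_left diff_divide_distrib)
      then have "norm (b - a) = norm (herm_inner (H z) z) / (norm z)\<^sup>2"
        by (simp add: norm_divide norm_power)
      also have "\<dots> \<le> (\<epsilon> * norm z * norm z) / (norm z)\<^sup>2"
        using order_trans[OF norm_herm_inner_le mult_right_mono[OF Hz norm_ge_zero]] by (intro divide_right_mono) auto
      also have "\<dots> = \<epsilon>" using z(2) by (simp add: power2_eq_square)
      finally have "dist b a \<le> \<epsilon>" by (simp add: dist_norm)
      then have "infdist b (g ` cball 0 \<rho>) \<le> \<epsilon>" by (rule infdist_le2[OF a])
      then show "herm_inner (hfield (F k) z) z / of_real ((norm z)\<^sup>2) \<in> g ` ball 0 1"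
        using \<epsilon>(2) by (auto simp: b_def)
    qed
  qed
qed

text \<open>Three radii: \<open>K\<close> lies in radius \<open>r0\<close>, the dilation uses
  \<open>\<rho> > r0\<close> close to 1, and the approximation takes place on radius
  \<open>r > \<rho>\<close>, which leaves room for derivative estimates.\<close>

lemma starlike_dense:
  fixes f :: "complex^'n \<Rightarrow> complex^'n"
  assumes g: "g holomorphic_on ball 0 1" "inj_on g (ball 0 1)" "g 0 = 1" "\<And>\<zeta>. \<zeta> \<in> ball 0 1 \<Longrightarrow> Re (g \<zeta>) > 0"
    and card: "CARD('n::finite) \<ge> 2" and f: "f \<in> g_starlike g"
    and K: "compact K" "K \<subseteq> unit_ball" "e > 0"
  shows "\<exists>k \<in> g_starlike g \<inter> A_ball. \<forall>z\<in>K. dist (k z) (f z) < e"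
proof -
  have fL: "f \<in> LS_ball" using f by (simp add: g_starlike_def)
  note p = LS_ball_props[OF fL]
  obtain r0 where r0: "0 < r0" "r0 < 1" "K \<subseteq> cball 0 r0"
    using compact_subset_ball[OF K(1,2)] by auto
  obtain \<rho> where \<rho>: "r0 < \<rho>" "\<rho> < 1" and app: "\<And>z. norm z \<le> r0 \<Longrightarrow>
      norm (complex_of_real (1 / \<rho>) *s f (complex_of_real \<rho> *s z) - f z) < e / 2"
    using dilation_approximation[OF cn_holomorphic_imp_continuous_on[OF p(1)] r0(1,2), of "e / 2"] K(3) by auto
  define r where "r = (1 + \<rho>) / 2"
  have r: "0 < r" "\<rho> < r" "r < 1" and \<rho>0: "0 < \<rho>" using \<rho> r0 by (auto simp: r_def)
  obtain c where c: "c > 0" "\<And>w. norm w \<le> r \<Longrightarrow> c * (norm w)\<^sup>2 \<le> hfield f w \<bullet> w"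
    using starlike_coercive[OF g f less_imp_le[OF r(1)] r(3)] by blast
  have "\<exists>F. F \<in> Aut_Cn \<and> F 0 = 0 \<and> (F has_derivative (\<lambda>v. v)) (at 0) \<and>
      (\<forall>z. norm z \<le> r \<longrightarrow> norm (F z - f z) \<le> inverse (real (Suc k)))" for k
  proof -
    have "inverse (real (Suc k)) > 0" by (rule positive_imp_inverse_positive) simp
    from starlike_automorphism_approximation[OF card fL r(1,3) c this] show ?thesis by metis
  qed
  then obtain F where F: "\<And>k. F k \<in> Aut_Cn" "\<And>k. F k 0 = 0" "\<And>k. (F k has_derivative (\<lambda>v. v)) (at 0)"
    "\<And>k z. norm z \<le> r \<Longrightarrow> norm (F k z - f z) \<le> inverse (real (Suc k))"
    by metis
  have small: "\<forall>\<^sub>F k in sequentially. inverse (real (Suc k)) < x" if "x > 0" for x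
    using LIMSEQ_inverse_real_of_nat that by (rule order_tendstoD(2))
  have "uniform_limit (cball 0 r) F f sequentially"
  proof (rule uniform_limitI)
    fix x :: real assume "x > 0"
    from small[OF this] show "\<forall>\<^sub>F k in sequentially. \<forall>z\<in>cball 0 r. dist (F k z) (f z) < x"
    proof eventually_elim
      case (elim k)
      show ?case using order_le_less_trans[OF F(4) elim] by (simp add: dist_norm)
    qed
  qed
  \<comment> \<open>The factor \<open>\<rho>\<close> in the tolerance compensates for the outer
    factor \<open>1 / \<rho>\<close> of the dilation.\<close>
  from starlike_nearby[OF g(1-3) f \<rho>0 r(2,3) F(1,2) this] small[of "\<rho> * e / 2"]
  have "\<forall>\<^sub>F k in sequentially. (\<forall>z. norm z < \<rho> \<longrightarrow> z \<noteq> 0 \<longrightarrow>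
    herm_inner (hfield (F k) z) z / of_real ((norm z)\<^sup>2) \<in> g ` ball 0 1) \<and> inverse (real (Suc k)) < \<rho> * e / 2"
    using \<rho>0 K(3) by (intro eventually_conj) auto
  then obtain k where k: "\<And>z. norm z < \<rho> \<Longrightarrow> z \<noteq> 0 \<Longrightarrow> herm_inner (hfield (F k) z) z / of_real ((norm z)\<^sup>2) \<in> g ` ball 0 1"
    "inverse (real (Suc k)) < \<rho> * e / 2"
    unfolding eventually_sequentially by blast
  define \<Psi> where "\<Psi> = restrict (\<lambda>z. complex_of_real (1 / \<rho>) *s F k (complex_of_real \<rho> *s z)) unit_ball"
  have "\<Psi> \<in> g_starlike g \<inter> A_ball"
    unfolding \<Psi>_def by (rule dilated_automorphism_starlike[OF F(1-3) \<rho>0 k(1)])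
  moreover have "dist (\<Psi> z) (f z) < e" if z: "z \<in> K" for z
  proof -
    define y where "y = complex_of_real \<rho> *s z"
    have nz: "norm z \<le> r0" using z r0(3) by auto
    have "norm y \<le> 1 * r" using nz r0 r \<rho> \<rho>0 unfolding y_def norm_smult_vec by (intro mult_mono) auto
    then have "norm (F k y - f y) < \<rho> * e / 2" using F(4)[of y k] k(2) by simp
    then have "(1 / \<rho>) * norm (F k y - f y) < e / 2" using \<rho>0 by (simp add: field_simps)
    then have 1: "norm (complex_of_real (1 / \<rho>) *s (F k y - f y)) < e / 2"
      using \<rho>0 by (simp only: of_real_smult norm_scaleR) simp
    have "\<Psi> z - f z = complex_of_real (1 / \<rho>) *s (F k y - f y) + (complex_of_real (1 / \<rho>) *s f y - f z)"
      using subsetD[OF K(2) z] by (simp add: \<Psi>_def y_def vector_ssub_ldistrib)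
    then have "norm (\<Psi> z - f z) \<le> norm (complex_of_real (1 / \<rho>) *s (F k y - f y)) + norm (complex_of_real (1 / \<rho>) *s f y - f z)"
      by (simp only: norm_triangle_ineq)
    then show ?thesis using 1 app[OF nz] by (simp add: dist_norm y_def)
  qed
  ultimately show ?thesis by blast
qed

theorem theorem4p4:
  fixes g :: "complex \<Rightarrow> complex"
  assumes "g holomorphic_on ball 0 1"
    and "inj_on g (ball 0 1)"
    and "g 0 = 1"
    and "\<And>\<zeta>. \<zeta> \<in> ball 0 1 \<Longrightarrow> Re (g \<zeta>) > 0"
    and "CARD('n::finite) \<ge> 2"
  shows "(g_starlike g :: (complex^'n \<Rightarrow> complex^'n) set) =
    H_topology closure_of (g_starlike g \<inter> A_ball)"
proof
  show "H_topology closure_of (g_starlike g \<inter> A_ball) \<subseteq> (g_starlike g :: (complex^'n \<Rightarrow> complex^'n) set)"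
    using g_starlike_closed[OF assms(1-3)] by blast
  show "(g_starlike g :: (complex^'n \<Rightarrow> complex^'n) set) \<subseteq> H_topology closure_of (g_starlike g \<inter> A_ball)"
  proof
    fix f :: "complex^'n \<Rightarrow> complex^'n" assume f: "f \<in> g_starlike g"
    have H: "g_starlike g \<subseteq> (H_ball :: (complex^'n \<Rightarrow> complex^'n) set)"
      by (auto simp: g_starlike_def LS_ball_def)
    show "f \<in> H_topology closure_of (g_starlike g \<inter> A_ball)"
      by (rule closure_of_H_topologyI) (use f H starlike_dense[OF assms f] in auto)
  qed
qed

end
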